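(* For $R>0$ let $D_R\subset\mathbb{C}$ denote the disk of radius $R$ centered at $0$. Let $\lambda>0$ be a smooth radial function on $\mathbb{C}$ that is nondecreasing (as a function of the radius), and define the (also radial) potential $$u=\frac{\Delta\sqrt{\lambda}}{\sqrt{\lambda}}.$$ If $D_R$ undergoes elliptic growth with operator $\Delta-u$ and singularity at the origin, then this produces an increasing family of disks centered at $0$, with areas changing at the rate $$\frac{d}{dt}\,\mathrm{area}(D_R)=\frac{\sqrt{\lambda(0)}}{\sqrt{\lambda(R)}},$$ where $R=R(t)$ is the radius at the time considered.
   Context: For radial $\lambda$, $\lambda(R)$ denotes the common value of $\lambda$ on the circle $|z|=R$. Elliptic growth of Schrödinger type with operator $\Delta-u$ ($u$ smooth and real) and singularity $w$: a growing family of bounded domains $D(t)$ containing $w$, with boundaries smooth enough to have an outward normal velocity $v_n$, such that $v_n=\partial_n g_w$ on $\partial D(t)$ for each $t$. Here $g_w$ is the Green function of $\Delta-u$ on $D(t)$ with singularity $w$, with the sign convention $(\Delta-u)g_w=\delta_w$ in $D(t)$ and $g_w=0$ on $\partial D(t)$, and $\partial_n$ is the outward normal derivative. *)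

theory Defs
  imports "HOL-Analysis.Analysis"
begin

(* On open sets S: f is k times continuously differentiable on S. *)
primrec Ck_on :: "nat \<Rightarrow> ('a::euclidean_space \<Rightarrow> real) \<Rightarrow> 'a set \<Rightarrow> bool" where
  "Ck_on 0 f S \<longleftrightarrow> continuous_on S f"
| "Ck_on (Suc k) f S \<longleftrightarrow>
     (\<exists>G. (\<forall>x\<in>S. GDERIV f x :> G x) \<and> (\<forall>b\<in>Basis. Ck_on k (\<lambda>x. G x \<bullet> b) S))"

definition smooth_on :: "('a::euclidean_space \<Rightarrow> real) \<Rightarrow> 'a set \<Rightarrow> bool" where
  "smooth_on f S \<longleftrightarrow> (\<forall>k. Ck_on k f S)"

definition laplacian :: "('a::euclidean_space \<Rightarrow> real) \<Rightarrow> 'a \<Rightarrow> real" where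
  "laplacian f z = (\<Sum>b\<in>Basis. deriv (deriv (\<lambda>s. f (z + s *\<^sub>R b))) 0)"

definition test_function_on :: "'a::euclidean_space set \<Rightarrow> ('a \<Rightarrow> real) \<Rightarrow> bool" where
  "test_function_on D \<phi> \<longleftrightarrow>
     smooth_on \<phi> UNIV \<and> compact (closure {z. \<phi> z \<noteq> 0}) \<and> closure {z. \<phi> z \<noteq> 0} \<subseteq> D"

(* (Laplacian - u) g = delta_w on the open set D, in the sense of distributions. *)
definition fundamental_eq ::
    "(complex \<Rightarrow> real) \<Rightarrow> complex set \<Rightarrow> complex \<Rightarrow> (complex \<Rightarrow> real) \<Rightarrow> bool" where
  "fundamental_eq u D w g \<longleftrightarrow>
     (\<forall>K. compact K \<and> K \<subseteq> D \<longrightarrow> g absolutely_integrable_on K) \<and>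
     (\<forall>\<phi>. test_function_on D \<phi> \<longrightarrow>
        integral D (\<lambda>z. g z * (laplacian \<phi> z - u z * \<phi> z)) = \<phi> w)"

(* The C2 and logarithmic-singularity clauses single out the classical representative of the
   distributional solution; for smooth u they are automatic by elliptic regularity.
   With this sign convention g tends to minus infinity at w. *)
definition green_function ::
    "(complex \<Rightarrow> real) \<Rightarrow> complex set \<Rightarrow> complex \<Rightarrow> (complex \<Rightarrow> real) \<Rightarrow> bool" where
  "green_function u D w g \<longleftrightarrow>
     fundamental_eq u D w g \<and>
     Ck_on 2 g (D - {w}) \<and>
     (\<forall>z\<in>D - {w}. laplacian g z - u z * g z = 0) \<and>
     (\<exists>B. eventually (\<lambda>z. \<bar>g z - ln (cmod (z - w)) / (2 * pi)\<bar> \<le> B) (at w)) \<and>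
     continuous_on (closure D - {w}) g \<and>
     (\<forall>x\<in>frontier D. g x = 0)"

(* Near (t, x) the moving domain is {Phi(s, y) < 0} for a C1 function Phi of time and space
   with nonzero spatial gradient q at (t, x). The outward unit normal of D t at x is then
   n = q / |q|, and differentiating Phi(s, y(s)) = 0 along a boundary point y(s) gives the
   normal velocity v = - Phi_t / |q|.  Only times s in I matter, so that at an endpoint
   of I the motion is one-sided. *)
definition moves_with_normal_velocity ::
    "real set \<Rightarrow> (real \<Rightarrow> complex set) \<Rightarrow> real \<Rightarrow> complex \<Rightarrow> complex \<Rightarrow> real \<Rightarrow> bool" where
  "moves_with_normal_velocity I D t x n v \<longleftrightarrow>
     (\<exists>U \<Phi> p q. open U \<and> (t, x) \<in> U \<and> Ck_on 1 \<Phi> U \<and>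
        (\<forall>s y. (s, y) \<in> U \<and> s \<in> I \<longrightarrow> (y \<in> D s \<longleftrightarrow> \<Phi> (s, y) < 0)) \<and>
        GDERIV \<Phi> (t, x) :> (p, q) \<and> q \<noteq> 0 \<and>
        n = q /\<^sub>R norm q \<and> v = - p / norm q)"

(* g is only defined on the inner side of the boundary, hence the one-sided derivative. *)
definition has_outward_normal_derivative ::
    "(complex \<Rightarrow> real) \<Rightarrow> complex \<Rightarrow> complex \<Rightarrow> real \<Rightarrow> bool" where
  "has_outward_normal_derivative g x n v \<longleftrightarrow>
     ((\<lambda>h. g (x + h *\<^sub>R n)) has_real_derivative v) (at_left 0)"

definition elliptic_growth ::
    "(complex \<Rightarrow> real) \<Rightarrow> complex \<Rightarrow> real set \<Rightarrow> (real \<Rightarrow> complex set) \<Rightarrow> bool" where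
  "elliptic_growth u w I D \<longleftrightarrow>
     (\<forall>t\<in>I. open (D t) \<and> connected (D t) \<and> bounded (D t) \<and> w \<in> D t) \<and>
     (\<forall>s\<in>I. \<forall>t\<in>I. s \<le> t \<longrightarrow> D s \<subseteq> D t) \<and>
     (\<forall>t\<in>I. \<exists>g. green_function u (D t) w g \<and>
        (\<forall>x\<in>frontier (D t). \<exists>n v. moves_with_normal_velocity I D t x n v \<and>
            has_outward_normal_derivative g x n v))"

end

theory Submission
  imports Defs
begin

text \<open>
  Write \<open>p = \<surd>\<lambda>\<close>, which solves \<open>(\<Delta> - u) p = 0\<close>. If \<open>F' = k / (2\<lambda>)\<close> as functions of \<open>s = |z|\<^sup>2\<close>, then
  \<open>g = p F\<close> satisfies \<open>(\<Delta> - u) g = (2 k + 2 s k') / p\<close>. The choice \<open>k = c / s\<close> gives the Green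
  function of a disk, with normal derivative \<open>p(0) / (2 \<pi> R p(R))\<close> on the boundary; \<open>k = c / (s + e)\<close>
  gives smooth approximations to it whose images under \<open>\<Delta> - u\<close> form an approximate identity, whence
  the distributional equation. So the disks whose area grows at the rate \<open>p(0) / p(R)\<close> are an
  elliptic growth.

  For uniqueness, the positive solution \<open>p\<close> yields a maximum principle, hence monotonicity of the Green
  function in the domain. Where the boundary of \<open>D t\<close> touches that of a disk containing it (contained
  in it), its normal velocity is at most (at least) that of the disk. Disks moving slightly
  faster (slower) than required are therefore never touched, and \<open>D t\<close> is squeezed to a disk.
\<close>

section \<open>Second-order calculus and the Laplacian\<close>

text \<open>The substitution \<open>g = p F\<close> conjugates the operator to divergence form:
  since \<open>\<Delta> p = u p\<close>, \<open>(\<Delta> - u) (p F)\<close> is the divergence of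
  \<open>p\<^sup>2\<close> times the gradient of F, divided by p. For F a function of
  \<open>s = |z|\<^sup>2\<close> this flux is \<open>2 \<lambda> F' z\<close>; naming
  \<open>k = 2 \<lambda> F'\<close> leaves the divergence of \<open>k z\<close>, in which \<lambda>
  no longer occurs.

  Comparison of Green functions gives only weak inequalities between normal derivatives. The
  barriers therefore run by a factor \<open>k \<noteq> 1\<close> too fast or too slow and start with
  an offset \<open>b\<close>, which makes contact contradictory; both perturbations tend to zero at
  the end. The motion law speaks only about neighbourhoods of boundary points, so the outer barrier
  must also exclude new pieces that appear elsewhere, and connectedness does this. The inner barrier
  draws the corresponding control from the monotonicity of the family. Monotonicity of \<lambda>
  bounds p below by its value at 0, so the squared radius has bounded speed and its flow exists for
  all times.\<close>

definition C2_on :: "('a::euclidean_space \<Rightarrow> real) \<Rightarrow> ('a \<Rightarrow> 'a) \<Rightarrow> ('a \<Rightarrow> 'a \<Rightarrow> 'a) \<Rightarrow> 'a set \<Rightarrow> bool" where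
  "C2_on f G H S \<longleftrightarrow>
     (\<forall>x\<in>S. GDERIV f x :> G x) \<and>
     (\<forall>b\<in>Basis. \<forall>x\<in>S. GDERIV (\<lambda>y. G y \<bullet> b) x :> H b x) \<and>
     (\<forall>b\<in>Basis. \<forall>b'\<in>Basis. continuous_on S (\<lambda>x. H b x \<bullet> b'))"

text \<open>Unfolding \<open>Ck_on\<close> twice leaves a separate hidden gradient for each basis
  vector; choice bundles them into one \<open>H\<close>. Afterwards gradients and Hessians are data
  that formulas can name.\<close>

lemma Ck_on_2_iff: "Ck_on 2 f S \<longleftrightarrow> (\<exists>G H. C2_on f G H S)"
proof
  assume "Ck_on 2 f S"
  then obtain G where G: "\<forall>x\<in>S. GDERIV f x :> G x"
    and *: "\<forall>b\<in>Basis. \<exists>H. (\<forall>x\<in>S. GDERIV (\<lambda>y. G y \<bullet> b) x :> H x) \<and>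
        (\<forall>b'\<in>Basis. continuous_on S (\<lambda>x. H x \<bullet> b'))"
    by (auto simp: numeral_2_eq_2)
  from bchoice[OF *] show "\<exists>G H. C2_on f G H S"
    using G unfolding C2_on_def by blast
next
  assume "\<exists>G H. C2_on f G H S"
  then show "Ck_on 2 f S"
    unfolding C2_on_def numeral_2_eq_2 by (simp, blast)
qed

lemma GDERIV_slice:
  assumes "GDERIV f (x + s *\<^sub>R b) :> D"
  shows "((\<lambda>s. f (x + s *\<^sub>R b)) has_real_derivative D \<bullet> b) (at s)"
proof -
  have 1: "((\<lambda>s. x + s *\<^sub>R b) has_derivative (\<lambda>h. h *\<^sub>R b)) (at s)"
    by (auto intro!: derivative_eq_intros)
  have 2: "(f has_derivative (\<lambda>h. h \<bullet> D)) (at (x + s *\<^sub>R b))"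
    using assms by (simp add: gderiv_def)
  show ?thesis
    using has_derivative_compose[OF 1 2] unfolding has_field_derivative_def
    by (rule has_derivative_eq_rhs) (simp add: inner_commute fun_eq_iff)
qed

lemma GDERIV_isCont: "GDERIV f x :> D \<Longrightarrow> isCont f x"
  unfolding gderiv_def by (rule has_derivative_continuous)

lemma GDERIV_cmult: "GDERIV f x :> D \<Longrightarrow> GDERIV (\<lambda>x. c * f x) x :> c *\<^sub>R D"
  using GDERIV_mult[OF GDERIV_const[of c x]] by simp

lemma GDERIV_inner: "GDERIV (\<lambda>y. y \<bullet> b) x :> b"
  unfolding gderiv_def by (auto intro!: derivative_eq_intros)

lemma GDERIV_norm_squared: "GDERIV (\<lambda>y. (norm y)\<^sup>2) x :> 2 *\<^sub>R x"
  unfolding gderiv_def power2_norm_eq_inner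
  by (auto intro!: derivative_eq_intros simp: inner_commute)

lemma continuous_on_componentwise_Basis:
  fixes f :: "'b::topological_space \<Rightarrow> 'a::euclidean_space"
  assumes "\<And>b. b \<in> Basis \<Longrightarrow> continuous_on S (\<lambda>x. f x \<bullet> b)"
  shows "continuous_on S f"
proof -
  have "continuous_on S (\<lambda>x. \<Sum>b\<in>Basis. (f x \<bullet> b) *\<^sub>R b)"
    using assms by (intro continuous_on_sum continuous_on_scaleR continuous_on_const) auto
  then show ?thesis
    by (simp add: euclidean_representation)
qed

lemma C2_on_continuous:
  assumes "C2_on f G H S"
  shows "continuous_on S f" "continuous_on S G" "b \<in> Basis \<Longrightarrow> continuous_on S (H b)"
proof -
  show "continuous_on S f"
    using assms GDERIV_isCont[of f] unfolding C2_on_def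
    by (intro continuous_at_imp_continuous_on) fast
  show "continuous_on S G"
  proof (rule continuous_on_componentwise_Basis, intro continuous_at_imp_continuous_on ballI)
    show "isCont (\<lambda>x. G x \<bullet> b) x" if "b \<in> Basis" "x \<in> S" for b x
      by (rule GDERIV_isCont[of _ _ "H b x"]) (use assms that in \<open>simp add: C2_on_def\<close>)
  qed
  show "continuous_on S (H b)" if "b \<in> Basis"
    using assms that unfolding C2_on_def
    by (intro continuous_on_componentwise_Basis[of S "H b"]) blast
qed

text \<open>\<open>laplacian\<close> is built from \<open>deriv\<close>, which has an arbitrary
  value where no derivative exists. This relation also records that the two derivatives along each
  axis exist, so that linear combinations and the second derivative test are legitimate.\<close>

definition has_laplacian :: "('a::euclidean_space \<Rightarrow> real) \<Rightarrow> 'a \<Rightarrow> real \<Rightarrow> bool" where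
  "has_laplacian f z L \<longleftrightarrow> (\<exists>d e.
     (\<forall>b\<in>Basis. (\<forall>\<^sub>F s in nhds 0. ((\<lambda>s. f (z + s *\<^sub>R b)) has_real_derivative d b s) (at s)) \<and>
        (d b has_real_derivative e b) (at 0)) \<and> L = (\<Sum>b\<in>Basis. e b))"

lemma has_laplacian_imp_laplacian:
  assumes "has_laplacian f z L"
  shows "laplacian f z = L"
proof -
  obtain d e where
    d: "\<And>b. b \<in> Basis \<Longrightarrow> \<forall>\<^sub>F s in nhds 0. ((\<lambda>s. f (z + s *\<^sub>R b)) has_real_derivative d b s) (at s)"
    and e: "\<And>b. b \<in> Basis \<Longrightarrow> (d b has_real_derivative e b) (at 0)"
    and L: "L = (\<Sum>b\<in>Basis. e b)"
    using assms unfolding has_laplacian_def by blast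
  have "deriv (deriv (\<lambda>s. f (z + s *\<^sub>R b))) 0 = e b" if "b \<in> Basis" for b
  proof -
    have "\<forall>\<^sub>F s in nhds 0. deriv (\<lambda>s. f (z + s *\<^sub>R b)) s = d b s"
      using d[OF that] by eventually_elim (rule DERIV_imp_deriv)
    then have "deriv (deriv (\<lambda>s. f (z + s *\<^sub>R b))) 0 = deriv (d b) 0"
      by (rule deriv_cong_ev) simp
    also have "\<dots> = e b"
      using e[OF that] by (rule DERIV_imp_deriv)
    finally show ?thesis .
  qed
  then show ?thesis
    unfolding laplacian_def L by (rule sum.cong[OF refl])
qed

lemma has_laplacian_lincomb:
  assumes "has_laplacian f z L" "has_laplacian g z M"
  shows "has_laplacian (\<lambda>x. a * f x + c * g x) z (a * L + c * M)"
proof -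
  obtain d e where
    d: "\<And>b. b \<in> Basis \<Longrightarrow> \<forall>\<^sub>F s in nhds 0. ((\<lambda>s. f (z + s *\<^sub>R b)) has_real_derivative d b s) (at s)"
    and e: "\<And>b. b \<in> Basis \<Longrightarrow> (d b has_real_derivative e b) (at 0)"
    and L: "L = (\<Sum>b\<in>Basis. e b)"
    using assms unfolding has_laplacian_def by blast
  obtain d' e' where
    d': "\<And>b. b \<in> Basis \<Longrightarrow> \<forall>\<^sub>F s in nhds 0. ((\<lambda>s. g (z + s *\<^sub>R b)) has_real_derivative d' b s) (at s)"
    and e': "\<And>b. b \<in> Basis \<Longrightarrow> (d' b has_real_derivative e' b) (at 0)"
    and M: "M = (\<Sum>b\<in>Basis. e' b)"
    using assms unfolding has_laplacian_def by blast
  have "\<forall>\<^sub>F s in nhds 0. ((\<lambda>s. a * f (z + s *\<^sub>R b) + c * g (z + s *\<^sub>R b))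
      has_real_derivative a * d b s + c * d' b s) (at s)" if "b \<in> Basis" for b
    using d[OF that] d'[OF that] by eventually_elim (auto intro!: derivative_eq_intros)
  moreover have "((\<lambda>s. a * d b s + c * d' b s) has_real_derivative a * e b + c * e' b) (at 0)"
    if "b \<in> Basis" for b
    using e[OF that] e'[OF that] by (auto intro!: derivative_eq_intros)
  moreover have "a * L + c * M = (\<Sum>b\<in>Basis. a * e b + c * e' b)"
    by (simp add: L M sum.distrib sum_distrib_left)
  ultimately show ?thesis
    unfolding has_laplacian_def
    by (intro exI[of _ "\<lambda>b s. a * d b s + c * d' b s"] exI[of _ "\<lambda>b. a * e b + c * e' b"]) simp
qed

lemma C2_on_has_laplacian:
  assumes f: "C2_on f G H S" and "open S" "z \<in> S"
  shows "has_laplacian f z (\<Sum>b\<in>Basis. H b z \<bullet> b)"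
proof -
  have "\<forall>\<^sub>F s in nhds 0. ((\<lambda>s. f (z + s *\<^sub>R b)) has_real_derivative G (z + s *\<^sub>R b) \<bullet> b) (at s)"
    for b
  proof -
    have "((\<lambda>s. z + s *\<^sub>R b) \<longlongrightarrow> z + 0 *\<^sub>R b) (nhds 0)"
      by (intro tendsto_intros filterlim_ident)
    then have "\<forall>\<^sub>F s in nhds 0. z + s *\<^sub>R b \<in> S"
      using topological_tendstoD assms by fastforce
    then show ?thesis
    proof eventually_elim
      case (elim s)
      then show ?case
        using f by (intro GDERIV_slice) (simp add: C2_on_def)
    qed
  qed
  moreover have "((\<lambda>s. G (z + s *\<^sub>R b) \<bullet> b) has_real_derivative H b z \<bullet> b) (at 0)"
    if "b \<in> Basis" for b
    using f that \<open>z \<in> S\<close> GDERIV_slice[of "\<lambda>y. G y \<bullet> b" z 0 b "H b z"] by (auto simp: C2_on_def)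
  ultimately show ?thesis
    unfolding has_laplacian_def
    by (intro exI[of _ "\<lambda>b s. G (z + s *\<^sub>R b) \<bullet> b"] exI[of _ "\<lambda>b. H b z \<bullet> b"]) simp
qed

lemma Ck_on_2_has_laplacian:
  assumes "Ck_on 2 f S" "open S" "z \<in> S"
  shows "has_laplacian f z (laplacian f z)"
proof -
  obtain G H where "C2_on f G H S"
    using assms Ck_on_2_iff by blast
  from C2_on_has_laplacian[OF this assms(2,3)] show ?thesis
    using has_laplacian_imp_laplacian by metis
qed

text \<open>At a minimum \<open>d 0 = 0\<close>, so \<open>e < 0\<close> would make \<open>d\<close>
  negative just to the right of 0, and the mean value theorem would push \<open>\<phi>\<close> below
  its minimum.\<close>

lemma second_derivative_nonneg_at_local_min:
  fixes \<phi> :: "real \<Rightarrow> real"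
  assumes d: "\<forall>\<^sub>F s in nhds 0. (\<phi> has_real_derivative d s) (at s)"
    and e: "(d has_real_derivative e) (at 0)"
    and min: "\<forall>\<^sub>F s in nhds 0. \<phi> 0 \<le> \<phi> s"
  shows "e \<ge> 0"
proof (rule ccontr)
  assume "\<not> e \<ge> 0"
  from d min have "\<forall>\<^sub>F s in nhds 0. (\<phi> has_real_derivative d s) (at s) \<and> \<phi> 0 \<le> \<phi> s"
    by eventually_elim auto
  then obtain r where r: "r > 0"
    and D: "\<And>s. \<bar>s\<bar> < r \<Longrightarrow> (\<phi> has_real_derivative d s) (at s)"
    and M: "\<And>s. \<bar>s\<bar> < r \<Longrightarrow> \<phi> 0 \<le> \<phi> s"
    unfolding eventually_nhds_metric dist_real_def by auto
  have d0: "d 0 = 0"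
    using DERIV_local_min[of \<phi> "d 0" 0 r] D[of 0] M r by (auto simp: abs_minus_commute)
  obtain r' where r': "r' > 0" "\<And>h. h > 0 \<Longrightarrow> h < r' \<Longrightarrow> d h < d 0"
    using DERIV_neg_dec_right[OF e] \<open>\<not> e \<ge> 0\<close> by auto
  define h where "h = min r r' / 2"
  have h: "0 < h" "h < r" "h < r'"
    using r r' by (auto simp: h_def min_def)
  obtain l where l: "0 < l" "l < h" "\<phi> h - \<phi> 0 = (h - 0) * d l"
    using MVT2[of 0 h \<phi> d] D h by (metis abs_of_nonneg dual_order.strict_trans1 less_eq_real_def)
  have "d l < 0"
    using r'(2)[of l] l h d0 by auto
  then have "h * d l < 0"
    using h by (simp add: mult_pos_neg)
  then have "\<phi> h < \<phi> 0"
    using l by simp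
  then show False
    using M[of h] h by auto
qed

lemma has_laplacian_local_min:
  assumes "has_laplacian f z L" and min: "\<forall>\<^sub>F y in nhds z. f z \<le> f y"
  shows "L \<ge> 0"
proof -
  obtain d e where
    d: "\<And>b. b \<in> Basis \<Longrightarrow> \<forall>\<^sub>F s in nhds 0. ((\<lambda>s. f (z + s *\<^sub>R b)) has_real_derivative d b s) (at s)"
    and e: "\<And>b. b \<in> Basis \<Longrightarrow> (d b has_real_derivative e b) (at 0)"
    and L: "L = (\<Sum>b\<in>Basis. e b)"
    using assms unfolding has_laplacian_def by blast
  have "e b \<ge> 0" if "b \<in> Basis" for b
  proof (rule second_derivative_nonneg_at_local_min[OF d[OF that] e[OF that]])
    have "((\<lambda>s. z + s *\<^sub>R b) \<longlongrightarrow> z + 0 *\<^sub>R b) (nhds 0)"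
      by (intro tendsto_intros filterlim_ident)
    then have "filterlim (\<lambda>s. z + s *\<^sub>R b) (nhds z) (nhds 0)"
      by simp
    from eventually_compose_filterlim[OF min this]
    show "\<forall>\<^sub>F s in nhds 0. f (z + 0 *\<^sub>R b) \<le> f (z + s *\<^sub>R b)"
      by simp
  qed
  then show ?thesis
    unfolding L by (rule sum_nonneg)
qed

text \<open>Carries the regularity of \<lambda> over to the solution \<open>sqrt \<lambda>\<close>;
  positivity keeps the square root away from its singular point.\<close>

lemma Ck_on_2_sqrt:
  assumes "Ck_on 2 f S" and pos: "\<And>x. x \<in> S \<Longrightarrow> f x > 0"
  shows "Ck_on 2 (\<lambda>x. sqrt (f x)) S"
proof -
  obtain G H where f: "C2_on f G H S"
    using assms Ck_on_2_iff by blast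
  define P where "P = (\<lambda>x. inverse (2 * sqrt (f x)))"
  define G' where "G' = (\<lambda>x. P x *\<^sub>R G x)"
  have 1: "GDERIV (\<lambda>x. sqrt (f x)) x :> G' x" if "x \<in> S" for x
    using GDERIV_DERIV_compose[of f x "G x" sqrt] f that pos[OF that] DERIV_real_sqrt[of "f x"]
    by (simp add: C2_on_def G'_def P_def inverse_eq_divide divide_simps mult.commute)
  define P' where "P' = (\<lambda>x. - (P x)\<^sup>2 *\<^sub>R (2 *\<^sub>R G' x))"
  have P': "GDERIV P x :> P' x" if "x \<in> S" for x
    unfolding P_def P'_def
    by (rule GDERIV_inverse[OF GDERIV_cmult[OF 1[OF that]]]) (use pos that in fastforce)
  define H' where "H' = (\<lambda>b x. P x *\<^sub>R H b x + (G x \<bullet> b) *\<^sub>R P' x)"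
  have 2: "GDERIV (\<lambda>y. G' y \<bullet> b) x :> H' b x" if "x \<in> S" "b \<in> Basis" for x b
    using GDERIV_mult[OF P'[OF that(1)], of "\<lambda>y. G y \<bullet> b" "H b x"] f that
    by (simp add: C2_on_def G'_def H'_def)
  have P: "continuous_on S P"
    using P' by (meson GDERIV_isCont continuous_at_imp_continuous_on)
  have "continuous_on S (\<lambda>x. H' b x \<bullet> b')" if "b \<in> Basis" for b b'
    unfolding H'_def P'_def G'_def
    using P C2_on_continuous[OF f] that by (intro continuous_intros) auto
  then have "C2_on (\<lambda>x. sqrt (f x)) G' H' S"
    using 1 2 by (auto simp: C2_on_def)
  then show ?thesis
    using Ck_on_2_iff by blast
qed

section \<open>Radial solutions\<close>

text \<open>The integrand may blow up at \<open>c\<close>, as \<open>1 / s\<close> does for the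
  Green function, so the primitive lives on the open half-line and is normalised at \<open>b\<close>
  instead of \<open>c\<close>.\<close>

lemma antiderivative_right:
  fixes f :: "real \<Rightarrow> real"
  assumes "\<And>x. x > c \<Longrightarrow> isCont f x"
  shows "\<exists>F. F b = 0 \<and> (\<forall>x>c. (F has_real_derivative f x) (at x))"
proof -
  have "\<exists>F. \<forall>x::real. ereal c < x \<longrightarrow> x < \<infinity> \<longrightarrow> (F has_vector_derivative f x) (at x)"
    by (rule einterval_antiderivative) (use assms in auto)
  then obtain F where F: "\<And>x. x > c \<Longrightarrow> (F has_real_derivative f x) (at x)"
    by (auto simp: has_real_derivative_iff_has_vector_derivative)
  have "\<forall>x>c. ((\<lambda>x. F x - F b) has_real_derivative f x) (at x)"
    using F by (auto intro!: derivative_eq_intros)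
  then show ?thesis
    by (intro exI[of _ "\<lambda>x. F x - F b"]) simp
qed

text \<open>Here \<open>p\<close> stands for the square root of \<lambda>. Its gradient and Hessian
  are parameters, so that those of \<open>p F\<close> can be written as closed formulas.\<close>

locale radial_potential =
  fixes p :: "complex \<Rightarrow> real" and Gp :: "complex \<Rightarrow> complex"
    and Hp :: "complex \<Rightarrow> complex \<Rightarrow> complex" and u :: "complex \<Rightarrow> real"
  assumes p_C2: "C2_on p Gp Hp UNIV"
    and p_pos: "p z > 0"
    and p_radial: "cmod z = cmod z' \<Longrightarrow> p z = p z'"
    and p_mono: "0 \<le> r \<Longrightarrow> r \<le> s \<Longrightarrow> p (complex_of_real r) \<le> p (complex_of_real s)"
    and u_eq: "u z = laplacian p z / p z"
begin

text \<open>The real square root is odd, so \<open>q\<close> is an even continuous extension of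
  \<open>\<lambda>(\<surd>s)\<close> to all of the line.\<close>

definition q :: "real \<Rightarrow> real" where
  "q s = (p (complex_of_real (sqrt s)))\<^sup>2"

definition radial_fun :: "(real \<Rightarrow> real) \<Rightarrow> complex \<Rightarrow> real" where
  "radial_fun F z = p z * F ((cmod z)\<^sup>2)"

text \<open>The product rule with \<open>2 F' = k / p\<^sup>2\<close>: the factor \<open>p\<close>
  of \<open>radial_fun\<close> cancels one power in the denominator, and \<open>F'\<close> is
  expressed through \<open>k\<close> throughout.\<close>

definition radial_grad :: "(real \<Rightarrow> real) \<Rightarrow> (real \<Rightarrow> real) \<Rightarrow> complex \<Rightarrow> complex" where
  "radial_grad k F z = (k ((cmod z)\<^sup>2) / p z) *\<^sub>R z + F ((cmod z)\<^sup>2) *\<^sub>R Gp z"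

definition radial_hess ::
    "(real \<Rightarrow> real) \<Rightarrow> (real \<Rightarrow> real) \<Rightarrow> (real \<Rightarrow> real) \<Rightarrow> complex \<Rightarrow> complex \<Rightarrow> complex" where
  "radial_hess k k' F b z =
     (z \<bullet> b) *\<^sub>R ((2 * k' ((cmod z)\<^sup>2) / p z) *\<^sub>R z - (k ((cmod z)\<^sup>2) / (p z)\<^sup>2) *\<^sub>R Gp z)
     + (k ((cmod z)\<^sup>2) / p z) *\<^sub>R b + F ((cmod z)\<^sup>2) *\<^sub>R Hp b z
     + ((Gp z \<bullet> b) * k ((cmod z)\<^sup>2) / (p z)\<^sup>2) *\<^sub>R z"

lemma p_gderiv: "GDERIV p z :> Gp z"
  using p_C2 by (simp add: C2_on_def)

lemma p_neq_0 [simp]: "p z \<noteq> 0"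
  using p_pos[of z] by simp

lemma continuous_on_p: "continuous_on S p" and continuous_on_Gp: "continuous_on S Gp"
  and continuous_on_Hp: "b \<in> Basis \<Longrightarrow> continuous_on S (Hp b)"
  using C2_on_continuous[OF p_C2] continuous_on_subset by blast+

lemma laplacian_p: "laplacian p z = (\<Sum>b\<in>Basis. Hp b z \<bullet> b)"
  using C2_on_has_laplacian[OF p_C2] has_laplacian_imp_laplacian by force

lemma has_laplacian_p: "has_laplacian p z (u z * p z)"
  using C2_on_has_laplacian[OF p_C2, of z] by (simp add: u_eq laplacian_p)

lemma continuous_on_u: "continuous_on S u"
  unfolding u_eq laplacian_p
  by (intro continuous_intros continuous_on_p continuous_on_Hp) auto

lemma q_cmod: "q ((cmod z)\<^sup>2) = (p z)\<^sup>2"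
  unfolding q_def by (subst p_radial[of z "complex_of_real (sqrt ((cmod z)\<^sup>2))"]) auto

lemma q_pos: "q s > 0"
  using p_pos by (simp add: q_def)

lemma q_neq_0 [simp]: "q s \<noteq> 0"
  using q_pos[of s] by simp

lemma isCont_q: "isCont q s"
proof -
  have "continuous_on UNIV q"
    unfolding q_def
    by (intro continuous_intros continuous_on_compose2[OF continuous_on_p[of UNIV]]) auto
  then show ?thesis
    by (simp add: continuous_on_eq_continuous_at)
qed

lemma open_radial: "open J \<Longrightarrow> open {z::complex. (cmod z)\<^sup>2 \<in> J}"
  using open_vimage[of J "\<lambda>z::complex. (cmod z)\<^sup>2"] by (simp add: vimage_def continuous_intros)

lemma radial_fun_C2:
  assumes "open J"
    and F: "\<And>s. s \<in> J \<Longrightarrow> (F has_real_derivative k s / (2 * q s)) (at s)"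
    and k: "\<And>s. s \<in> J \<Longrightarrow> (k has_real_derivative k' s) (at s)"
    and k': "continuous_on J k'"
  defines "S \<equiv> {z. (cmod z)\<^sup>2 \<in> J}"
  shows "C2_on (radial_fun F) (radial_grad k F) (radial_hess k k' F) S"
proof -
  let ?s = "\<lambda>z::complex. (cmod z)\<^sup>2"
  have F': "GDERIV (\<lambda>z. F (?s z)) z :> (k (?s z) / (p z)\<^sup>2) *\<^sub>R z" if "z \<in> S" for z
    using GDERIV_DERIV_compose[OF GDERIV_norm_squared F, of z] that
    by (simp add: S_def q_cmod)
  have k1: "GDERIV (\<lambda>z. k (?s z)) z :> (2 * k' (?s z)) *\<^sub>R z" if "z \<in> S" for z
    using GDERIV_DERIV_compose[OF GDERIV_norm_squared k, of z] that
    by (simp add: S_def mult.commute)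
  have 1: "GDERIV (radial_fun F) z :> radial_grad k F z" if "z \<in> S" for z
    using GDERIV_mult[OF p_gderiv F'[OF that]]
    unfolding radial_fun_def radial_grad_def by (simp add: power2_eq_square)
  have ip: "GDERIV (\<lambda>z. inverse (p z)) z :> - (inverse (p z))\<^sup>2 *\<^sub>R Gp z" for z
    by (rule GDERIV_inverse[OF p_gderiv]) simp
  have 2: "GDERIV (\<lambda>z. radial_grad k F z \<bullet> b) z :> radial_hess k k' F b z"
    if z: "z \<in> S" and b: "b \<in> Basis" for z b
  proof -
    have *: "GDERIV (\<lambda>z. Gp z \<bullet> b) z :> Hp b z"
      using p_C2 b by (simp add: C2_on_def)
    have "GDERIV (\<lambda>z. (k (?s z) * inverse (p z)) * (z \<bullet> b) + F (?s z) * (Gp z \<bullet> b)) z :>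
      ((k (?s z) * inverse (p z)) *\<^sub>R b + (z \<bullet> b) *\<^sub>R
         (k (?s z) *\<^sub>R (- (inverse (p z))\<^sup>2 *\<^sub>R Gp z) + inverse (p z) *\<^sub>R ((2 * k' (?s z)) *\<^sub>R z)))
      + (F (?s z) *\<^sub>R Hp b z + (Gp z \<bullet> b) *\<^sub>R ((k (?s z) / (p z)\<^sup>2) *\<^sub>R z))"
      by (intro GDERIV_add GDERIV_mult GDERIV_inner ip k1 F' z *)
    then show ?thesis
      unfolding radial_grad_def radial_hess_def
      by (simp add: inner_add_left divide_inverse scaleR_add_right scaleR_diff_right power_inverse algebra_simps)
  qed
  have ck: "continuous_on J k" "continuous_on J F"
    using k F by (meson DERIV_isCont continuous_at_imp_continuous_on)+
  have comp: "continuous_on S (\<lambda>z. f (?s z))" if "continuous_on J f" for f :: "real \<Rightarrow> real"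
    by (rule continuous_on_compose2[OF that]) (auto simp: S_def intro!: continuous_intros)
  have "continuous_on S (\<lambda>z. radial_hess k k' F b z \<bullet> b')" if "b \<in> Basis" for b b'
    unfolding radial_hess_def using that
    by (intro continuous_intros comp ck k' continuous_on_p continuous_on_Gp continuous_on_Hp) auto
  then show ?thesis
    using 1 2 unfolding C2_on_def by blast
qed

text \<open>In the trace of \<open>radial_hess\<close> the two terms that pair \<open>k\<close> with
  \<open>Gp\<close>, one from differentiating \<open>1 / p\<close> and one from differentiating
  \<open>F\<close>, cancel. What survives of \<open>p\<close> is \<open>u\<close>, through its own
  Laplacian, and a factor \<open>1 / p\<close>.\<close>

lemma radial_fun_has_laplacian:
  assumes "open J"
    and F: "\<And>s. s \<in> J \<Longrightarrow> (F has_real_derivative k s / (2 * q s)) (at s)"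
    and k: "\<And>s. s \<in> J \<Longrightarrow> (k has_real_derivative k' s) (at s)"
    and k': "continuous_on J k'" and z: "(cmod z)\<^sup>2 \<in> J"
  shows "has_laplacian (radial_fun F) z (u z * radial_fun F z
    + (2 * k ((cmod z)\<^sup>2) + 2 * (cmod z)\<^sup>2 * k' ((cmod z)\<^sup>2)) / p z)"
proof -
  have "has_laplacian (radial_fun F) z (\<Sum>b\<in>Basis. radial_hess k k' F b z \<bullet> b)"
    using z by (intro C2_on_has_laplacian[OF radial_fun_C2[OF assms(1-4)]] open_radial assms(1)) auto
  moreover have "(\<Sum>b\<in>Basis. radial_hess k k' F b z \<bullet> b) = u z * radial_fun F z
    + (2 * k ((cmod z)\<^sup>2) + 2 * (cmod z)\<^sup>2 * k' ((cmod z)\<^sup>2)) / p z"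
  proof -
    have "(cmod z)\<^sup>2 = z \<bullet> 1 * (z \<bullet> 1) + z \<bullet> \<i> * (z \<bullet> \<i>)"
      unfolding cmod_power2 by (simp add: power2_eq_square inner_complex_def)
    then show ?thesis
      unfolding radial_hess_def radial_fun_def u_eq laplacian_p
      by (simp add: Basis_complex_def inner_add_left inner_diff_left inner_complex_def[of 1 1]
          inner_complex_def[of \<i> \<i>] field_simps power2_eq_square)
  qed
  ultimately show ?thesis
    by simp
qed

end

section \<open>Regularized Green functions of disks\<close>

context radial_potential
begin

text \<open>Normalises the pole: near the origin \<open>p F\<close> behaves like
  \<open>p 0 * c0 / (2 * (p 0)\<^sup>2) * ln |z|\<^sup>2\<close>, which has to be
  \<open>ln |z| / (2 * pi)\<close>.\<close>

definition c0 :: real where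
  "c0 = p 0 / (2 * pi)"

lemma c0_pos: "c0 > 0"
  using p_pos by (simp add: c0_def)

text \<open>With \<open>e = 0\<close> this is the radial profile of the Green function divided by \<open>p\<close>; a positive
  \<open>e\<close> removes the singularity.\<close>

definition profile :: "real \<Rightarrow> real \<Rightarrow> real \<Rightarrow> real" where
  "profile \<rho> e = (SOME F. F (\<rho>\<^sup>2) = 0 \<and>
     (\<forall>s>-e. (F has_real_derivative c0 / (s + e) / (2 * q s)) (at s)))"

definition reg_green :: "real \<Rightarrow> real \<Rightarrow> complex \<Rightarrow> real" where
  "reg_green \<rho> e = radial_fun (profile \<rho> e)"

lemma profile_props: "profile \<rho> e (\<rho>\<^sup>2) = 0 \<and>
     (\<forall>s>-e. (profile \<rho> e has_real_derivative c0 / (s + e) / (2 * q s)) (at s))"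
proof -
  have "isCont (\<lambda>s. c0 / (s + e) / (2 * q s)) s" if "s > - e" for s
    using that by (intro continuous_intros isCont_q) auto
  from someI_ex[OF antiderivative_right[OF this]] show ?thesis
    by (simp add: profile_def)
qed

lemma profile_boundary [simp]: "profile \<rho> e (\<rho>\<^sup>2) = 0"
  and DERIV_profile: "s > -e \<Longrightarrow> (profile \<rho> e has_real_derivative c0 / (s + e) / (2 * q s)) (at s)"
  using profile_props by auto

lemma DERIV_regularized_rate:
  "s > -e \<Longrightarrow> ((\<lambda>s. c0 / (s + e)) has_real_derivative - c0 / (s + e)\<^sup>2) (at s)"
  by (auto intro!: derivative_eq_intros simp: power2_eq_square)

text \<open>One domain serves both uses: it is the punctured plane for \<open>e = 0\<close> and the
  whole plane for \<open>e > 0\<close>.\<close>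

lemma reg_green_C2:
  "C2_on (reg_green \<rho> e) (radial_grad (\<lambda>s. c0 / (s + e)) (profile \<rho> e))
     (radial_hess (\<lambda>s. c0 / (s + e)) (\<lambda>s. - c0 / (s + e)\<^sup>2) (profile \<rho> e)) {z. (cmod z)\<^sup>2 > - e}"
  using radial_fun_C2[of "{-e<..}" "profile \<rho> e" "\<lambda>s. c0 / (s + e)" "\<lambda>s. - c0 / (s + e)\<^sup>2"]
    DERIV_profile[of e] DERIV_regularized_rate[of e]
  unfolding reg_green_def by (force intro!: continuous_intros)

text \<open>The source is twice the derivative of \<open>s k = c0 s / (s + e)\<close>, divided by
  \<open>p\<close>. It vanishes for \<open>e = 0\<close> and concentrates at the origin as
  \<open>e\<close> decreases to 0.\<close>

lemma reg_green_has_laplacian: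
  assumes "(cmod z)\<^sup>2 > - e"
  shows "has_laplacian (reg_green \<rho> e) z
    (u z * reg_green \<rho> e z + 2 * c0 * e / ((cmod z)\<^sup>2 + e)\<^sup>2 / p z)"
proof -
  have "has_laplacian (reg_green \<rho> e) z (u z * reg_green \<rho> e z
    + (2 * (c0 / ((cmod z)\<^sup>2 + e)) + 2 * (cmod z)\<^sup>2 * (- c0 / ((cmod z)\<^sup>2 + e)\<^sup>2)) / p z)"
    unfolding reg_green_def
    by (rule radial_fun_has_laplacian[of "{-e<..}"])
      (use assms DERIV_profile[of e] DERIV_regularized_rate[of e] in \<open>auto intro!: continuous_intros\<close>)
  moreover have "2 * (c0 / (s + e)) + 2 * s * (- c0 / (s + e)\<^sup>2) = 2 * c0 * e / (s + e)\<^sup>2"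
    if "s > - e" for s
    using that by (simp add: divide_simps) (simp add: power2_eq_square algebra_simps)
  ultimately show ?thesis
    using assms by simp
qed

lemma green_boundary [simp]: "cmod z = \<rho> \<Longrightarrow> reg_green \<rho> e z = 0"
  by (simp add: reg_green_def radial_fun_def)

lemma profile_nonpos:
  assumes "0 \<le> e" "- e < s" "s \<le> \<rho>\<^sup>2"
  shows "profile \<rho> e s \<le> 0"
proof -
  have "profile \<rho> e s \<le> profile \<rho> e (\<rho>\<^sup>2)"
  proof (rule DERIV_nonneg_imp_nondecreasing[OF assms(3)])
    fix x assume "s \<le> x" "x \<le> \<rho>\<^sup>2"
    then show "\<exists>y. (profile \<rho> e has_real_derivative y) (at x) \<and> 0 \<le> y"
      using DERIV_profile[of e x \<rho>] assms c0_pos q_pos[of x] by (intro exI[of _ "c0 / (x + e) / (2 * q x)"]) auto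
  qed
  then show ?thesis
    by simp
qed

text \<open>Both profiles vanish at \<open>\<rho>\<^sup>2\<close> and the singular one has the
  larger slope, so going inwards it falls below the other.\<close>

lemma profile_mono:
  assumes "0 \<le> e" "0 < s" "s \<le> \<rho>\<^sup>2"
  shows "profile \<rho> 0 s \<le> profile \<rho> e s"
proof -
  have "profile \<rho> 0 s - profile \<rho> e s \<le> profile \<rho> 0 (\<rho>\<^sup>2) - profile \<rho> e (\<rho>\<^sup>2)"
  proof (rule DERIV_nonneg_imp_nondecreasing[OF assms(3)])
    fix x assume x: "s \<le> x" "x \<le> \<rho>\<^sup>2"
    then have "((\<lambda>s. profile \<rho> 0 s - profile \<rho> e s) has_real_derivative
      c0 / (x + 0) / (2 * q x) - c0 / (x + e) / (2 * q x)) (at x)"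
      using assms by (intro derivative_intros DERIV_profile) auto
    moreover have "c0 / (x + e) / (2 * q x) \<le> c0 / (x + 0) / (2 * q x)"
      using c0_pos q_pos[of x] assms x by (intro divide_right_mono divide_left_mono) auto
    ultimately show "\<exists>y. ((\<lambda>s. profile \<rho> 0 s - profile \<rho> e s) has_real_derivative y) (at x) \<and> 0 \<le> y"
      by force
  qed
  then show ?thesis
    by simp
qed

lemma reg_green_nonpos:
  "0 \<le> e \<Longrightarrow> - e < (cmod z)\<^sup>2 \<Longrightarrow> cmod z \<le> \<rho> \<Longrightarrow> reg_green \<rho> e z \<le> 0"
  unfolding reg_green_def radial_fun_def
  using p_pos[of z] by (intro mult_nonneg_nonpos profile_nonpos power_mono) auto

text \<open>Supplies the dominating function, independent of \<open>e\<close>, for the passage to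
  \<open>e = 0\<close> in the distributional equation.\<close>

lemma abs_reg_green_le:
  assumes "0 \<le> e" "z \<noteq> 0" "cmod z \<le> \<rho>"
  shows "\<bar>reg_green \<rho> e z\<bar> \<le> \<bar>reg_green \<rho> 0 z\<bar>"
proof -
  have "reg_green \<rho> 0 z \<le> reg_green \<rho> e z"
    unfolding reg_green_def radial_fun_def
    using p_pos[of z] assms by (intro mult_left_mono profile_mono power_mono) auto
  moreover have "0 < (cmod z)\<^sup>2"
    using assms by simp
  then have "- e < (cmod z)\<^sup>2"
    using assms(1) by linarith
  then have "reg_green \<rho> e z \<le> 0"
    using reg_green_nonpos[of e z \<rho>] assms by simp
  ultimately show ?thesis
    by linarith
qed

lemma profile_tendsto:
  assumes "0 < s" "s \<le> \<rho>\<^sup>2"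
  shows "((\<lambda>e. profile \<rho> e s) \<longlongrightarrow> profile \<rho> 0 s) (at_right 0)"
proof -
  \<comment> \<open>The slopes of the two profiles differ by \<open>e c0 / (x (x + e))\<close> over
    \<open>2 q x\<close>, at most \<open>e c0 / x\<^sup>2\<close> over \<open>2 q x\<close>. So
    \<open>e\<close> times a primitive \<open>A\<close> of the latter without \<open>e\<close>
    controls the difference linearly in \<open>e\<close>.\<close>
  have "\<exists>A. A (\<rho>\<^sup>2) = 0 \<and> (\<forall>x>0. (A has_real_derivative c0 / (x * x) / (2 * q x)) (at x))"
    by (intro antiderivative_right continuous_intros isCont_q) auto
  then obtain A where A: "A (\<rho>\<^sup>2) = 0"
    "\<And>x. x > 0 \<Longrightarrow> (A has_real_derivative c0 / (x * x) / (2 * q x)) (at x)"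
    by blast
  have *: "profile \<rho> e s - profile \<rho> 0 s \<le> e * (- A s)" if e: "0 < e" for e
  proof -
    have "e * A s - (profile \<rho> 0 s - profile \<rho> e s)
      \<le> e * A (\<rho>\<^sup>2) - (profile \<rho> 0 (\<rho>\<^sup>2) - profile \<rho> e (\<rho>\<^sup>2))"
    proof (rule DERIV_nonneg_imp_nondecreasing[OF assms(2)])
      fix x assume x: "s \<le> x" "x \<le> \<rho>\<^sup>2"
      then have "((\<lambda>s. e * A s - (profile \<rho> 0 s - profile \<rho> e s)) has_real_derivative
        e * (c0 / (x * x) / (2 * q x)) - (c0 / (x + 0) / (2 * q x) - c0 / (x + e) / (2 * q x))) (at x)"
        using assms e by (intro derivative_intros DERIV_profile A DERIV_cmult) auto
      moreover have "c0 / (x + 0) / (2 * q x) - c0 / (x + e) / (2 * q x)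
          = e * (c0 / (x * (x + e)) / (2 * q x))"
        using x assms e by (simp add: divide_simps) (simp add: algebra_simps)
      moreover have "e * (c0 / (x * (x + e)) / (2 * q x)) \<le> e * (c0 / (x * x) / (2 * q x))"
        using c0_pos q_pos[of x] assms x e
        by (intro mult_left_mono divide_right_mono divide_left_mono) auto
      ultimately show "\<exists>y. ((\<lambda>s. e * A s - (profile \<rho> 0 s - profile \<rho> e s))
          has_real_derivative y) (at x) \<and> 0 \<le> y"
        by force
    qed
    then show ?thesis
      using A by (simp add: algebra_simps)
  qed
  have "((\<lambda>e. profile \<rho> e s - profile \<rho> 0 s) \<longlongrightarrow> 0) (at_right 0)"
  proof (rule tendsto_sandwich[of "\<lambda>_. 0" _ _ "\<lambda>e. e * (- A s)"])
    show "\<forall>\<^sub>F e in at_right 0. 0 \<le> profile \<rho> e s - profile \<rho> 0 s"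
      using eventually_at_right_less by eventually_elim (use profile_mono assms in auto)
    show "\<forall>\<^sub>F e in at_right 0. profile \<rho> e s - profile \<rho> 0 s \<le> e * (- A s)"
      using eventually_at_right_less by eventually_elim (rule *)
    show "((\<lambda>e. e * (- A s)) \<longlongrightarrow> 0) (at_right 0)"
      by (auto intro!: tendsto_eq_intros)
  qed auto
  then show ?thesis
    by (rule LIM_zero_cancel)
qed

lemma reg_green_tendsto:
  assumes "z \<noteq> 0" "cmod z \<le> \<rho>"
  shows "((\<lambda>e. reg_green \<rho> e z) \<longlongrightarrow> reg_green \<rho> 0 z) (at_right 0)"
  unfolding reg_green_def radial_fun_def
  using assms by (intro tendsto_intros profile_tendsto power_mono) auto

end

section \<open>The logarithmic singularity at the origin\<close>

lemma DERIV_imp_local_lipschitz: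
  fixes f :: "real \<Rightarrow> real"
  assumes "(f has_real_derivative D) (at x)"
  shows "\<exists>d>0. \<exists>K. \<forall>y. \<bar>y - x\<bar> < d \<longrightarrow> \<bar>f y - f x\<bar> \<le> K * \<bar>y - x\<bar>"
proof -
  have "((\<lambda>y. (f y - f x) / (y - x)) \<longlongrightarrow> D) (at x)"
    using assms by (simp add: has_field_derivative_iff)
  then have "\<forall>\<^sub>F y in at x. dist ((f y - f x) / (y - x)) D < 1"
    by (rule tendstoD) simp
  then obtain d where d: "d > 0"
    and *: "\<And>y. y \<noteq> x \<Longrightarrow> dist y x < d \<Longrightarrow> dist ((f y - f x) / (y - x)) D < 1"
    unfolding eventually_at by auto
  have "\<bar>f y - f x\<bar> \<le> (\<bar>D\<bar> + 1) * \<bar>y - x\<bar>" if "\<bar>y - x\<bar> < d" for y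
  proof (cases "y = x")
    case False
    then have "\<bar>(f y - f x) / (y - x) - D\<bar> < 1"
      using *[of y] that by (simp add: dist_real_def)
    then have "\<bar>(f y - f x) / (y - x)\<bar> \<le> \<bar>D\<bar> + 1"
      by linarith
    then show ?thesis
      using False by (simp add: abs_divide divide_le_eq)
  qed auto
  with d show ?thesis
    by blast
qed

context radial_potential
begin

lemma DERIV_p_real: "((\<lambda>r. p (complex_of_real r)) has_real_derivative Re (Gp r)) (at r)"
  using GDERIV_slice[of p 0 r 1 "Gp r"] p_gderiv[of r] by (simp add: inner_complex_def scaleR_conv_of_real)

text \<open>After subtraction of the logarithm the remaining slope is
  \<open>c0 / (2 s) * (1 / q s - 1 / q 0)\<close>. Differentiability of \<open>p\<close> at 0 along
  the real axis makes the bracket \<open>O(sqrt s)\<close>, so the slope is at most the derivative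
  of \<open>c0 K sqrt s\<close>; adding or subtracting that function makes \<open>M\<close>
  monotone, hence bounded.\<close>

lemma profile_log_bound:
  "\<exists>d>0. \<exists>B. \<forall>s. 0 < s \<and> s \<le> d \<longrightarrow> \<bar>profile \<rho> 0 s - c0 / (2 * q 0) * ln s\<bar> \<le> B"
proof -
  have "((\<lambda>r. 1 / (p (complex_of_real r))\<^sup>2) has_real_derivative
      - (2 * p 0 * Re (Gp 0)) / ((p 0)\<^sup>2)\<^sup>2) (at 0)"
    using DERIV_p_real[of 0] by (auto intro!: derivative_eq_intros simp: power2_eq_square divide_simps)
  from DERIV_imp_local_lipschitz[OF this] obtain d K where d: "d > 0"
    and K: "\<And>r. \<bar>r\<bar> < d \<Longrightarrow> \<bar>1 / (p (complex_of_real r))\<^sup>2 - 1 / (p 0)\<^sup>2\<bar> \<le> K * \<bar>r\<bar>"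
    by (auto simp del: abs_divide)
  \<comment> \<open>Squared because the Lipschitz estimate is in the radius \<open>sqrt s\<close>,
    and halved so that \<open>sqrt s\<close> is strictly below \<open>d\<close>.\<close>
  define d1 where "d1 = (d / 2)\<^sup>2"
  have d1: "d1 > 0"
    using d by (simp add: d1_def)
  have Kq: "\<bar>1 / q s - 1 / q 0\<bar> \<le> K * sqrt s" if "0 < s" "s \<le> d1" for s
  proof -
    have "sqrt s \<le> d / 2"
      using real_sqrt_le_mono[OF that(2)] d by (simp add: d1_def)
    then show ?thesis
      using K[of "sqrt s"] that d by (simp add: q_def)
  qed
  define M where "M = (\<lambda>s. profile \<rho> 0 s - c0 / (2 * q 0) * ln s)"
  define M' where "M' = (\<lambda>s. c0 / (2 * s) * (1 / q s - 1 / q 0))"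
  have M': "(M has_real_derivative M' s) (at s)" if "s > 0" for s
    unfolding M_def M'_def using that DERIV_profile[of 0 s \<rho>]
    by (auto intro!: derivative_eq_intros simp: divide_simps) (simp add: algebra_simps)
  have M'_le: "\<bar>M' s\<bar> \<le> c0 * K * (inverse (sqrt s) / 2)" if "0 < s" "s \<le> d1" for s
  proof -
    have "\<bar>M' s\<bar> = c0 / (2 * s) * \<bar>1 / q s - 1 / q 0\<bar>"
      using c0_pos that by (simp add: M'_def abs_mult)
    also have "\<dots> \<le> c0 / (2 * s) * (K * sqrt s)"
      using c0_pos that Kq by (intro mult_left_mono) auto
    also have "\<dots> = c0 * K * (inverse (sqrt s) / 2)"
      using that real_sqrt_mult_self[of s] by (simp add: field_simps)
    finally show ?thesis .
  qed
  have "\<bar>M s\<bar> \<le> \<bar>M d1\<bar> + \<bar>c0 * K * sqrt d1\<bar> + \<bar>c0 * K\<bar> * sqrt d1" if s: "0 < s" "s \<le> d1" for s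
  proof -
    have sq: "((\<lambda>s. c0 * K * sqrt s) has_real_derivative c0 * K * (inverse (sqrt x) / 2)) (at x)"
      if "x > 0" for x
      by (intro DERIV_cmult DERIV_real_sqrt that)
    have "M s + c0 * K * sqrt s \<le> M d1 + c0 * K * sqrt d1"
    proof (rule DERIV_nonneg_imp_nondecreasing[OF s(2)])
      fix x assume "s \<le> x" "x \<le> d1"
      then show "\<exists>y. ((\<lambda>s. M s + c0 * K * sqrt s) has_real_derivative y) (at x) \<and> 0 \<le> y"
        using s M'_le[of x] DERIV_add[OF M' sq, of x]
        by (intro exI[of _ "M' x + c0 * K * (inverse (sqrt x) / 2)"]) auto
    qed
    moreover have "M s - c0 * K * sqrt s \<ge> M d1 - c0 * K * sqrt d1"
    proof (rule DERIV_nonpos_imp_nonincreasing[OF s(2)])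
      fix x assume "s \<le> x" "x \<le> d1"
      then show "\<exists>y. ((\<lambda>s. M s - c0 * K * sqrt s) has_real_derivative y) (at x) \<and> y \<le> 0"
        using s M'_le[of x] DERIV_diff[OF M' sq, of x]
        by (intro exI[of _ "M' x - c0 * K * (inverse (sqrt x) / 2)"]) auto
    qed
    moreover have "\<bar>c0 * K * sqrt s\<bar> \<le> \<bar>c0 * K\<bar> * sqrt d1"
      using s by (simp add: abs_mult mult_left_mono)
    ultimately show ?thesis
      by linarith
  qed
  then show ?thesis
    using d1 unfolding M_def by blast
qed

text \<open>Replacing the factor \<open>p z\<close> by \<open>p 0\<close> costs a multiple of
  \<open>|z| * |ln |z||\<close>, which stays bounded; the rest is the logarithmic bound for the
  profile, and the constants combine to \<open>1 / (2 * pi)\<close>.\<close>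

lemma green_log_bound:
  "\<exists>B. \<forall>\<^sub>F z in at 0. \<bar>reg_green \<rho> 0 z - ln (cmod z) / (2 * pi)\<bar> \<le> B"
proof -
  obtain d B where d: "d > 0"
    and B: "\<And>s. 0 < s \<Longrightarrow> s \<le> d \<Longrightarrow> \<bar>profile \<rho> 0 s - c0 / (2 * q 0) * ln s\<bar> \<le> B"
    using profile_log_bound by blast
  obtain d' K where d': "d' > 0" and K: "\<And>r. \<bar>r\<bar> < d' \<Longrightarrow> \<bar>p (complex_of_real r) - p 0\<bar> \<le> K * \<bar>r\<bar>"
    using DERIV_imp_local_lipschitz[OF DERIV_p_real[of 0]] by auto
  have "\<bar>reg_green \<rho> 0 z - ln (cmod z) / (2 * pi)\<bar> \<le> (p 0 + \<bar>K\<bar>) * B + \<bar>K\<bar> / p 0 / (2 * pi)"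
    if z: "z \<noteq> 0" "cmod z < min 1 (min d d')" for z
  proof -
    let ?r = "cmod z" and ?s = "(cmod z)\<^sup>2"
    have r: "0 < ?r" "?r < 1" "?r < d" "?r < d'"
      using z by auto
    have "?s \<le> ?r"
      using r by (simp add: power2_eq_square mult_le_cancel_left1)
    then have Bs: "\<bar>profile \<rho> 0 ?s - c0 / (2 * q 0) * ln ?s\<bar> \<le> B"
      using r by (intro B) auto
    have pz: "\<bar>p z - p 0\<bar> \<le> \<bar>K\<bar> * ?r"
    proof -
      have "p z = p (complex_of_real ?r)"
        by (rule p_radial) simp
      moreover have "\<bar>p (complex_of_real ?r) - p 0\<bar> \<le> K * \<bar>?r\<bar>"
        using r by (intro K) auto
      moreover have "K * \<bar>?r\<bar> \<le> \<bar>K\<bar> * ?r"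
        using r by (simp add: mult_right_mono)
      ultimately show ?thesis
        by linarith
    qed
    have ln: "ln ?s = 2 * ln ?r"
      using r by (simp add: ln_realpow)
    have rln: "?r * \<bar>ln ?r\<bar> \<le> 1"
    proof -
      have "- ln ?r \<le> 1 / ?r"
        using ln_le_minus_one[of "1 / ?r"] r by (simp add: ln_div)
      then show ?thesis
        using r by (simp add: field_simps ln_less_zero abs_of_neg)
    qed
    have "reg_green \<rho> 0 z - ln ?r / (2 * pi) =
        p z * (profile \<rho> 0 ?s - c0 / (2 * q 0) * ln ?s) + (p z - p 0) * ln ?r / p 0 / (2 * pi)"
      unfolding reg_green_def radial_fun_def ln
      using p_pos[of 0] by (simp add: c0_def q_def field_simps power2_eq_square)
    also have "\<bar>\<dots>\<bar> \<le> \<bar>p z * (profile \<rho> 0 ?s - c0 / (2 * q 0) * ln ?s)\<bar>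
        + \<bar>(p z - p 0) * ln ?r / p 0 / (2 * pi)\<bar>"
      by (rule abs_triangle_ineq)
    also have "\<bar>p z * (profile \<rho> 0 ?s - c0 / (2 * q 0) * ln ?s)\<bar> \<le> (p 0 + \<bar>K\<bar>) * B"
    proof -
      have "\<bar>K\<bar> * ?r \<le> \<bar>K\<bar>"
        using r by (simp add: mult_left_le)
      then have "p z \<le> p 0 + \<bar>K\<bar>"
        using pz by linarith
      then show ?thesis
        using Bs p_pos[of z] unfolding abs_mult by (intro mult_mono) auto
    qed
    also have "\<bar>(p z - p 0) * ln ?r / p 0 / (2 * pi)\<bar> \<le> \<bar>K\<bar> / p 0 / (2 * pi)"
    proof -
      have "\<bar>(p z - p 0) * ln ?r\<bar> \<le> (\<bar>K\<bar> * ?r) * \<bar>ln ?r\<bar>"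
        unfolding abs_mult by (intro mult_right_mono pz) auto
      also have "\<dots> \<le> \<bar>K\<bar> * 1"
        unfolding mult.assoc by (intro mult_left_mono rln) auto
      finally show ?thesis
        using p_pos[of 0] by (simp add: abs_divide divide_right_mono)
    qed
    finally show ?thesis
      by simp
  qed
  moreover have "min 1 (min d d') > 0"
    using d d' by simp
  ultimately show ?thesis
    unfolding eventually_at by (metis dist_0_norm dist_commute)
qed

lemma continuous_on_green: "0 \<notin> S \<Longrightarrow> continuous_on S (reg_green \<rho> 0)"
  using C2_on_continuous(1)[OF reg_green_C2[of \<rho> 0]] by (rule continuous_on_subset) auto

lemma continuous_on_reg_green: "e > 0 \<Longrightarrow> continuous_on S (reg_green \<rho> e)"
  using C2_on_continuous(1)[OF reg_green_C2[of \<rho> e]]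
  by (rule continuous_on_subset) (auto intro: less_le_trans[OF _ zero_le_power2])

text \<open>Near the origin the logarithm is weaker than \<open>1 / cmod z\<close>, elsewhere
  compactness bounds the function. The reciprocal is the chosen majorant because it is easily
  integrated over a disk.\<close>

lemma abs_green_le:
  assumes "\<rho> > 0"
  shows "\<exists>C. \<forall>z. z \<noteq> 0 \<and> cmod z \<le> \<rho> \<longrightarrow> \<bar>reg_green \<rho> 0 z\<bar> \<le> C / cmod z"
proof -
  obtain B where "\<forall>\<^sub>F z in at 0. \<bar>reg_green \<rho> 0 z - ln (cmod z) / (2 * pi)\<bar> \<le> B"
    using green_log_bound by blast
  then obtain d where d: "d > 0"
    and B: "\<And>z. z \<noteq> 0 \<Longrightarrow> cmod z < d \<Longrightarrow> \<bar>reg_green \<rho> 0 z - ln (cmod z) / (2 * pi)\<bar> \<le> B"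
    unfolding eventually_at by auto
  define d' where "d' = min (d / 2) 1"
  have d': "0 < d'" "d' < d" "d' \<le> 1"
    using d by (auto simp: d'_def)
  have "compact (reg_green \<rho> 0 ` (cball 0 \<rho> - ball 0 d'))"
    using d' by (intro compact_continuous_image continuous_on_green compact_diff) auto
  then have "bounded (reg_green \<rho> 0 ` (cball 0 \<rho> - ball 0 d'))"
    by (rule compact_imp_bounded)
  then obtain B' where "\<forall>z\<in>cball 0 \<rho> - ball 0 d'. \<bar>reg_green \<rho> 0 z\<bar> \<le> B'"
    by (auto simp: bounded_iff)
  then have B': "\<bar>reg_green \<rho> 0 z\<bar> \<le> B'" if "cmod z \<le> \<rho>" "d' \<le> cmod z" for z
    using that by auto
  have "\<bar>reg_green \<rho> 0 z\<bar> \<le> (\<bar>B\<bar> + 1 + \<bar>B'\<bar> * \<rho>) / cmod z" if z: "z \<noteq> 0" "cmod z \<le> \<rho>" for z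
  proof (cases "cmod z < d'")
    case True
    have r: "0 < cmod z" "cmod z < 1"
      using z True d' by auto
    have "- ln (cmod z) \<le> 1 / cmod z"
      using ln_le_minus_one[of "1 / cmod z"] r by (simp add: ln_div)
    moreover have "- ln (cmod z) / (2 * pi) \<le> - ln (cmod z) / 1"
      using r pi_ge_two by (intro divide_left_mono) auto
    moreover have "ln (cmod z) / (2 * pi) \<le> 0"
      using r by (simp add: divide_nonpos_pos)
    ultimately have "\<bar>reg_green \<rho> 0 z\<bar> \<le> B + 1 / cmod z"
      using B[of z] z True d' by auto
    also have "B \<le> \<bar>B\<bar> / cmod z"
      using r by (smt (verit) divide_less_eq_1_neg le_divide_eq mult_left_le)
    also have "\<bar>B\<bar> / cmod z + 1 / cmod z \<le> (\<bar>B\<bar> + 1 + \<bar>B'\<bar> * \<rho>) / cmod z"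
      using r assms by (simp add: divide_simps)
    finally show ?thesis
      by simp
  next
    case False
    have "\<bar>reg_green \<rho> 0 z\<bar> * cmod z \<le> \<bar>B'\<bar> * \<rho>"
      using B'[of z] z False by (intro mult_mono) auto
    also have "\<dots> \<le> \<bar>B\<bar> + 1 + \<bar>B'\<bar> * \<rho>"
      by simp
    finally show ?thesis
      using z by (simp add: pos_le_divide_eq)
  qed
  then show ?thesis
    by blast
qed

end

section \<open>Integration by parts and radial integrals\<close>

lemma GDERIV_eq_0_outside_support:
  assumes "GDERIV f x :> D" "closed K" "x \<notin> K" "\<And>y. y \<notin> K \<Longrightarrow> f y = 0"
  shows "D = 0"
proof -
  have "(f has_derivative (\<lambda>h. 0)) (at x)"
    by (rule has_derivative_transform_within_open[of "\<lambda>_. 0" _ _ _ "- K"])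
      (use assms in \<open>auto simp: open_Compl\<close>)
  then have "(\<lambda>h. h \<bullet> D) = (\<lambda>h. 0)"
    using assms(1) has_derivative_unique unfolding gderiv_def by blast
  then have "D \<bullet> D = 0"
    by meson
  then show ?thesis
    by simp
qed

lemma integrable_continuous_compact_support:
  fixes f :: "'a::euclidean_space \<Rightarrow> real"
  assumes "continuous_on UNIV f" "compact K" "\<And>x. x \<notin> K \<Longrightarrow> f x = 0"
  shows "integrable lborel f"
proof -
  have "integrable lborel (\<lambda>x. indicator K x *\<^sub>R f x)"
    using assms by (intro borel_integrable_compact) (auto intro: continuous_on_subset)
  also have "(\<lambda>x. indicator K x *\<^sub>R f x) = f"
    using assms(3) by (auto simp: indicator_def fun_eq_iff)
  finally show ?thesis .
qed

lemma bounded_continuous_compact_support: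
  fixes f :: "'a::euclidean_space \<Rightarrow> real"
  assumes "continuous_on UNIV f" "compact K" "\<And>x. x \<notin> K \<Longrightarrow> f x = 0"
  obtains M where "M \<ge> 0" "\<And>x. \<bar>f x\<bar> \<le> M"
proof -
  have "bounded (f ` K)"
    using assms by (intro compact_imp_bounded compact_continuous_image) (auto intro: continuous_on_subset)
  then obtain M where M: "\<And>x. x \<in> K \<Longrightarrow> \<bar>f x\<bar> \<le> M"
    by (auto simp: bounded_iff)
  have "\<bar>f x\<bar> \<le> \<bar>M\<bar>" for x
    using M[of x] assms(3)[of x] by (cases "x \<in> K") auto
  then show ?thesis
    using that[of "\<bar>M\<bar>"] by simp
qed

text \<open>By translation invariance every difference quotient of \<open>f\<close> has integral zero.\<close>

lemma integral_directional_derivative_eq_0: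
  fixes f :: "'a::euclidean_space \<Rightarrow> real"
  assumes D: "\<And>x. GDERIV f x :> G x" and cont: "continuous_on UNIV (\<lambda>x. G x \<bullet> b)"
    and K: "compact K" "\<And>x. x \<notin> K \<Longrightarrow> f x = 0"
  shows "integral\<^sup>L lborel (\<lambda>x. G x \<bullet> b) = 0"
proof -
  have cf: "continuous_on UNIV f"
    using D GDERIV_isCont by (intro continuous_at_imp_continuous_on) blast
  have G0: "G x = 0" if "x \<notin> K" for x
    by (rule GDERIV_eq_0_outside_support[OF D _ that]) (use K compact_imp_closed in auto)
  obtain M where M: "M \<ge> 0" "\<And>x. \<bar>G x \<bullet> b\<bar> \<le> M"
    by (rule bounded_continuous_compact_support[OF cont K(1)]) (use G0 in auto)
  define s where "s = (\<lambda>n x. (f (inverse (Suc n) *\<^sub>R b + x) - f x) * Suc n)"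
  obtain r where r: "\<And>x. x \<in> K \<Longrightarrow> norm x \<le> r"
    using compact_imp_bounded[OF K(1)] by (auto simp: bounded_iff)
  \<comment> \<open>The translations have length at most \<open>norm b\<close>, so every difference
    quotient vanishes outside this ball; inside, the mean value theorem bounds it by
    \<open>M\<close>.\<close>
  define B where "B = cball (0::'a) (r + norm b)"
  have fint: "integrable lborel f"
    by (rule integrable_continuous_compact_support[OF cf K])
  have shift: "integrable lborel (\<lambda>x. f (c + x))" "integral\<^sup>L lborel (\<lambda>x. f (c + x)) = integral\<^sup>L lborel f" for c
  proof -
    have [measurable]: "f \<in> borel_measurable borel"
      using cf by (rule borel_measurable_continuous_onI)
    show "integrable lborel (\<lambda>x. f (c + x))"
      using fint integrable_distr_eq[of "(+) c" lborel borel f] by (simp add: lborel_distr_plus)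
    show "integral\<^sup>L lborel (\<lambda>x. f (c + x)) = integral\<^sup>L lborel f"
      using integral_distr[of "(+) c" lborel borel f] by (simp add: lborel_distr_plus)
  qed
  have s0: "integral\<^sup>L lborel (s n) = 0" for n
    unfolding s_def using shift fint by simp
  have "(\<lambda>n. integral\<^sup>L lborel (s n)) \<longlonglongrightarrow> integral\<^sup>L lborel (\<lambda>x. G x \<bullet> b)"
  proof (rule integral_dominated_convergence[where w="\<lambda>x. M * indicator B x"])
    show "(\<lambda>x. G x \<bullet> b) \<in> borel_measurable lborel"
      using borel_measurable_continuous_onI[OF cont] by simp
    show "s n \<in> borel_measurable lborel" for n
      unfolding s_def using shift(1) fint by (intro borel_measurable_integrable) auto
    show "integrable lborel (\<lambda>x. M * indicator B x)"
      using emeasure_lborel_cball_finite[of "0::'a" "r + norm b"]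
      by (intro integrable_mult_right integrable_real_indicator) (simp_all add: B_def)
    have "(\<lambda>n. s n x) \<longlonglongrightarrow> G x \<bullet> b" for x
    proof -
      have "((\<lambda>t. f (x + t *\<^sub>R b)) has_real_derivative G x \<bullet> b) (at 0)"
        using GDERIV_slice[of f x 0 b "G x"] D by simp
      then have "((\<lambda>t. (f (x + t *\<^sub>R b) - f x) / t) \<longlongrightarrow> G x \<bullet> b) (at 0)"
        by (simp add: has_field_derivative_iff)
      moreover have "filterlim (\<lambda>n. inverse (real (Suc n))) (at 0) sequentially"
        by (simp add: filterlim_at LIMSEQ_inverse_real_of_nat del: of_nat_Suc)
      ultimately have "(\<lambda>n. (f (x + inverse (real (Suc n)) *\<^sub>R b) - f x) / inverse (real (Suc n))) \<longlonglongrightarrow> G x \<bullet> b"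
        by (rule filterlim_compose)
      then show ?thesis
        unfolding s_def by (simp add: add.commute field_simps del: of_nat_Suc)
    qed
    then show "AE x in lborel. (\<lambda>n. s n x) \<longlonglongrightarrow> G x \<bullet> b"
      by simp
    have "norm (s n x) \<le> M * indicator B x" for n x
    proof (cases "x \<in> B")
      case True
      define h where "h = inverse (real (Suc n))"
      have h: "h > 0" "h * Suc n = 1"
        by (simp_all add: h_def del: of_nat_Suc)
      obtain t where "0 < t" "t < h" "f (x + h *\<^sub>R b) - f (x + 0 *\<^sub>R b) = (h - 0) * (G (x + t *\<^sub>R b) \<bullet> b)"
        using MVT2[OF h(1), of "\<lambda>t. f (x + t *\<^sub>R b)" "\<lambda>t. G (x + t *\<^sub>R b) \<bullet> b"] GDERIV_slice D by blast
      then have "s n x = h * Suc n * (G (x + t *\<^sub>R b) \<bullet> b)"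
        by (simp add: s_def h_def[symmetric] add.commute del: of_nat_Suc)
      then show ?thesis
        using True M h by simp
    next
      case False
      have "norm (inverse (Suc n) *\<^sub>R b) \<le> norm b"
        by (simp add: field_simps mult_left_le)
      then have "norm (inverse (Suc n) *\<^sub>R b + x) > r"
        using False norm_diff_ineq[of x "inverse (Suc n) *\<^sub>R b"] by (simp add: B_def add.commute del: of_nat_Suc)
      then have "inverse (Suc n) *\<^sub>R b + x \<notin> K"
        using r by force
      moreover have "x \<notin> K"
        using False r[of x] norm_ge_zero[of b] by (auto simp: B_def simp del: norm_ge_zero)
      ultimately show ?thesis
        using K False by (simp add: s_def del: of_nat_Suc)
    qed
    then show "AE x in lborel. norm (s n x) \<le> M * indicator B x" for n
      by simp
  qed
  then have "(\<lambda>n. 0) \<longlonglongrightarrow> integral\<^sup>L lborel (\<lambda>x. G x \<bullet> b)"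
    by (simp add: s0)
  then show ?thesis
    by (rule LIMSEQ_unique[OF _ tendsto_const])
qed

text \<open>Polar coordinates without the angle: the disk of radius \<open>sqrt a\<close> has area
  \<open>pi * a\<close>, so the squared modulus pushes area forward to \<open>pi\<close> times
  length on the half-line. Half-lines \<open>{..a}\<close> determine the measure.\<close>

lemma distr_cmod_squared:
  "distr lborel borel (\<lambda>z. (cmod z)\<^sup>2) = density lborel (\<lambda>s. ennreal pi * indicator {0..} s)"
proof (rule measure_eqI_generator_eq[where E="range (\<lambda>a::real. {..a})" and \<Omega>=UNIV and A="\<lambda>n. {..real n}"])
  \<comment> \<open>The formula also covers \<open>a < 0\<close>: the set is then empty and
    \<open>ennreal a\<close> is 0.\<close>
  have 1: "emeasure (distr lborel borel (\<lambda>z. (cmod z)\<^sup>2)) {..a} = ennreal pi * ennreal a"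
    for a :: real
  proof -
    have "emeasure (distr lborel borel (\<lambda>z. (cmod z)\<^sup>2)) {..a} = emeasure lborel {z. (cmod z)\<^sup>2 \<le> a}"
      by (subst emeasure_distr) (auto simp: vimage_def)
    also have "\<dots> = ennreal pi * ennreal a"
    proof (cases "a \<ge> 0")
      case True
      have *: "(cmod z)\<^sup>2 \<le> a \<longleftrightarrow> cmod z \<le> sqrt a" for z
        using real_sqrt_le_iff[of "(cmod z)\<^sup>2" a] by simp
      have "{z. (cmod z)\<^sup>2 \<le> a} = cball 0 (sqrt a)"
        unfolding * by auto
      then show ?thesis
        using True by (simp add: emeasure_cball unit_ball_vol_2 ennreal_mult)
    next
      case False
      then have "{z. (cmod z)\<^sup>2 \<le> a} = {}"
        by (auto simp: not_le intro: less_le_trans[OF _ zero_le_power2])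
      then show ?thesis
        using False by (simp add: ennreal_neg)
    qed
    finally show ?thesis .
  qed
  have 2: "emeasure (density lborel (\<lambda>s. ennreal pi * indicator {0..} s)) {..a} = ennreal pi * ennreal a"
    for a :: real
  proof -
    have "emeasure (density lborel (\<lambda>s. ennreal pi * indicator {0..} s)) {..a} =
        (\<integral>\<^sup>+ s. ennreal pi * indicator {0..a} s \<partial>lborel)"
      by (subst emeasure_density) (auto intro!: nn_integral_cong simp: indicator_def)
    also have "\<dots> = ennreal pi * ennreal a"
      by (subst nn_integral_cmult_indicator) (cases "a \<ge> 0"; simp add: ennreal_neg)+
    finally show ?thesis .
  qed
  show "emeasure (distr lborel borel (\<lambda>z. (cmod z)\<^sup>2)) X =
      emeasure (density lborel (\<lambda>s. ennreal pi * indicator {0..} s)) X" if "X \<in> range (\<lambda>a::real. {..a})" for X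
    using that 1 2 by auto
  show "emeasure (distr lborel borel (\<lambda>z. (cmod z)\<^sup>2)) {..real n} \<noteq> \<infinity>" for n
    unfolding 1 by (simp add: ennreal_mult_eq_top_iff)
  show "(\<Union>n. {..real n}) = UNIV"
    using real_arch_simple by auto
qed (auto simp: Int_stable_def borel_eq_atMost)

lemma nn_integral_cmod_squared:
  assumes [measurable]: "f \<in> borel_measurable borel"
  shows "(\<integral>\<^sup>+ z. f ((cmod z)\<^sup>2) \<partial>lborel) = ennreal pi * (\<integral>\<^sup>+ s. f s * indicator {0..} s \<partial>lborel)"
proof -
  have "(\<integral>\<^sup>+ z. f ((cmod z)\<^sup>2) \<partial>lborel) = integral\<^sup>N (distr lborel borel (\<lambda>z. (cmod z)\<^sup>2)) f"
    by (subst nn_integral_distr) auto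
  also have "\<dots> = (\<integral>\<^sup>+ s. ennreal pi * (f s * indicator {0..} s) \<partial>lborel)"
    unfolding distr_cmod_squared
    by (subst nn_integral_density) (auto simp: mult_ac)
  also have "\<dots> = ennreal pi * (\<integral>\<^sup>+ s. f s * indicator {0..} s \<partial>lborel)"
    by (rule nn_integral_cmult) auto
  finally show ?thesis .
qed

text \<open>In the variable \<open>s = |z|\<^sup>2\<close> the integrand becomes
  \<open>s powr (-1/2)\<close>, whose exponent exceeds -1.\<close>

lemma integrable_inverse_cmod_ball:
  "integrable lborel (\<lambda>z. indicator (cball 0 \<rho>) z / cmod z :: real)"
proof (rule integrableI_bounded)
  show "(\<lambda>z. indicator (cball 0 \<rho>) z / cmod z :: real) \<in> borel_measurable lborel"
    by (simp, intro borel_measurable_divide borel_measurable_indicator borel_measurable_norm) auto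
  let ?f = "\<lambda>s. indicator {0..\<rho>\<^sup>2} s * s powr (-1/2) :: real"
  have "(\<integral>\<^sup>+ z. norm (indicator (cball 0 \<rho>) z / cmod z :: real) \<partial>lborel)
      \<le> (\<integral>\<^sup>+ z. ennreal (?f ((cmod z)\<^sup>2)) \<partial>lborel)"
  proof (rule nn_integral_mono)
    fix z :: complex
    have "((cmod z)\<^sup>2) powr (-1/2) = 1 / cmod z" if "z \<noteq> 0"
    proof -
      have "((cmod z)\<^sup>2) powr (-1/2) = (cmod z powr 2) powr (-1/2)"
        using that by simp
      also have "\<dots> = cmod z powr (-1)"
        by (simp only: powr_powr) simp
      finally show ?thesis
        using that by (simp add: powr_minus_divide)
    qed
    \<comment> \<open>At the origin the left side is 0, by the convention for division by
      zero.\<close>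
    then show "ennreal (norm (indicator (cball 0 \<rho>) z / cmod z :: real)) \<le> ennreal (?f ((cmod z)\<^sup>2))"
      by (cases "z = 0") (auto simp: indicator_def intro!: ennreal_leI power_mono)
  qed
  also have "\<dots> = ennreal pi * (\<integral>\<^sup>+ s. ennreal (?f s) * indicator {0..} s \<partial>lborel)"
    by (rule nn_integral_cmod_squared) measurable
  also have "(\<integral>\<^sup>+ s. ennreal (?f s) * indicator {0..} s \<partial>lborel) = (\<integral>\<^sup>+ s. ennreal (?f s) \<partial>lborel)"
    by (intro nn_integral_cong) (auto simp: indicator_def)
  also have "\<dots> = ennreal ((\<rho>\<^sup>2) powr (- 1/2 + 1) / (- 1/2 + 1))"
  proof (rule nn_integral_has_integral_lborel)
    have "((\<lambda>s. s powr (- 1/2)) has_integral ((\<rho>\<^sup>2) powr (- 1/2 + 1) / (- 1/2 + 1))) {0..\<rho>\<^sup>2}"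
      by (rule has_integral_powr_from_0) auto
    then show "(?f has_integral ((\<rho>\<^sup>2) powr (- 1/2 + 1) / (- 1/2 + 1))) UNIV"
      by (subst (asm) has_integral_restrict_UNIV[symmetric])
        (auto simp: indicator_def if_distrib cong: if_cong elim!: has_integral_eq[rotated])
  qed auto
  also have "ennreal pi * \<dots> < \<infinity>"
    by (simp add: ennreal_mult_less_top)
  finally show "(\<integral>\<^sup>+ z. norm (indicator (cball 0 \<rho>) z / cmod z :: real) \<partial>lborel) < \<infinity>" .
qed

section \<open>The regularized source as an approximate identity\<close>

lemma filterlim_shift_at_top: "LIM s at_top. s + e :> (at_top :: real filter)"
  using filterlim_tendsto_add_at_top[OF tendsto_const[of e] filterlim_ident] by (simp add: add.commute)

text \<open>This is the source of \<open>reg_green\<close> with the factor \<open>p 0 / p z\<close>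
  removed, as \<open>2 * c0 = p 0 / pi\<close>; its total mass is one.\<close>

definition radial_kernel :: "real \<Rightarrow> complex \<Rightarrow> real" where
  "radial_kernel e z = e / pi / ((cmod z)\<^sup>2 + e)\<^sup>2"

lemma radial_kernel_nonneg: "e > 0 \<Longrightarrow> radial_kernel e z \<ge> 0"
  by (simp add: radial_kernel_def)

lemma radial_kernel_measurable [measurable]: "radial_kernel e \<in> borel_measurable borel"
  unfolding radial_kernel_def by measurable

lemma nn_integral_radial_kernel:
  assumes "e > 0"
  shows "(\<integral>\<^sup>+ z. ennreal (radial_kernel e z) \<partial>lborel) = 1"
proof -
  have "(\<integral>\<^sup>+ z. ennreal (radial_kernel e z) \<partial>lborel)
      = ennreal pi * (\<integral>\<^sup>+ s. ennreal (e / pi / (s + e)\<^sup>2) * indicator {0..} s \<partial>lborel)"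
    unfolding radial_kernel_def by (rule nn_integral_cmod_squared) measurable
  also have "(\<integral>\<^sup>+ s. ennreal (e / pi / (s + e)\<^sup>2) * indicator {0..} s \<partial>lborel)
      = ennreal (0 - (- e / pi / (0 + e)))"
  proof (rule nn_integral_FTC_atLeast)
    show "((\<lambda>s. - e / pi / (s + e)) has_real_derivative e / pi / (s + e)\<^sup>2) (at s)" if "0 \<le> s" for s
      using that assms by (auto intro!: derivative_eq_intros simp: power2_eq_square)
    show "((\<lambda>s. - e / pi / (s + e)) \<longlongrightarrow> 0) at_top"
      by (rule real_tendsto_divide_at_top[OF tendsto_const filterlim_shift_at_top])
  qed (use assms in \<open>auto simp: less_imp_le\<close>)
  also have "ennreal pi * \<dots> = 1"
    using assms by (simp add: ennreal_mult[symmetric])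
  finally show ?thesis .
qed

text \<open>The first moment measures how fast the kernel concentrates. Bounding
  \<open>cmod z\<close> by the square root of \<open>s + e\<close> turns the integrand into a pure
  power of \<open>s + e\<close> with an explicit primitive.\<close>

lemma nn_integral_cmod_radial_kernel:
  assumes "e > 0"
  shows "(\<integral>\<^sup>+ z. ennreal (cmod z * radial_kernel e z) \<partial>lborel) \<le> ennreal (2 * sqrt e)"
proof -
  let ?f = "\<lambda>s. e / pi * (s + e) powr (-3/2)"
  have "(\<integral>\<^sup>+ z. ennreal (cmod z * radial_kernel e z) \<partial>lborel) \<le> (\<integral>\<^sup>+ z. ennreal (?f ((cmod z)\<^sup>2)) \<partial>lborel)"
  proof (intro nn_integral_mono ennreal_leI)
    fix z :: complex
    let ?a = "(cmod z)\<^sup>2 + e"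
    have a: "?a > 0"
      using assms by (simp add: add_nonneg_pos)
    have "cmod z \<le> ?a powr (1/2)"
      using assms by (simp add: powr_half_sqrt real_le_rsqrt)
    then have "cmod z * radial_kernel e z \<le> ?a powr (1/2) * (e / pi / ?a\<^sup>2)"
      unfolding radial_kernel_def using assms by (intro mult_right_mono) auto
    also have "\<dots> = e / pi * (?a powr (1/2) * ?a powr (-2))"
      using a by (simp add: powr_minus_divide)
    also have "?a powr (1/2) * ?a powr (-2) = ?a powr (-3/2)"
      by (simp add: powr_add[symmetric])
    finally show "cmod z * radial_kernel e z \<le> ?f ((cmod z)\<^sup>2)" .
  qed
  also have "\<dots> = ennreal pi * (\<integral>\<^sup>+ s. ennreal (?f s) * indicator {0..} s \<partial>lborel)"
    by (rule nn_integral_cmod_squared) measurable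
  also have "(\<integral>\<^sup>+ s. ennreal (?f s) * indicator {0..} s \<partial>lborel)
      = ennreal (0 - (- 2 * e / pi * (0 + e) powr (-1/2)))"
  proof (rule nn_integral_FTC_atLeast)
    show "((\<lambda>s. - 2 * e / pi * (s + e) powr (-1/2)) has_real_derivative ?f s) (at s)" if "0 \<le> s" for s
      using that assms by (auto intro!: derivative_eq_intros simp: powr_diff)
    have "((\<lambda>s. (s + e) powr (-1/2)) \<longlongrightarrow> 0) at_top"
      by (rule tendsto_neg_powr[OF _ filterlim_shift_at_top]) simp
    then show "((\<lambda>s. - 2 * e / pi * (s + e) powr (-1/2)) \<longlongrightarrow> 0) at_top"
      using tendsto_mult_left_zero tendsto_mult_right_zero by blast
  qed (use assms in \<open>auto simp: less_imp_le\<close>)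
  also have "ennreal pi * \<dots> = ennreal (2 * (e * e powr (-1/2)))"
    using assms by (simp add: ennreal_mult[symmetric])
  also have "e * e powr (-1/2) = sqrt e"
    using assms powr_add[of e 1 "-1/2"] by (simp add: powr_half_sqrt)
  finally show ?thesis .
qed


lemma radial_kernel_integral:
  assumes "e > 0"
  shows "integrable lborel (radial_kernel e)" "integral\<^sup>L lborel (radial_kernel e) = 1"
    "integrable lborel (\<lambda>z. cmod z * radial_kernel e z)"
    "integral\<^sup>L lborel (\<lambda>z. cmod z * radial_kernel e z) \<le> 2 * sqrt e"
proof -
  note nonneg = radial_kernel_nonneg[OF assms]
  show 1: "integrable lborel (radial_kernel e)"
    by (rule integrableI_nonneg) (use nonneg nn_integral_radial_kernel[OF assms] in auto)
  show "integral\<^sup>L lborel (radial_kernel e) = 1"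
    using nn_integral_eq_integral[OF 1] nonneg nn_integral_radial_kernel[OF assms] by simp
  show 2: "integrable lborel (\<lambda>z. cmod z * radial_kernel e z)"
  proof (rule integrableI_nonneg)
    show "(\<lambda>z. cmod z * radial_kernel e z) \<in> borel_measurable lborel"
      by (intro borel_measurable_times borel_measurable_norm) simp_all
    show "(\<integral>\<^sup>+ z. ennreal (cmod z * radial_kernel e z) \<partial>lborel) < \<infinity>"
      by (rule le_less_trans[OF nn_integral_cmod_radial_kernel[OF assms]]) simp
  qed (use nonneg in auto)
  show "integral\<^sup>L lborel (\<lambda>z. cmod z * radial_kernel e z) \<le> 2 * sqrt e"
    using nn_integral_eq_integral[OF 2] nonneg nn_integral_cmod_radial_kernel[OF assms] assms
    by (simp add: ennreal_le_iff)
qed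

text \<open>Continuity near 0 and boundedness far away merge into the single estimate
  \<open>\<eta> / 2 + 2 * M / \<delta> * cmod z\<close>. Integrated against the kernel, its first
  term contributes \<open>\<eta> / 2\<close> and its second a multiple of the first moment, which
  tends to 0.\<close>

lemma radial_kernel_approximate_identity:
  fixes \<psi> :: "complex \<Rightarrow> real"
  assumes cont: "continuous_on UNIV \<psi>" and M: "\<And>z. \<bar>\<psi> z\<bar> \<le> M"
  shows "((\<lambda>e. integral\<^sup>L lborel (\<lambda>z. \<psi> z * radial_kernel e z)) \<longlongrightarrow> \<psi> 0) (at_right 0)"
proof (rule tendstoI)
  fix \<eta> :: real assume "\<eta> > 0"
  then have "\<eta> / 2 > 0"
    by simp
  then obtain \<delta> where \<delta>: "\<delta> > 0" "\<And>z. cmod z < \<delta> \<Longrightarrow> \<bar>\<psi> z - \<psi> 0\<bar> < \<eta> / 2"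
    using cont unfolding continuous_on_iff dist_real_def by (metis UNIV_I dist_0_norm dist_commute)
  have M0: "M \<ge> 0"
    using M[of 0] by linarith
  have bound: "\<bar>\<psi> z - \<psi> 0\<bar> \<le> \<eta> / 2 + 2 * M / \<delta> * cmod z" for z
  proof (cases "cmod z < \<delta>")
    case True
    moreover have "2 * M / \<delta> * cmod z \<ge> 0"
      using \<delta> M0 by simp
    ultimately show ?thesis
      using \<delta>(2)[of z] by linarith
  next
    case False
    have "2 * M * \<delta> \<le> 2 * M * cmod z"
      using False M0 by (intro mult_left_mono) auto
    then have "2 * M \<le> 2 * M / \<delta> * cmod z"
      using \<delta> by (simp add: field_simps)
    then show ?thesis
      using M[of z] M[of 0] \<open>\<eta> > 0\<close> by linarith
  qed
  have [measurable]: "\<psi> \<in> borel_measurable borel"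
    using cont by (rule borel_measurable_continuous_onI)
  have est: "\<bar>integral\<^sup>L lborel (\<lambda>z. \<psi> z * radial_kernel e z) - \<psi> 0\<bar> \<le> \<eta> / 2 + 2 * M / \<delta> * (2 * sqrt e)"
    if e: "e > 0" for e
  proof -
    note K = radial_kernel_integral[OF e]
    have i: "integrable lborel (\<lambda>z. \<psi> z * radial_kernel e z)"
    proof (rule Bochner_Integration.integrable_bound[OF integrable_mult_right[OF K(1), of M]])
      show "AE z in lborel. norm (\<psi> z * radial_kernel e z) \<le> norm (M * radial_kernel e z)"
        using M M0 radial_kernel_nonneg[OF e] by (simp add: abs_mult mult_right_mono)
    qed measurable
    have "integral\<^sup>L lborel (\<lambda>z. \<psi> z * radial_kernel e z) - \<psi> 0
        = integral\<^sup>L lborel (\<lambda>z. \<psi> z * radial_kernel e z) - integral\<^sup>L lborel (\<lambda>z. \<psi> 0 * radial_kernel e z)"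
      using K by simp
    also have "\<dots> = integral\<^sup>L lborel (\<lambda>z. (\<psi> z - \<psi> 0) * radial_kernel e z)"
      using i K by (subst Bochner_Integration.integral_diff[symmetric]) (auto simp: left_diff_distrib)
    also have "\<bar>\<dots>\<bar> \<le> integral\<^sup>L lborel (\<lambda>z. \<eta> / 2 * radial_kernel e z + 2 * M / \<delta> * (cmod z * radial_kernel e z))"
    proof (rule order_trans[OF integral_abs_bound integral_mono])
      show "integrable lborel (\<lambda>z. \<bar>(\<psi> z - \<psi> 0) * radial_kernel e z\<bar>)"
        using i K by (simp add: left_diff_distrib)
      show "integrable lborel (\<lambda>z. \<eta> / 2 * radial_kernel e z + 2 * M / \<delta> * (cmod z * radial_kernel e z))"
        using K by (intro Bochner_Integration.integrable_add integrable_mult_right) auto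
      show "\<bar>(\<psi> z - \<psi> 0) * radial_kernel e z\<bar>
          \<le> \<eta> / 2 * radial_kernel e z + 2 * M / \<delta> * (cmod z * radial_kernel e z)" for z
        using mult_right_mono[OF bound[of z] radial_kernel_nonneg[OF e, of z]] radial_kernel_nonneg[OF e, of z]
        by (simp add: abs_mult distrib_right mult.assoc)
    qed
    also have "\<dots> = \<eta> / 2 * 1 + 2 * M / \<delta> * integral\<^sup>L lborel (\<lambda>z. cmod z * radial_kernel e z)"
      using K by (subst Bochner_Integration.integral_add) (auto intro: integrable_mult_right)
    also have "\<dots> \<le> \<eta> / 2 * 1 + 2 * M / \<delta> * (2 * sqrt e)"
      using K(4) \<delta> M0 by (intro add_left_mono mult_left_mono) auto
    finally show ?thesis
      by simp
  qed
  have "((\<lambda>e. 2 * M / \<delta> * (2 * sqrt e)) \<longlongrightarrow> 0) (at_right 0)"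
    using \<delta> by (auto intro!: tendsto_eq_intros)
  then have "\<forall>\<^sub>F e in at_right 0. 2 * M / \<delta> * (2 * sqrt e) < \<eta> / 2"
    using \<open>\<eta> > 0\<close> by (intro order_tendstoD) auto
  with eventually_at_right_less
  show "\<forall>\<^sub>F e in at_right 0. dist (integral\<^sup>L lborel (\<lambda>z. \<psi> z * radial_kernel e z)) (\<psi> 0) < \<eta>"
    by eventually_elim (use est in \<open>force simp: dist_real_def\<close>)
qed

section \<open>The Green function of a disk\<close>

lemma Ck_on_subset: "Ck_on k f S \<Longrightarrow> T \<subseteq> S \<Longrightarrow> Ck_on k f T"
  by (induction k arbitrary: f) (auto intro: continuous_on_subset, blast)

context radial_potential
begin

lemma reg_green_measurable: "reg_green \<rho> 0 \<in> borel_measurable borel"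
  by (rule borel_measurable_continuous_countable_exceptions[of "{0}"])
    (auto intro: continuous_on_green)

lemma integrable_green_ball:
  assumes "\<rho> > 0"
  shows "integrable lborel (\<lambda>z. indicator (cball 0 \<rho>) z * reg_green \<rho> 0 z)"
proof -
  obtain C where C: "\<And>z. z \<noteq> 0 \<Longrightarrow> cmod z \<le> \<rho> \<Longrightarrow> \<bar>reg_green \<rho> 0 z\<bar> \<le> C / cmod z"
    using abs_green_le[OF assms] by blast
  show ?thesis
  proof (rule Bochner_Integration.integrable_bound)
    show "integrable lborel (\<lambda>z. C * (indicator (cball 0 \<rho>) z / cmod z))"
      by (intro integrable_mult_right integrable_inverse_cmod_ball)
    show "(\<lambda>z. indicator (cball 0 \<rho>) z * reg_green \<rho> 0 z) \<in> borel_measurable lborel"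
      using reg_green_measurable[of \<rho>] by (simp, intro borel_measurable_times borel_measurable_indicator) auto
    have "AE z in lborel. z \<noteq> (0::complex)"
      by (rule AE_lborel_singleton)
    then show "AE z in lborel. norm (indicator (cball 0 \<rho>) z * reg_green \<rho> 0 z)
        \<le> norm (C * (indicator (cball 0 \<rho>) z / cmod z))"
    proof eventually_elim
      case (elim z)
      then show ?case
        using order_trans[OF C[of z] abs_ge_self] by (auto simp: indicator_def)
    qed
  qed
qed

text \<open>Green's second identity: the field \<open>g\<close> grad \<open>\<phi>\<close> minus
  \<open>\<phi>\<close> grad \<open>g\<close> has compact support, so each component differentiated
  along its own axis integrates to zero. The products of first derivatives cancel in its divergence,
  and the term \<open>u g\<close> in the Laplacian of \<open>g\<close> moves over to
  \<open>\<phi>\<close>.\<close>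

lemma reg_green_integral_by_parts:
  assumes e: "e > 0" and \<phi>: "C2_on \<phi> G H UNIV" and K: "compact K" "\<And>z. z \<notin> K \<Longrightarrow> \<phi> z = 0"
  shows "integral\<^sup>L lborel (\<lambda>z. reg_green \<rho> e z * (laplacian \<phi> z - u z * \<phi> z))
    = integral\<^sup>L lborel (\<lambda>z. p 0 * (\<phi> z / p z) * radial_kernel e z)"
proof -
  define g where "g = reg_green \<rho> e"
  define Gg where "Gg = radial_grad (\<lambda>s. c0 / (s + e)) (profile \<rho> e)"
  define Hg where "Hg = radial_hess (\<lambda>s. c0 / (s + e)) (\<lambda>s. - c0 / (s + e)\<^sup>2) (profile \<rho> e)"
  have pos: "- e < (cmod z)\<^sup>2" for z
    using e zero_le_power2[of "cmod z"] by linarith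
  then have "{z. (cmod z)\<^sup>2 > - e} = UNIV"
    by auto
  then have g: "C2_on g Gg Hg UNIV"
    using reg_green_C2[of \<rho> e] by (simp add: g_def Gg_def Hg_def)
  have lg: "(\<Sum>b\<in>Basis. Hg b z \<bullet> b) = u z * g z + p 0 / p z * radial_kernel e z" for z
  proof -
    have "(\<Sum>b\<in>Basis. Hg b z \<bullet> b) = laplacian g z"
      using has_laplacian_imp_laplacian[OF C2_on_has_laplacian[OF g]] by simp
    also have "\<dots> = u z * g z + 2 * c0 * e / ((cmod z)\<^sup>2 + e)\<^sup>2 / p z"
      unfolding g_def by (rule has_laplacian_imp_laplacian[OF reg_green_has_laplacian[OF pos]])
    also have "2 * c0 * e / ((cmod z)\<^sup>2 + e)\<^sup>2 / p z = p 0 / p z * radial_kernel e z"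
      by (simp add: c0_def radial_kernel_def)
    finally show ?thesis .
  qed
  have l\<phi>: "laplacian \<phi> z = (\<Sum>b\<in>Basis. H b z \<bullet> b)" for z
    using has_laplacian_imp_laplacian[OF C2_on_has_laplacian[OF \<phi>]] by simp
  define Gf where "Gf = (\<lambda>b z. (g z *\<^sub>R H b z + (G z \<bullet> b) *\<^sub>R Gg z) - (\<phi> z *\<^sub>R Hg b z + (Gg z \<bullet> b) *\<^sub>R G z))"
  have G0: "G z = 0" if "z \<notin> K" for z
    using \<phi> K that by (intro GDERIV_eq_0_outside_support[of \<phi> z "G z" K])
      (auto simp: C2_on_def compact_imp_closed)
  have D: "GDERIV (\<lambda>z. g z * (G z \<bullet> b) - \<phi> z * (Gg z \<bullet> b)) z :> Gf b z" if "b \<in> Basis" for b z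
    unfolding Gf_def using g \<phi> that
    by (intro GDERIV_diff GDERIV_mult) (auto simp: C2_on_def)
  have cont: "continuous_on UNIV (\<lambda>z. Gf b z \<bullet> b)" if "b \<in> Basis" for b
    unfolding Gf_def
    by (intro continuous_intros C2_on_continuous[OF g] C2_on_continuous[OF \<phi>] that)
  have zero: "integral\<^sup>L lborel (\<lambda>z. Gf b z \<bullet> b) = 0" if "b \<in> Basis" for b
    by (rule integral_directional_derivative_eq_0[OF D cont K(1)]) (use that K G0 in auto)
  have Gf0: "Gf b z \<bullet> b = 0" if "b \<in> Basis" "z \<notin> K" for b z
  proof -
    have "Gf b z = 0"
      by (rule GDERIV_eq_0_outside_support[OF D _ that(2)]) (use that K G0 compact_imp_closed in auto)
    then show ?thesis
      by simp
  qed
  have "(\<Sum>b\<in>Basis. Gf b z \<bullet> b) = g z * (laplacian \<phi> z - u z * \<phi> z) - p 0 * (\<phi> z / p z) * radial_kernel e z" for z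
  proof -
    have "(\<Sum>b\<in>Basis. Gf b z \<bullet> b) = g z * laplacian \<phi> z - \<phi> z * (\<Sum>b\<in>Basis. Hg b z \<bullet> b)"
      unfolding Gf_def l\<phi> by (simp add: inner_add_left inner_diff_left mult.commute sum.distrib
        sum_subtractf sum_distrib_left)
    then show ?thesis
      unfolding lg by (simp add: algebra_simps)
  qed
  moreover have "integral\<^sup>L lborel (\<lambda>z. \<Sum>b\<in>Basis. Gf b z \<bullet> b) = 0"
    using zero integrable_continuous_compact_support[OF cont K(1) Gf0]
    by (subst Bochner_Integration.integral_sum) auto
  ultimately have "integral\<^sup>L lborel (\<lambda>z. g z * (laplacian \<phi> z - u z * \<phi> z)
      - p 0 * (\<phi> z / p z) * radial_kernel e z) = 0"
    by simp
  moreover have "integrable lborel (\<lambda>z. g z * (laplacian \<phi> z - u z * \<phi> z))"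
  proof (rule integrable_continuous_compact_support[OF _ K(1)])
    show "continuous_on UNIV (\<lambda>z. g z * (laplacian \<phi> z - u z * \<phi> z))"
      unfolding l\<phi>
      by (intro continuous_intros C2_on_continuous[OF g] C2_on_continuous[OF \<phi>] continuous_on_u)
    show "g z * (laplacian \<phi> z - u z * \<phi> z) = 0" if "z \<notin> K" for z
    proof -
      have "H b z = 0" if "b \<in> Basis" for b
        using \<phi> that G0 K \<open>z \<notin> K\<close>
        by (intro GDERIV_eq_0_outside_support[of "\<lambda>z. G z \<bullet> b" z "H b z" K])
          (auto simp: C2_on_def compact_imp_closed)
      then show ?thesis
        using that K by (simp add: l\<phi>)
    qed
  qed
  moreover have "integrable lborel (\<lambda>z. p 0 * (\<phi> z / p z) * radial_kernel e z)"
  proof (rule integrable_continuous_compact_support[OF _ K(1)])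
    have "(cmod z)\<^sup>2 + e \<noteq> 0" for z
      using pos[of z] by linarith
    then show "continuous_on UNIV (\<lambda>z. p 0 * (\<phi> z / p z) * radial_kernel e z)"
      unfolding radial_kernel_def
      by (intro continuous_intros C2_on_continuous[OF \<phi>] continuous_on_p) auto
  qed (use K in auto)
  ultimately show ?thesis
    by (simp add: g_def)
qed

text \<open>Let \<open>e\<close> tend to 0 in the regularized identity. The left side converges by
  domination on the support of \<open>\<phi>\<close>, the right side by the approximate identity,
  whose limit is \<open>p 0 * (\<phi> 0 / p 0)\<close>.\<close>

lemma fundamental_eq_green:
  assumes \<rho>: "\<rho> > 0"
  shows "fundamental_eq u (ball 0 \<rho>) 0 (reg_green \<rho> 0)"
  unfolding fundamental_eq_def
proof (intro conjI allI impI)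
  fix K :: "complex set" assume K: "compact K \<and> K \<subseteq> ball 0 \<rho>"
  have "integrable lborel (\<lambda>z. indicator K z * (indicator (cball 0 \<rho>) z * reg_green \<rho> 0 z))"
    using integrable_real_mult_indicator[of K lborel "\<lambda>z. indicator (cball 0 \<rho>) z * reg_green \<rho> 0 z"]
      integrable_green_ball[OF \<rho>] K by (simp add: mult.commute compact_imp_closed)
  also have "(\<lambda>z. indicator K z * (indicator (cball 0 \<rho>) z * reg_green \<rho> 0 z))
      = (\<lambda>z. indicator K z *\<^sub>R reg_green \<rho> 0 z)"
    using K by (auto simp: indicator_def fun_eq_iff)
  finally show "reg_green \<rho> 0 absolutely_integrable_on K"
    unfolding set_integrable_def
    using integrable_completion[OF borel_measurable_integrable] by blast
next
  fix \<phi> :: "complex \<Rightarrow> real" assume "test_function_on (ball 0 \<rho>) \<phi>"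
  then have sm: "smooth_on \<phi> UNIV" and K: "compact (closure {z. \<phi> z \<noteq> 0})"
    and sub: "closure {z. \<phi> z \<noteq> 0} \<subseteq> ball 0 \<rho>"
    by (auto simp: test_function_on_def)
  define K where "K = closure {z. \<phi> z \<noteq> 0}"
  have K: "compact K" "K \<subseteq> ball 0 \<rho>" "\<And>z. z \<notin> K \<Longrightarrow> \<phi> z = 0"
    using K sub closure_subset[of "{z. \<phi> z \<noteq> 0}"] by (auto simp: K_def)
  from sm have "Ck_on 2 \<phi> UNIV"
    by (simp add: smooth_on_def)
  then obtain G H where \<phi>: "C2_on \<phi> G H UNIV"
    using Ck_on_2_iff by blast
  define L where "L = (\<lambda>z. laplacian \<phi> z - u z * \<phi> z)"
  have l\<phi>: "laplacian \<phi> z = (\<Sum>b\<in>Basis. H b z \<bullet> b)" for z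
    using has_laplacian_imp_laplacian[OF C2_on_has_laplacian[OF \<phi>]] by simp
  have contL: "continuous_on UNIV L"
    unfolding L_def l\<phi> by (intro continuous_intros C2_on_continuous[OF \<phi>] continuous_on_u)
  have L0: "L z = 0" if "z \<notin> K" for z
  proof -
    have G0: "G z = 0" if "z \<notin> K" for z
      using \<phi> K that by (intro GDERIV_eq_0_outside_support[of \<phi> z "G z" K])
        (auto simp: C2_on_def compact_imp_closed)
    have "H b z = 0" if "b \<in> Basis" for b
      using \<phi> that G0 K \<open>z \<notin> K\<close>
      by (intro GDERIV_eq_0_outside_support[of "\<lambda>z. G z \<bullet> b" z "H b z" K])
        (auto simp: C2_on_def compact_imp_closed)
    then show ?thesis
      using that K by (simp add: L_def l\<phi>)
  qed
  obtain M where M: "M \<ge> 0" "\<And>z. \<bar>L z\<bar> \<le> M"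
    by (rule bounded_continuous_compact_support[OF contL K(1) L0]) auto
  have [measurable]: "L \<in> borel_measurable borel" "reg_green \<rho> 0 \<in> borel_measurable borel"
    using borel_measurable_continuous_onI[OF contL] reg_green_measurable by auto
  have AE0: "AE z in lborel. z \<noteq> (0::complex)"
    by (rule AE_lborel_singleton)
  have w: "integrable lborel (\<lambda>z. M * \<bar>indicator (cball 0 \<rho>) z * reg_green \<rho> 0 z\<bar>)"
    using integrable_green_ball[OF \<rho>] by (intro integrable_mult_right integrable_abs)
  have dom: "\<bar>reg_green \<rho> e z * L z\<bar> \<le> M * \<bar>indicator (cball 0 \<rho>) z * reg_green \<rho> 0 z\<bar>"
    if "z \<noteq> 0" "e \<ge> 0" for z :: complex and e
  proof (cases "z \<in> K")
    case True
    then have "cmod z \<le> \<rho>"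
      using K by auto
    then show ?thesis
      using abs_reg_green_le[OF that(2,1), of \<rho>] M
      by (simp add: abs_mult mult.commute) (rule mult_mono, auto)
  qed (use L0 M in auto)
  define e where "e = (\<lambda>n. inverse (real (Suc n)))"
  have e: "e n > 0" for n
    by (simp add: e_def)
  have e_lim: "filterlim e (at_right 0) sequentially"
    using LIMSEQ_inverse_real_of_nat e
    by (intro filterlim_at_withinI) (auto simp: e_def)
  have "(\<lambda>n. integral\<^sup>L lborel (\<lambda>z. reg_green \<rho> (e n) z * L z))
      \<longlonglongrightarrow> integral\<^sup>L lborel (\<lambda>z. reg_green \<rho> 0 z * L z)"
  proof (rule integral_dominated_convergence[OF _ _ w])
    show "(\<lambda>z. reg_green \<rho> (e n) z * L z) \<in> borel_measurable lborel" for n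
      using borel_measurable_continuous_onI[OF continuous_on_reg_green[OF e]] by simp
    show "AE z in lborel. (\<lambda>n. reg_green \<rho> (e n) z * L z) \<longlonglongrightarrow> reg_green \<rho> 0 z * L z"
      using AE0
    proof eventually_elim
      case (elim z)
      show ?case
      proof (cases "z \<in> K")
        case True
        then have "cmod z \<le> \<rho>"
          using K by auto
        then show ?thesis
          using elim by (intro tendsto_mult tendsto_const filterlim_compose[OF reg_green_tendsto e_lim])
      qed (simp add: L0)
    qed
    show "AE z in lborel. norm (reg_green \<rho> (e n) z * L z)
        \<le> M * \<bar>indicator (cball 0 \<rho>) z * reg_green \<rho> 0 z\<bar>" for n
      using AE0 by eventually_elim (use dom e[of n] in \<open>auto simp: less_imp_le\<close>)
  qed measurable
  moreover have "(\<lambda>n. integral\<^sup>L lborel (\<lambda>z. reg_green \<rho> (e n) z * L z)) \<longlonglongrightarrow> \<phi> 0"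
  proof -
    have cont: "continuous_on UNIV (\<lambda>z. p 0 * (\<phi> z / p z))"
      by (intro continuous_intros C2_on_continuous[OF \<phi>] continuous_on_p) auto
    obtain M' where "\<And>z. \<bar>p 0 * (\<phi> z / p z)\<bar> \<le> M'"
      by (rule bounded_continuous_compact_support[OF cont K(1)]) (use K in auto)
    from filterlim_compose[OF radial_kernel_approximate_identity[OF cont this] e_lim]
    have "(\<lambda>n. integral\<^sup>L lborel (\<lambda>z. p 0 * (\<phi> z / p z) * radial_kernel (e n) z)) \<longlonglongrightarrow> \<phi> 0"
      by simp
    moreover have "integral\<^sup>L lborel (\<lambda>z. reg_green \<rho> (e n) z * L z)
        = integral\<^sup>L lborel (\<lambda>z. p 0 * (\<phi> z / p z) * radial_kernel (e n) z)" for n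
      unfolding L_def by (rule reg_green_integral_by_parts[OF e \<phi> K(1,3)])
    ultimately show ?thesis
      by simp
  qed
  ultimately have eq: "integral\<^sup>L lborel (\<lambda>z. reg_green \<rho> 0 z * L z) = \<phi> 0"
    by (rule LIMSEQ_unique)
  have "integrable lborel (\<lambda>z. reg_green \<rho> 0 z * L z)"
  proof (rule Bochner_Integration.integrable_bound[OF w])
    show "AE z in lborel. norm (reg_green \<rho> 0 z * L z)
        \<le> norm (M * \<bar>indicator (cball 0 \<rho>) z * reg_green \<rho> 0 z\<bar>)"
      using AE0 by eventually_elim (use dom M in auto)
  qed measurable
  then have "integral UNIV (\<lambda>z. reg_green \<rho> 0 z * L z) = \<phi> 0"
    using integral_lborel eq by metis
  moreover have "integral (ball 0 \<rho>) (\<lambda>z. reg_green \<rho> 0 z * L z) = integral UNIV (\<lambda>z. reg_green \<rho> 0 z * L z)"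
  proof -
    have "(\<lambda>z. if z \<in> ball 0 \<rho> then reg_green \<rho> 0 z * L z else 0) = (\<lambda>z. reg_green \<rho> 0 z * L z)"
    proof
      show "(if z \<in> ball 0 \<rho> then reg_green \<rho> 0 z * L z else 0) = reg_green \<rho> 0 z * L z" for z
        using L0[of z] K(2) by (cases "z \<in> K") auto
    qed
    then show ?thesis
      using Henstock_Kurzweil_Integration.integral_restrict_UNIV by metis
  qed
  ultimately show "integral (ball 0 \<rho>) (\<lambda>z. reg_green \<rho> 0 z * (laplacian \<phi> z - u z * \<phi> z)) = \<phi> 0"
    by (simp add: L_def)
qed

lemma green_function_ball:
  assumes "\<rho> > 0"
  shows "green_function u (ball 0 \<rho>) 0 (reg_green \<rho> 0)"
  unfolding green_function_def
proof (intro conjI)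
  show "Ck_on 2 (reg_green \<rho> 0) (ball 0 \<rho> - {0})"
    by (rule Ck_on_subset[of _ _ "{z. (cmod z)\<^sup>2 > - 0}"])
      (use reg_green_C2[of \<rho> 0] Ck_on_2_iff in auto)
  show "\<forall>z\<in>ball 0 \<rho> - {0}. laplacian (reg_green \<rho> 0) z - u z * reg_green \<rho> 0 z = 0"
    using has_laplacian_imp_laplacian[OF reg_green_has_laplacian[of 0]] by auto
  show "\<exists>B. \<forall>\<^sub>F z in at 0. \<bar>reg_green \<rho> 0 z - ln (cmod (z - 0)) / (2 * pi)\<bar> \<le> B"
    using green_log_bound by simp
  show "continuous_on (closure (ball 0 \<rho>) - {0}) (reg_green \<rho> 0)"
    by (rule continuous_on_green) auto
  show "\<forall>x\<in>frontier (ball 0 \<rho>). reg_green \<rho> 0 x = 0"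
    using assms by (auto simp: frontier_ball)
qed (rule fundamental_eq_green[OF assms])

end

section \<open>Comparison with disks\<close>

context radial_potential
begin

text \<open>At a negative minimum of \<open>V / p\<close>, where \<open>V\<close> is \<open>v\<close> plus a small strict supersolution,
  \<open>V - m p\<close> has a local minimum with value \<open>0\<close>, so no sign condition on \<open>u\<close> is needed.\<close>

lemma comparison_principle:
  assumes D: "open D" "bounded D" "0 \<in> D"
    and cont: "continuous_on (closure D - {0}) v"
    and lap: "\<And>z. z \<in> D \<Longrightarrow> z \<noteq> 0 \<Longrightarrow> has_laplacian v z (u z * v z)"
    and front: "\<And>x. x \<in> frontier D \<Longrightarrow> v x \<ge> 0"
    and below: "\<forall>\<^sub>F z in at 0. B \<le> v z"
    and z: "z \<in> D" "z \<noteq> 0"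
  shows "v z \<ge> 0"
proof -
  obtain \<rho> where \<rho>: "\<rho> > 0" "D \<subseteq> ball 0 \<rho>"
    using D(2) bounded_subset_ballD[of D 0] by auto
  then have cl: "closure D \<subseteq> cball 0 \<rho>"
    using closure_mono[OF \<rho>(2)] by simp
  \<comment> \<open>The constant choice \<open>k = 1\<close> in the radial ansatz:
    \<open>\<psi> = p P\<close> satisfies \<open>(\<Delta> - u) \<psi> = 2 / p\<close>, strictly
    positive. Starting the half-line at -1 keeps \<open>s = 0\<close> in its interior, so
    \<open>\<psi>\<close> is regular at the origin.\<close>
  have "\<exists>P. P (\<rho>\<^sup>2) = 0 \<and> (\<forall>s>-1. (P has_real_derivative 1 / (2 * q s)) (at s))"
    by (intro antiderivative_right continuous_intros isCont_q) auto
  then obtain P where P0: "P (\<rho>\<^sup>2) = 0"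
    and P: "\<And>s. s > -1 \<Longrightarrow> (P has_real_derivative 1 / (2 * q s)) (at s)"
    by blast
  define \<psi> where "\<psi> = radial_fun P"
  have pos: "- 1 < (cmod w)\<^sup>2" for w
    using zero_le_power2[of "cmod w"] by linarith
  have \<psi>lap: "has_laplacian \<psi> w (u w * \<psi> w + 2 / p w)" for w
    unfolding \<psi>_def
    using radial_fun_has_laplacian[of "{-1<..}" P "\<lambda>_. 1" "\<lambda>_. 0" w] P pos[of w] by simp
  have \<psi>_le: "\<psi> w \<le> 0" if "cmod w \<le> \<rho>" for w
  proof -
    have "P ((cmod w)\<^sup>2) \<le> P (\<rho>\<^sup>2)"
    proof (rule DERIV_nonneg_imp_nondecreasing[of "(cmod w)\<^sup>2" "\<rho>\<^sup>2" P])
      show "(cmod w)\<^sup>2 \<le> \<rho>\<^sup>2"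
        using that by (intro power_mono) auto
      show "\<exists>y. (P has_real_derivative y) (at x) \<and> 0 \<le> y" if "(cmod w)\<^sup>2 \<le> x" "x \<le> \<rho>\<^sup>2" for x
        using P[of x] that(1) pos[of w] q_pos[of x] by (intro exI[of _ "1 / (2 * q x)"]) auto
    qed
    then show ?thesis
      unfolding \<psi>_def radial_fun_def using P0 p_pos[of w] by (simp add: mult_nonneg_nonpos)
  qed
  have cont\<psi>: "continuous_on S \<psi>" for S
  proof -
    have "{z. (cmod z)\<^sup>2 \<in> {-1<..}} = UNIV"
      using pos by auto
    then have "C2_on \<psi> (radial_grad (\<lambda>_. 1) P) (radial_hess (\<lambda>_. 1) (\<lambda>_. 0) P) UNIV"
      unfolding \<psi>_def using radial_fun_C2[of "{-1<..}" P "\<lambda>_. 1" "\<lambda>_. 0"] P by simp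
    then show ?thesis
      using C2_on_continuous(1) continuous_on_subset by blast
  qed
  let ?g = "reg_green \<rho> 0"
  \<comment> \<open>Both corrections are nonnegative on the closure of \<open>D\<close>. The term
    \<open>- t * ?g\<close> tends to plus infinity at the origin and beats the lower bound
    \<open>B\<close> there; the term \<open>- t * \<psi>\<close> makes the differential inequality
    strict.\<close>
  have main: "v z - t * ?g z - t * \<psi> z \<ge> 0" if t: "t > 0" for t
  proof (rule ccontr)
    define V where "V = (\<lambda>z. v z - t * ?g z - t * \<psi> z)"
    assume "\<not> v z - t * ?g z - t * \<psi> z \<ge> 0"
    then have neg: "V z < 0"
      by (simp add: V_def)
    have "\<exists>r>0. \<forall>w. w \<noteq> 0 \<and> cmod w < r \<longrightarrow> V w > 0"
    proof -
      obtain C where C: "\<forall>\<^sub>F w in at 0. \<bar>?g w - ln (cmod w) / (2 * pi)\<bar> \<le> C"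
        using green_log_bound by blast
      have "((\<lambda>w::complex. cmod w) \<longlongrightarrow> 0) (at 0)"
        by (rule tendsto_norm_zero) (rule tendsto_ident_at)
      \<comment> \<open>The exponential solves \<open>ln r / (2 * pi) + C = B / t - 1\<close> for
        \<open>r\<close>, so inside that radius the disk's Green function is below
        \<open>B / t\<close>.\<close>
      then have "\<forall>\<^sub>F w::complex in at 0. cmod w < min \<rho> (exp (2 * pi * (B / t - C - 1)))"
        using \<rho> by (intro order_tendstoD) auto
      moreover have "\<forall>\<^sub>F w in at 0. w \<noteq> (0::complex)"
        by (rule eventually_neq_at_within)
      ultimately have "\<forall>\<^sub>F w in at 0. V w > 0"
        using C below
      proof eventually_elim
        case (elim w)
        have "ln (cmod w) < ln (exp (2 * pi * (B / t - C - 1)))"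
          using elim by (intro ln_less_cancel_iff[THEN iffD2]) auto
        then have "ln (cmod w) / (2 * pi) < B / t - C - 1"
          by (simp add: divide_less_eq mult.commute del: ln_less_cancel_iff)
        then have "?g w < B / t"
          using elim by linarith
        then have "t * ?g w < B"
          using t by (simp add: field_simps)
        moreover have "t * \<psi> w \<le> 0"
          using t \<psi>_le[of w] elim by (simp add: mult_nonneg_nonpos)
        ultimately show ?case
          using elim unfolding V_def by linarith
      qed
      then show ?thesis
        unfolding eventually_at by auto
    qed
    then obtain r where r: "r > 0" "\<And>w. w \<noteq> 0 \<Longrightarrow> cmod w < r \<Longrightarrow> V w > 0"
      by blast
    \<comment> \<open>Only half of the radius is removed: a point with \<open>V < 0\<close> has
      modulus at least \<open>r\<close>, so the minimum is attained away from the inner rim of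
      \<open>K\<close>.\<close>
    define K where "K = closure D - ball 0 (r / 2)"
    have K: "compact K" "0 \<notin> K"
      using D r by (auto simp: K_def intro!: compact_diff)
    have zK: "z \<in> K"
      using z neg r(2)[of z] r(1) closure_subset[of D] by (force simp: K_def)
    have contV: "continuous_on K (\<lambda>w. V w / p w)"
      unfolding V_def
      by (intro continuous_intros continuous_on_green cont\<psi> continuous_on_p continuous_on_subset[OF cont])
        (use K in \<open>auto simp: K_def\<close>)
    obtain w where w: "w \<in> K" and min: "\<And>y. y \<in> K \<Longrightarrow> V w / p w \<le> V y / p y"
      using continuous_attains_inf[OF K(1) _ contV] zK by blast
    define m where "m = V w / p w"
    have "V w / p w \<le> V z / p z"
      by (rule min[OF zK])
    also have "\<dots> < 0"
      using neg p_pos[of z] by (simp add: divide_neg_pos)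
    finally have "V w / p w < 0" .
    then have Vw: "V w < 0"
      using p_pos[of w] by (simp add: divide_less_0_iff)
    have w0: "w \<noteq> 0" "cmod w \<ge> r"
      using w K Vw r(2)[of w] by force+
    have "w \<notin> frontier D"
    proof
      assume "w \<in> frontier D"
      then have "v w \<ge> 0" "w \<in> closure D"
        using front frontier_closures by auto
      moreover have "?g w \<le> 0"
        using w0 cl \<open>w \<in> closure D\<close> by (intro reg_green_nonpos) auto
      moreover have "\<psi> w \<le> 0"
        using cl \<open>w \<in> closure D\<close> by (intro \<psi>_le) auto
      ultimately have "V w \<ge> 0"
        unfolding V_def using t by (smt (verit) mult_nonneg_nonpos)
      then show False
        using Vw by simp
    qed
    then have wD: "w \<in> D"
      using w D by (auto simp: K_def frontier_def interior_open)
    have "\<forall>\<^sub>F y in nhds w. y \<in> D - cball 0 (r / 2)"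
      using wD w0 r D by (intro eventually_nhds_in_open) auto
    then have "\<forall>\<^sub>F y in nhds w. 1 * V w + (- m) * p w \<le> 1 * V y + (- m) * p y"
    proof eventually_elim
      case (elim y)
      then have "y \<in> K"
        using closure_subset[of D] by (auto simp: K_def)
      then have "m \<le> V y / p y"
        unfolding m_def by (rule min)
      then have "m * p y \<le> V y"
        using p_pos[of y] by (simp add: pos_le_divide_eq)
      then show ?case
        by (simp add: m_def)
    qed
    moreover have "has_laplacian (\<lambda>y. 1 * V y + (- m) * p y) w
        (1 * (1 * (1 * (u w * v w) + (- t) * (u w * ?g w)) + (- t) * (u w * \<psi> w + 2 / p w)) + (- m) * (u w * p w))"
    proof -
      have "has_laplacian ?g w (u w * ?g w)"
        using reg_green_has_laplacian[of 0 w \<rho>] w0 by simp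
      from has_laplacian_lincomb[OF has_laplacian_lincomb[OF has_laplacian_lincomb[OF lap[OF wD w0(1)] this] \<psi>lap] has_laplacian_p,
          of 1 1 1 "-t" "-t" "-m"]
      show ?thesis
        by (simp add: V_def algebra_simps)
    qed
    ultimately have "0 \<le> 1 * (1 * (1 * (u w * v w) + (- t) * (u w * ?g w)) + (- t) * (u w * \<psi> w + 2 / p w)) + (- m) * (u w * p w)"
      by (rule has_laplacian_local_min[rotated])
    also have "\<dots> = u w * (V w - m * p w) - t * (2 / p w)"
      by (simp add: V_def algebra_simps)
    also have "\<dots> = - (t * (2 / p w))"
      by (simp add: m_def)
    also have "\<dots> < 0"
      using t p_pos[of w] by simp
    finally show False
      by simp
  qed
  show ?thesis
  proof (rule tendsto_lowerbound[of "\<lambda>t. v z - t * ?g z - t * \<psi> z" _ "at_right 0"])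
    show "((\<lambda>t. v z - t * ?g z - t * \<psi> z) \<longlongrightarrow> v z) (at_right 0)"
      by (auto intro!: tendsto_eq_intros)
    show "\<forall>\<^sub>F t in at_right 0. 0 \<le> v z - t * ?g z - t * \<psi> z"
      using eventually_at_right_less by eventually_elim (rule main)
  qed simp
qed

section \<open>Green functions of general domains against those of disks\<close>

lemma green_function_has_laplacian:
  assumes "green_function u D 0 g" "open D" "z \<in> D" "z \<noteq> 0"
  shows "has_laplacian g z (u z * g z)"
proof -
  have "has_laplacian g z (laplacian g z)"
    using assms by (intro Ck_on_2_has_laplacian[of _ "D - {0}"]) (auto simp: green_function_def)
  moreover have "laplacian g z = u z * g z"
    using assms by (auto simp: green_function_def)
  ultimately show ?thesis
    by simp
qed

lemma green_function_nonpos: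
  assumes g: "green_function u D 0 g" and D: "open D" "bounded D" "0 \<in> D" and z: "z \<in> closure D" "z \<noteq> 0"
  shows "g z \<le> 0"
proof (cases "z \<in> D")
  case False
  then have "z \<in> frontier D"
    using z D by (simp add: frontier_def interior_open)
  then show ?thesis
    using g by (simp add: green_function_def)
next
  case True
  obtain B where B: "\<forall>\<^sub>F z in at 0. \<bar>g z - ln (cmod z) / (2 * pi)\<bar> \<le> B"
    using g by (auto simp: green_function_def)
  \<comment> \<open>The zero summand gives \<open>- g\<close> the shape of a linear combination, to
    which \<open>has_laplacian_lincomb\<close> applies.\<close>
  have "0 \<le> -1 * g z + 0 * g z"
  proof (rule comparison_principle[OF D _ _ _ _ True z(2)])
    show "continuous_on (closure D - {0}) (\<lambda>z. -1 * g z + 0 * g z)"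
      using g by (intro continuous_intros) (auto simp: green_function_def)
    show "has_laplacian (\<lambda>z. -1 * g z + 0 * g z) z (u z * (-1 * g z + 0 * g z))" if "z \<in> D" "z \<noteq> 0" for z
      using has_laplacian_lincomb[of g z "u z * g z" g "u z * g z" "-1" 0]
        green_function_has_laplacian[OF g D(1) that] by (simp add: algebra_simps)
    show "0 \<le> -1 * g x + 0 * g x" if "x \<in> frontier D" for x
      using g that by (simp add: green_function_def)
    have "((\<lambda>w::complex. cmod w) \<longlongrightarrow> 0) (at 0)"
      by (rule tendsto_norm_zero) (rule tendsto_ident_at)
    then have "\<forall>\<^sub>F w::complex in at 0. cmod w < 1"
      by (intro order_tendstoD) auto
    moreover have "\<forall>\<^sub>F w in at 0. w \<noteq> (0::complex)"
      by (rule eventually_neq_at_within)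
    ultimately show "\<forall>\<^sub>F z in at 0. - B \<le> -1 * g z + 0 * g z"
      using B
    proof eventually_elim
      case (elim z)
      then have "ln (cmod z) / (2 * pi) \<le> 0"
        by (simp add: divide_le_0_iff)
      then show ?case
        using elim by simp
    qed
  qed
  then show ?thesis
    by simp
qed

text \<open>The logarithmic poles cancel in the difference, which is therefore bounded near the
  origin. On the frontier of \<open>D\<close> it is nonnegative because the Green function of the
  larger disk is nonpositive there.\<close>

lemma green_function_ge_disk:
  assumes g: "green_function u D 0 g" and D: "open D" "0 \<in> D" "D \<subseteq> ball 0 \<rho>" and z: "z \<in> D" "z \<noteq> 0"
  shows "reg_green \<rho> 0 z \<le> g z"
proof -
  have "\<rho> > 0"
    using D(2,3) by auto
  then have cl: "closure D \<subseteq> cball 0 \<rho>"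
    using closure_mono[OF D(3)] by simp
  obtain B where B: "\<forall>\<^sub>F z in at 0. \<bar>g z - ln (cmod z) / (2 * pi)\<bar> \<le> B"
    using g by (auto simp: green_function_def)
  obtain C where C: "\<forall>\<^sub>F z in at 0. \<bar>reg_green \<rho> 0 z - ln (cmod z) / (2 * pi)\<bar> \<le> C"
    using green_log_bound by blast
  have "0 \<le> 1 * g z + (-1) * reg_green \<rho> 0 z"
  proof (rule comparison_principle[OF D(1) _ D(2) _ _ _ _ z])
    show "bounded D"
      using D(3) bounded_ball bounded_subset by blast
    show "continuous_on (closure D - {0}) (\<lambda>z. 1 * g z + (-1) * reg_green \<rho> 0 z)"
      using g by (intro continuous_intros continuous_on_green) (auto simp: green_function_def)
    show "has_laplacian (\<lambda>z. 1 * g z + (-1) * reg_green \<rho> 0 z) z (u z * (1 * g z + (-1) * reg_green \<rho> 0 z))"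
      if "z \<in> D" "z \<noteq> 0" for z
      using has_laplacian_lincomb[of g z "u z * g z" "reg_green \<rho> 0" "u z * reg_green \<rho> 0 z" 1 "-1"]
        green_function_has_laplacian[OF g D(1) that] reg_green_has_laplacian[of 0 z \<rho>] that
      by (simp add: algebra_simps)
    show "0 \<le> 1 * g x + (-1) * reg_green \<rho> 0 x" if "x \<in> frontier D" for x
    proof -
      have "x \<noteq> 0" "x \<in> closure D"
        using that D by (auto simp: frontier_def interior_open)
      then have "reg_green \<rho> 0 x \<le> 0"
        using cl by (intro reg_green_nonpos) auto
      then show ?thesis
        using g that by (simp add: green_function_def)
    qed
    show "\<forall>\<^sub>F z in at 0. - B - C \<le> 1 * g z + (-1) * reg_green \<rho> 0 z"
      using B C by eventually_elim simp
  qed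
  then show ?thesis
    by simp
qed

text \<open>The same comparison on the disk, with the roles exchanged: now \<open>g\<close> is
  nonpositive on the circle, where the disk's Green function vanishes.\<close>

lemma green_function_le_disk:
  assumes g: "green_function u D 0 g" and D: "open D" "bounded D" "ball 0 \<rho> \<subseteq> D"
    and z: "cmod z < \<rho>" "z \<noteq> 0"
  shows "g z \<le> reg_green \<rho> 0 z"
proof -
  have \<rho>: "\<rho> > 0"
    using z(1) norm_ge_zero[of z] by linarith
  have cl: "cball 0 \<rho> \<subseteq> closure D"
    using closure_mono[OF D(3)] \<rho> by simp
  have D0: "0 \<in> D"
    using D(3) \<rho> by auto
  obtain B where B: "\<forall>\<^sub>F z in at 0. \<bar>g z - ln (cmod z) / (2 * pi)\<bar> \<le> B"
    using g by (auto simp: green_function_def)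
  obtain C where C: "\<forall>\<^sub>F z in at 0. \<bar>reg_green \<rho> 0 z - ln (cmod z) / (2 * pi)\<bar> \<le> C"
    using green_log_bound by blast
  have "0 \<le> 1 * reg_green \<rho> 0 z + (-1) * g z"
  proof (rule comparison_principle[of "ball 0 \<rho>"])
    have "continuous_on (closure (ball 0 \<rho>) - {0}) g"
      using g cl \<rho> unfolding green_function_def by (elim conjE continuous_on_subset) auto
    then show "continuous_on (closure (ball 0 \<rho>) - {0}) (\<lambda>z. 1 * reg_green \<rho> 0 z + (-1) * g z)"
      by (intro continuous_intros continuous_on_green) auto
    show "has_laplacian (\<lambda>z. 1 * reg_green \<rho> 0 z + (-1) * g z) z (u z * (1 * reg_green \<rho> 0 z + (-1) * g z))"
      if "z \<in> ball 0 \<rho>" "z \<noteq> 0" for z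
      using has_laplacian_lincomb[of "reg_green \<rho> 0" z "u z * reg_green \<rho> 0 z" g "u z * g z" 1 "-1"]
        green_function_has_laplacian[OF g D(1), of z] reg_green_has_laplacian[of 0 z \<rho>] that D(3)
      by (auto simp: algebra_simps)
    show "0 \<le> 1 * reg_green \<rho> 0 x + (-1) * g x" if "x \<in> frontier (ball 0 \<rho>)" for x
    proof -
      have "cmod x = \<rho>"
        using that \<rho> by (simp add: frontier_ball)
      then have "g x \<le> 0"
        using cl \<rho> by (intro green_function_nonpos[OF g D(1,2) D0]) auto
      then show ?thesis
        using \<open>cmod x = \<rho>\<close> by simp
    qed
    show "\<forall>\<^sub>F z in at 0. - B - C \<le> 1 * reg_green \<rho> 0 z + (-1) * g z"
      using B C by eventually_elim simp
  qed (use z \<rho> in auto)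
  then show ?thesis
    by simp
qed

text \<open>The normal derivative of the disk's Green function on its circle. Multiplied by the
  circumference it is \<open>p 0 / p \<rho>\<close>, the claimed area rate; multiplied by
  \<open>2 * \<rho>\<close> it is the rate of the squared radius.\<close>

definition speed :: "real \<Rightarrow> real" where
  "speed \<rho> = c0 / (\<rho> * p (complex_of_real \<rho>))"

text \<open>The profile vanishes on the circle, so the part of the gradient containing
  \<open>Gp\<close> drops out and a radial vector remains.\<close>

lemma green_radial_derivative:
  assumes "cmod x = \<rho>" "\<rho> > 0"
  shows "((\<lambda>h. reg_green \<rho> 0 (x + h *\<^sub>R (x /\<^sub>R \<rho>))) has_real_derivative speed \<rho>) (at 0)"
proof -
  have "x \<noteq> 0"
    using assms by auto
  then have "GDERIV (reg_green \<rho> 0) (x + 0 *\<^sub>R (x /\<^sub>R \<rho>)) :> radial_grad (\<lambda>s. c0 / (s + 0)) (profile \<rho> 0) x"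
    using reg_green_C2[of \<rho> 0] unfolding C2_on_def by simp
  moreover have "radial_grad (\<lambda>s. c0 / (s + 0)) (profile \<rho> 0) x \<bullet> (x /\<^sub>R \<rho>) = speed \<rho>"
  proof -
    have "p x = p (complex_of_real \<rho>)"
      by (rule p_radial) (use assms in simp)
    moreover have "x \<bullet> x = \<rho>\<^sup>2"
      using assms power2_norm_eq_inner by metis
    moreover have "profile \<rho> 0 ((cmod x)\<^sup>2) = 0"
      using assms by simp
    ultimately have "radial_grad (\<lambda>s. c0 / (s + 0)) (profile \<rho> 0) x \<bullet> (x /\<^sub>R \<rho>)
        = c0 / \<rho>\<^sup>2 / p (complex_of_real \<rho>) * \<rho>\<^sup>2 / \<rho>"
      using assms(1) by (simp add: radial_grad_def divide_inverse)
    then show ?thesis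
      using assms(2) by (simp add: speed_def)
  qed
  ultimately show ?thesis
    using GDERIV_slice by metis
qed

text \<open>Both functions vanish at \<open>x\<close>, and dividing their inequality by
  \<open>h < 0\<close> reverses it. The inequality is known only inside \<open>D\<close>, which is
  why the inward ray must run in \<open>D\<close>.\<close>

lemma outward_derivative_le:
  assumes g: "green_function u D 0 g" and D: "open D" "0 \<in> D" "D \<subseteq> ball 0 \<rho>"
    and x: "x \<in> frontier D" "cmod x = \<rho>" "\<rho> > 0"
    and in_D: "\<forall>\<^sub>F h in at_left 0. x + h *\<^sub>R (x /\<^sub>R \<rho>) \<in> D"
    and v: "has_outward_normal_derivative g x (x /\<^sub>R \<rho>) v"
  shows "v \<le> speed \<rho>"
proof (rule tendsto_le[of "at_left 0"])
  let ?y = "\<lambda>h. x + h *\<^sub>R (x /\<^sub>R \<rho>)"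
  have gx: "g x = 0"
    using g x by (simp add: green_function_def)
  show "((\<lambda>h. g (?y h) / h) \<longlongrightarrow> v) (at_left 0)"
    using v gx by (simp add: has_outward_normal_derivative_def has_field_derivative_iff)
  show "((\<lambda>h. reg_green \<rho> 0 (?y h) / h) \<longlongrightarrow> speed \<rho>) (at_left 0)"
    using has_field_derivative_at_within[OF green_radial_derivative[OF x(2,3)], of "{..<0}"] x
    by (simp add: has_field_derivative_iff)
  have "\<forall>\<^sub>F h::real in at_left 0. h \<in> {-\<rho><..<0}"
    using x by (intro eventually_at_leftI[of "-\<rho>"]) auto
  then show "\<forall>\<^sub>F h in at_left 0. g (?y h) / h \<le> reg_green \<rho> 0 (?y h) / h"
    using in_D
  proof eventually_elim
    case (elim h)
    have "?y h = (1 + h / \<rho>) *\<^sub>R x"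
      by (simp add: scaleR_add_left divide_inverse)
    moreover have "1 + h / \<rho> \<noteq> 0" "x \<noteq> 0"
      using elim x by (auto simp: field_simps)
    ultimately have "?y h \<noteq> 0"
      by simp
    from green_function_ge_disk[OF g D elim(2) this] show ?case
      using elim by (intro divide_right_mono_neg) auto
  qed
qed simp

lemma outward_derivative_ge:
  assumes g: "green_function u D 0 g" and D: "open D" "bounded D" "ball 0 \<rho> \<subseteq> D"
    and x: "x \<in> frontier D" "cmod x = \<rho>" "\<rho> > 0"
    and v: "has_outward_normal_derivative g x (x /\<^sub>R \<rho>) v"
  shows "speed \<rho> \<le> v"
proof (rule tendsto_le[of "at_left 0"])
  let ?y = "\<lambda>h. x + h *\<^sub>R (x /\<^sub>R \<rho>)"
  have gx: "g x = 0"
    using g x by (simp add: green_function_def)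
  show "((\<lambda>h. g (?y h) / h) \<longlongrightarrow> v) (at_left 0)"
    using v gx by (simp add: has_outward_normal_derivative_def has_field_derivative_iff)
  show "((\<lambda>h. reg_green \<rho> 0 (?y h) / h) \<longlongrightarrow> speed \<rho>) (at_left 0)"
    using has_field_derivative_at_within[OF green_radial_derivative[OF x(2,3)], of "{..<0}"] x
    by (simp add: has_field_derivative_iff)
  have "\<forall>\<^sub>F h::real in at_left 0. h \<in> {-\<rho><..<0}"
    using x by (intro eventually_at_leftI[of "-\<rho>"]) auto
  then show "\<forall>\<^sub>F h in at_left 0. reg_green \<rho> 0 (?y h) / h \<le> g (?y h) / h"
  proof eventually_elim
    case (elim h)
    have y: "?y h = (1 + h / \<rho>) *\<^sub>R x"
      by (simp add: scaleR_add_left divide_inverse)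
    have h: "0 < 1 + h / \<rho>" "1 + h / \<rho> < 1" "x \<noteq> 0"
      using elim x by (auto simp: field_simps)
    then have "?y h \<noteq> 0" "cmod (?y h) < \<rho>"
      unfolding y using x by (auto simp: mult_less_cancel_right1)
    from green_function_le_disk[OF g D this(2,1)] show ?case
      using elim by (intro divide_right_mono_neg) auto
  qed
qed simp

end

section \<open>Growing disks\<close>

lemma antiderivative_UNIV:
  fixes f :: "real \<Rightarrow> real"
  assumes "\<And>x. isCont f x"
  shows "\<exists>F. \<forall>x. (F has_real_derivative f x) (at x)"
  using einterval_antiderivative[of "-\<infinity>" \<infinity> f] assms
  by (auto simp: has_real_derivative_iff_has_vector_derivative)

context radial_potential
begin

lemma p_ge_p_0: "p 0 \<le> p z"
proof -
  have "p (complex_of_real 0) \<le> p (complex_of_real (cmod z))"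
    by (rule p_mono) auto
  also have "p (complex_of_real (cmod z)) = p z"
    by (rule p_radial) simp
  finally show ?thesis
    by simp
qed

text \<open>Separation of variables: time as a function \<open>F\<close> of the squared radius has
  derivative \<open>p / (2 * c0)\<close>, which is at least \<open>pi\<close> because
  \<open>p\<close> is smallest at the origin. So \<open>F\<close> is an increasing bijection of the
  line and its inverse solves the equation for all times. As \<open>sqrt\<close> is total, negative
  values of \<open>S\<close> need no special case.\<close>

lemma squared_radius_flow:
  "\<exists>S. (\<forall>\<tau>. (S has_real_derivative 2 * c0 / p (complex_of_real (sqrt (S \<tau>)))) (at \<tau>)) \<and>
    strict_mono S \<and> surj S"
proof -
  define f where "f = (\<lambda>s. p (complex_of_real (sqrt s)) / (2 * c0))"
  have "continuous_on UNIV f"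
    unfolding f_def using c0_pos
    by (intro continuous_intros continuous_on_compose2[OF continuous_on_p[of UNIV]]) auto
  then obtain F where F: "\<And>x. (F has_real_derivative f x) (at x)"
    using antiderivative_UNIV[of f] by (auto simp: continuous_on_eq_continuous_at)
  have f_ge: "f x \<ge> pi" for x
  proof -
    have "p 0 / (2 * c0) = pi"
      using p_pos[of 0] by (simp add: c0_def)
    then show ?thesis
      unfolding f_def using divide_right_mono[OF p_ge_p_0, of "2 * c0" "complex_of_real (sqrt x)"] c0_pos
      by simp
  qed
  have F_diff: "pi * (y - x) \<le> F y - F x" if xy: "x < y" for x y
  proof -
    obtain z where "F y - F x = (y - x) * f z"
      using MVT2[OF xy, of F f] F by blast
    then show ?thesis
      using mult_right_mono[OF f_ge[of z], of "y - x"] xy by (simp add: mult.commute)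
  qed
  have F_less: "F x < F y" if "x < y" for x y
  proof -
    have "0 < pi * (y - x)"
      using that by simp
    then show ?thesis
      using F_diff[OF that] by linarith
  qed
  have inj: "inj F"
    using F_less by (metis injI less_irrefl linorder_neqE_linordered_idom)
  have contF: "continuous_on UNIV F"
    using F DERIV_isCont continuous_at_imp_continuous_on by blast
  have surj: "\<exists>x. F x = y" for y
  proof -
    \<comment> \<open>With slope at least \<open>pi\<close>, moving by
      \<open>\<bar>y - F 0\<bar> / pi\<close> already carries \<open>F\<close> to the level
      \<open>y\<close>; the extra 1 gives strict signs.\<close>
    define a where "a = - \<bar>y - F 0\<bar> / pi - 1"
    define b where "b = \<bar>y - F 0\<bar> / pi + 1"
    have b: "b > 0" "a < 0"
      unfolding a_def b_def by (auto intro: add_nonneg_pos simp: divide_nonneg_pos minus_divide_left[symmetric])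
        (smt (verit) divide_nonneg_pos pi_gt_zero)
    have "pi * b = \<bar>y - F 0\<bar> + pi" "pi * a = - \<bar>y - F 0\<bar> - pi"
      by (simp_all add: a_def b_def distrib_left right_diff_distrib)
    then have "F a \<le> y" "y \<le> F b"
      using F_diff[OF b(1)] F_diff[OF b(2)] pi_gt_zero by (simp_all, linarith+)
    then show ?thesis
      using IVT'[of F a y b] b contF continuous_on_subset by (metis less_eq_real_def order.strict_trans subset_UNIV)
  qed
  define S where "S = inv F"
  have FS: "F (S \<tau>) = \<tau>" for \<tau>
    unfolding S_def using surj by (metis f_inv_into_f rangeI)
  have SF: "S (F x) = x" for x
    unfolding S_def using inj by (rule inv_f_f)
  have S_mono: "S a < S b" if "a < b" for a b
    using F_less[of "S b" "S a"] FS[of a] FS[of b] that by (metis linorder_neqE_linordered_idom order_less_asym)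
  have S_cont: "isCont S \<tau>" for \<tau>
    using isCont_inverse_function[of 1 "S \<tau>" S F] SF F DERIV_isCont FS by fastforce
  have "(S has_real_derivative 2 * c0 / p (complex_of_real (sqrt (S \<tau>)))) (at \<tau>)" for \<tau>
  proof -
    have "(S has_real_derivative inverse (f (S \<tau>))) (at \<tau>)"
    proof (rule DERIV_inverse_function[OF F, where a="\<tau> - 1" and b="\<tau> + 1"])
      show "f (S \<tau>) \<noteq> 0"
        using f_ge[of "S \<tau>"] pi_gt_zero by linarith
    qed (use FS S_cont in auto)
    then show ?thesis
      by (simp add: f_def)
  qed
  moreover have "strict_mono S"
    using S_mono by (simp add: strict_mono_def)
  moreover have "surj S"
    using SF by (metis surjI)
  ultimately show ?thesis
    by blast
qed

lemma GDERIV_disk_level: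
  assumes "(S has_real_derivative d) (at (\<tau> + fst z))"
  shows "GDERIV (\<lambda>z::real \<times> complex. (cmod (snd z))\<^sup>2 - S (\<tau> + fst z)) z :> (- d, 2 *\<^sub>R snd z)"
proof -
  have "((\<lambda>y. (cmod y)\<^sup>2) has_derivative (\<lambda>h. h \<bullet> (2 *\<^sub>R snd z))) (at (snd z))"
    using GDERIV_norm_squared[of "snd z"] by (simp add: gderiv_def)
  from has_derivative_compose[OF has_derivative_snd[OF has_derivative_ident] this]
  have 1: "((\<lambda>z::real \<times> complex. (cmod (snd z))\<^sup>2) has_derivative (\<lambda>h. snd h \<bullet> (2 *\<^sub>R snd z))) (at z)" .
  have "((\<lambda>z::real \<times> complex. \<tau> + fst z) has_derivative (\<lambda>h. fst h)) (at z)"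
    by (auto intro!: derivative_eq_intros)
  from has_derivative_compose[OF this assms[unfolded has_field_derivative_def]]
  have 2: "((\<lambda>z::real \<times> complex. S (\<tau> + fst z)) has_derivative (\<lambda>h. d * fst h)) (at z)" .
  show ?thesis
    unfolding gderiv_def using has_derivative_diff[OF 1 2]
    by (rule has_derivative_eq_rhs) (simp add: fun_eq_iff inner_prod_def)
qed

text \<open>The level function \<open>|y|\<^sup>2 - S\<close> has normal velocity
  \<open>S' / (2 \<rho>)\<close>, and the equation for \<open>S\<close> was chosen so that this
  equals \<open>speed \<rho>\<close>, the normal derivative of the Green function.\<close>

lemma disks_elliptic_growth:
  assumes S: "\<And>\<tau>. (S has_real_derivative 2 * c0 / p (complex_of_real (sqrt (S \<tau>)))) (at \<tau>)"
    and mono: "strict_mono S" and pos: "S \<tau> > 0"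
  shows "elliptic_growth u 0 {0..<T} (\<lambda>t. ball 0 (sqrt (S (\<tau> + t))))"
proof -
  have St: "S (\<tau> + t) > 0" if "t \<ge> 0" for t
    using less_le_trans[OF pos] strict_mono_mono[OF mono] that by (simp add: monoD)
  have contS: "continuous_on UNIV S"
    using S DERIV_isCont continuous_at_imp_continuous_on by blast
  have normal: "moves_with_normal_velocity {0..<T} (\<lambda>t. ball 0 (sqrt (S (\<tau> + t)))) t x
      (x /\<^sub>R sqrt (S (\<tau> + t))) (speed (sqrt (S (\<tau> + t))))"
    if t: "t \<in> {0..<T}" and x: "cmod x = sqrt (S (\<tau> + t))" for t x
  proof -
    define d where "d = (\<lambda>\<tau>. 2 * c0 / p (complex_of_real (sqrt (S \<tau>))))"
    define \<Phi> where "\<Phi> = (\<lambda>z::real \<times> complex. (cmod (snd z))\<^sup>2 - S (\<tau> + fst z))"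
    have D: "GDERIV \<Phi> z :> (- d (\<tau> + fst z), 2 *\<^sub>R snd z)" for z
      unfolding \<Phi>_def d_def by (rule GDERIV_disk_level[OF S])
    have "continuous_on UNIV d"
      unfolding d_def
      by (intro continuous_intros continuous_on_compose2[OF continuous_on_p[of UNIV]]
          continuous_on_compose2[OF contS]) auto
    then have "continuous_on UNIV (\<lambda>z::real \<times> complex. d (\<tau> + fst z))"
      by (rule continuous_on_compose2) (auto intro!: continuous_intros)
    then have cont: "continuous_on UNIV (\<lambda>z::real \<times> complex. (- d (\<tau> + fst z), 2 *\<^sub>R snd z) \<bullet> b)" for b
      by (intro continuous_on_inner continuous_on_Pair continuous_on_minus continuous_on_scaleR
          continuous_on_snd continuous_on_id continuous_on_const)
    have C1: "Ck_on 1 \<Phi> UNIV"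
      unfolding One_nat_def Ck_on.simps
    proof (rule exI[of _ "\<lambda>z. (- d (\<tau> + fst z), 2 *\<^sub>R snd z)"], rule conjI)
      show "\<forall>z\<in>UNIV. GDERIV \<Phi> z :> (- d (\<tau> + fst z), 2 *\<^sub>R snd z)"
        using D by simp
      show "\<forall>b\<in>Basis. continuous_on UNIV (\<lambda>z::real \<times> complex. (- d (\<tau> + fst z), 2 *\<^sub>R snd z) \<bullet> b)"
        by (intro ballI cont)
    qed
    let ?\<rho> = "sqrt (S (\<tau> + t))"
    have \<rho>: "?\<rho> > 0"
      using St[of t] t by simp
    then have "x \<noteq> 0"
      using x by auto
    have lev: "y \<in> ball 0 (sqrt (S (\<tau> + s))) \<longleftrightarrow> \<Phi> (s, y) < 0" if "s \<in> {0..<T}" for s y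
    proof -
      have "cmod y < sqrt (S (\<tau> + s)) \<longleftrightarrow> (cmod y)\<^sup>2 < S (\<tau> + s)"
        using real_sqrt_less_iff[of "(cmod y)\<^sup>2" "S (\<tau> + s)"] by simp
      then show ?thesis
        by (simp add: \<Phi>_def)
    qed
    have n: "x /\<^sub>R ?\<rho> = (2 *\<^sub>R x) /\<^sub>R norm (2 *\<^sub>R x)"
      using x by simp
    have v: "speed ?\<rho> = - (- d (\<tau> + t)) / norm (2 *\<^sub>R x)"
      using x by (simp add: speed_def d_def)
    show ?thesis
      unfolding moves_with_normal_velocity_def
    proof (intro exI conjI allI impI)
      show "open (UNIV :: (real \<times> complex) set)" "(t, x) \<in> UNIV" "Ck_on 1 \<Phi> UNIV"
        using C1 by auto
      show "y \<in> ball 0 (sqrt (S (\<tau> + s))) \<longleftrightarrow> \<Phi> (s, y) < 0" if "(s, y) \<in> UNIV \<and> s \<in> {0..<T}" for s y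
        using lev that by blast
      show "GDERIV \<Phi> (t, x) :> (- d (\<tau> + t), 2 *\<^sub>R x)"
        using D[of "(t, x)"] by simp
      show "2 *\<^sub>R x \<noteq> 0"
        using \<open>x \<noteq> 0\<close> by simp
    qed (rule n v)+
  qed
  show ?thesis
    unfolding elliptic_growth_def
  proof (intro conjI ballI impI)
    fix s t assume "s \<in> {0..<T}" "t \<in> {0..<T}" "s \<le> t"
    then have "sqrt (S (\<tau> + s)) \<le> sqrt (S (\<tau> + t))"
      using strict_mono_mono[OF mono] by (simp add: monoD)
    then show "ball (0::complex) (sqrt (S (\<tau> + s))) \<subseteq> ball 0 (sqrt (S (\<tau> + t)))"
      by (rule subset_ball)
  next
    fix t assume t: "t \<in> {0..<T}"
    let ?\<rho> = "sqrt (S (\<tau> + t))"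
    have \<rho>: "?\<rho> > 0"
      using St[of t] t by simp
    show "\<exists>g. green_function u (ball 0 ?\<rho>) 0 g \<and> (\<forall>x\<in>frontier (ball 0 ?\<rho>). \<exists>n v.
        moves_with_normal_velocity {0..<T} (\<lambda>t. ball 0 (sqrt (S (\<tau> + t)))) t x n v \<and>
        has_outward_normal_derivative g x n v)"
    proof (intro exI[of _ "reg_green ?\<rho> 0"] conjI ballI green_function_ball \<rho>)
      fix x assume "x \<in> frontier (ball (0::complex) ?\<rho>)"
      then have x: "cmod x = ?\<rho>"
        using \<rho> by (simp add: frontier_ball)
      have "has_outward_normal_derivative (reg_green ?\<rho> 0) x (x /\<^sub>R ?\<rho>) (speed ?\<rho>)"
        unfolding has_outward_normal_derivative_def
        by (rule has_field_derivative_at_within[OF green_radial_derivative[OF x \<rho>]])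
      with normal[OF t x] show "\<exists>n v.
        moves_with_normal_velocity {0..<T} (\<lambda>t. ball 0 (sqrt (S (\<tau> + t)))) t x n v \<and>
        has_outward_normal_derivative (reg_green ?\<rho> 0) x n v"
        by blast
    qed
  qed (use St in auto)
qed

end

section \<open>Touching boundaries\<close>

lemma eventually_neg_along_ray:
  assumes "GDERIV f z :> g" "f z = 0" "g \<bullet> w < 0"
  shows "\<forall>\<^sub>F s in at_right 0. f (z + s *\<^sub>R w) < 0"
proof -
  have "((\<lambda>s. f (z + s *\<^sub>R w)) has_real_derivative g \<bullet> w) (at 0)"
    using GDERIV_slice[of f z 0 w g] assms(1) by simp
  from DERIV_neg_dec_right[OF this assms(3)] show ?thesis
    using assms(2) unfolding eventually_at_right_field by auto
qed

lemma eventually_pos_along_ray: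
  assumes "GDERIV f z :> g" "f z = 0" "g \<bullet> w > 0"
  shows "\<forall>\<^sub>F s in at_right 0. f (z + s *\<^sub>R w) > 0"
  using eventually_neg_along_ray[OF GDERIV_minus[OF assms(1)], of w] assms by simp

lemma eventually_along_ray_in_open:
  fixes z w :: "'a::real_normed_vector"
  assumes "open U" "z \<in> U"
  shows "\<forall>\<^sub>F s in at_right 0. z + s *\<^sub>R w \<in> U"
proof (rule topological_tendstoD[OF _ assms(1)])
  show "((\<lambda>s. z + s *\<^sub>R w) \<longlongrightarrow> z) (at_right 0)"
    by (auto intro!: tendsto_eq_intros)
qed fact

text \<open>A negative level would put \<open>x\<close> into the open set \<open>D\<close>, and a
  positive one would, by continuity, keep a neighbourhood of \<open>x\<close> outside
  \<open>D\<close>.\<close>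

lemma level_zero_on_frontier:
  assumes "open U" "(t, x) \<in> U" "isCont \<Phi> (t, x)"
    and lev: "\<And>y. (t, y) \<in> U \<Longrightarrow> y \<in> D \<longleftrightarrow> \<Phi> (t, y) < (0::real)"
    and "open D" "x \<in> frontier D"
  shows "\<Phi> (t, x) = 0"
proof (rule ccontr)
  assume "\<Phi> (t, x) \<noteq> 0"
  moreover have "x \<notin> D"
    using assms by (simp add: frontier_def interior_open)
  ultimately have pos: "\<Phi> (t, x) > 0"
    using lev[OF assms(2)] by simp
  have "((\<lambda>y. (t, y)) \<longlongrightarrow> (t, x)) (at x)"
    by (intro tendsto_intros)
  then have "\<forall>\<^sub>F y in at x. (t, y) \<in> U" "\<forall>\<^sub>F y in at x. \<Phi> (t, y) > 0"
    using assms(1,2) pos isCont_tendsto_compose[OF assms(3), of "\<lambda>y. (t, y)" "at x"]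
    by (auto intro: topological_tendstoD order_tendstoD)
  then have "\<forall>\<^sub>F y in at x. y \<notin> D"
    by eventually_elim (use lev in auto)
  then have "\<not> x islimpt D"
    by (simp add: islimpt_iff_eventually)
  then have "x \<notin> closure D"
    using \<open>x \<notin> D\<close> by (simp add: closure_def)
  then show False
    using assms(6) by (simp add: frontier_def)
qed

lemma unit_inner_less_1:
  fixes a b :: "'a::real_inner"
  assumes "norm a = 1" "norm b = 1" "a \<noteq> b"
  shows "a \<bullet> b < 1"
proof -
  have "0 < (a - b) \<bullet> (a - b)"
    using assms(3) by simp
  also have "\<dots> = 2 - 2 * (a \<bullet> b)"
    using assms by (simp add: inner_diff_left inner_diff_right inner_commute norm_eq_1)
  finally show ?thesis
    by simp
qed

lemma eventually_norm_gt_along_ray: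
  fixes x :: complex
  assumes "x \<bullet> d > 0"
  shows "\<forall>\<^sub>F s in at_right 0. norm (x + s *\<^sub>R d) > norm x"
proof -
  have "GDERIV (\<lambda>y. (norm y)\<^sup>2 - (norm x)\<^sup>2) x :> 2 *\<^sub>R x - 0"
    by (intro GDERIV_diff GDERIV_norm_squared GDERIV_const)
  then have "\<forall>\<^sub>F s in at_right 0. 0 < (norm (x + s *\<^sub>R d))\<^sup>2 - (norm x)\<^sup>2"
    by (rule eventually_pos_along_ray) (use assms in auto)
  then show ?thesis
    by eventually_elim (auto intro: power2_less_imp_less)
qed

lemma eventually_norm_less_along_ray:
  fixes x :: complex
  assumes "x \<bullet> d < 0"
  shows "\<forall>\<^sub>F s in at_right 0. norm (x + s *\<^sub>R d) < norm x"
proof -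
  have "GDERIV (\<lambda>y. (norm y)\<^sup>2 - (norm x)\<^sup>2) x :> 2 *\<^sub>R x - 0"
    by (intro GDERIV_diff GDERIV_norm_squared GDERIV_const)
  then have "\<forall>\<^sub>F s in at_right 0. (norm (x + s *\<^sub>R d))\<^sup>2 - (norm x)\<^sup>2 < 0"
    by (rule eventually_neg_along_ray) (use assms in auto)
  then show ?thesis
    by eventually_elim (auto intro: power2_less_imp_less)
qed

lemma trivial_at_right_contradiction:
  assumes "\<forall>\<^sub>F s in at_right (0::real). P s" "\<forall>\<^sub>F s in at_right 0. \<not> P s"
  shows False
proof -
  have "\<forall>\<^sub>F s in at_right (0::real). False"
    using assms by eventually_elim simp
  then show False
    by simp
qed

text \<open>Exposes the witnesses hidden in \<open>moves_with_normal_velocity\<close>, so that one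
  local level function can be probed along several rays.\<close>

definition level_fun_at ::
    "real set \<Rightarrow> (real \<Rightarrow> complex set) \<Rightarrow> real \<Rightarrow> complex \<Rightarrow> (real \<times> complex) set \<Rightarrow>
     (real \<times> complex \<Rightarrow> real) \<Rightarrow> real \<Rightarrow> complex \<Rightarrow> bool" where
  "level_fun_at I D t x U \<Phi> p q \<longleftrightarrow> open U \<and> (t, x) \<in> U \<and> Ck_on 1 \<Phi> U \<and>
     (\<forall>s y. (s, y) \<in> U \<and> s \<in> I \<longrightarrow> (y \<in> D s \<longleftrightarrow> \<Phi> (s, y) < 0)) \<and>
     GDERIV \<Phi> (t, x) :> (p, q) \<and> q \<noteq> 0"

lemma moves_with_normal_velocity_iff:
  "moves_with_normal_velocity I D t x n v \<longleftrightarrow>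
     (\<exists>U \<Phi> p q. level_fun_at I D t x U \<Phi> p q \<and> n = q /\<^sub>R norm q \<and> v = - p / norm q)"
  unfolding moves_with_normal_velocity_def level_fun_at_def by (simp only: conj_assoc)

lemma level_fun_at_zero:
  assumes L: "level_fun_at I D t x U \<Phi> p q" and "t \<in> I" "open (D t)" "x \<in> frontier (D t)"
  shows "\<Phi> (t, x) = 0"
  using assms GDERIV_isCont[of \<Phi> "(t, x)" "(p, q)"]
  by (intro level_zero_on_frontier[of U t x \<Phi> "D t"]) (auto simp: level_fun_at_def)

text \<open>\<open>a * p + q \<bullet> d\<close> is the derivative of the level function along the
  space-time ray with direction \<open>(a, d)\<close>. With \<open>a = 0\<close> the ray probes the
  domain at a fixed time, with \<open>a = -1\<close> it runs into the past.\<close>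

lemma level_fun_eventually_in:
  assumes L: "level_fun_at I D t x U \<Phi> p q" and t: "t \<in> I" "open (D t)" "x \<in> frontier (D t)"
    and w: "a * p + q \<bullet> d < 0" and I: "\<forall>\<^sub>F s in at_right 0. t + s * a \<in> I"
  shows "\<forall>\<^sub>F s in at_right 0. x + s *\<^sub>R d \<in> D (t + s * a)"
proof -
  have "\<forall>\<^sub>F s in at_right 0. \<Phi> ((t, x) + s *\<^sub>R (a, d)) < 0"
    by (rule eventually_neg_along_ray[of _ _ "(p, q)"])
      (use L level_fun_at_zero[OF L t] w in \<open>auto simp: level_fun_at_def inner_prod_def mult.commute\<close>)
  moreover have "\<forall>\<^sub>F s in at_right 0. (t, x) + s *\<^sub>R (a, d) \<in> U"
    using L by (intro eventually_along_ray_in_open) (auto simp: level_fun_at_def)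
  ultimately show ?thesis
    using I by eventually_elim (use L in \<open>auto simp: level_fun_at_def\<close>)
qed

lemma level_fun_eventually_notin:
  assumes L: "level_fun_at I D t x U \<Phi> p q" and t: "t \<in> I" "open (D t)" "x \<in> frontier (D t)"
    and w: "a * p + q \<bullet> d > 0" and I: "\<forall>\<^sub>F s in at_right 0. t + s * a \<in> I"
  shows "\<forall>\<^sub>F s in at_right 0. x + s *\<^sub>R d \<notin> D (t + s * a)"
proof -
  have "\<forall>\<^sub>F s in at_right 0. \<Phi> ((t, x) + s *\<^sub>R (a, d)) > 0"
    by (rule eventually_pos_along_ray[of _ _ "(p, q)"])
      (use L level_fun_at_zero[OF L t] w in \<open>auto simp: level_fun_at_def inner_prod_def mult.commute\<close>)
  moreover have "\<forall>\<^sub>F s in at_right 0. (t, x) + s *\<^sub>R (a, d) \<in> U"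
    using L by (intro eventually_along_ray_in_open) (auto simp: level_fun_at_def)
  ultimately show ?thesis
    using I by eventually_elim (use L in \<open>auto simp: level_fun_at_def\<close>)
qed

text \<open>If the unit normals \<open>n\<close> of the domain and \<open>e\<close> of the circle
  differed, the direction \<open>e - n\<close> would lead into the domain and at the same time out
  of the disk that contains it.\<close>

lemma outer_touching_normal:
  assumes L: "level_fun_at I D t x U \<Phi> p q" and t: "t \<in> I" "open (D t)" "x \<in> frontier (D t)"
    and \<rho>: "D t \<subseteq> ball 0 \<rho>" "cmod x = \<rho>" "\<rho> > 0"
  shows "q /\<^sub>R norm q = x /\<^sub>R \<rho>"
proof (rule ccontr)
  assume neq: "\<not> ?thesis"
  define n where "n = q /\<^sub>R norm q"
  define e where "e = x /\<^sub>R \<rho>"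
  have q: "norm q > 0"
    using L by (simp add: level_fun_at_def)
  have units: "norm n = 1" "norm e = 1"
    using q \<rho> by (auto simp: n_def e_def)
  have lt: "n \<bullet> e < 1"
    using unit_inner_less_1[OF units] neq by (simp add: n_def e_def)
  have qn: "q = norm q *\<^sub>R n" and xe: "x = \<rho> *\<^sub>R e"
    using q \<rho> by (auto simp: n_def e_def)
  have nn: "n \<bullet> n = 1" "e \<bullet> e = 1"
    using units by (simp_all add: norm_eq_1)
  have "q \<bullet> (e - n) = norm q * (n \<bullet> e - 1)"
    by (subst qn) (simp only: inner_scaleR_left inner_diff_right nn right_diff_distrib)
  then have "q \<bullet> (e - n) < 0"
    using q lt by (simp add: mult_pos_neg)
  then have "\<forall>\<^sub>F s in at_right 0. x + s *\<^sub>R (e - n) \<in> D (t + s * 0)"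
    by (intro level_fun_eventually_in[OF L t]) (use t in auto)
  then have "\<forall>\<^sub>F s in at_right 0. norm (x + s *\<^sub>R (e - n)) < norm x"
    by eventually_elim (use \<rho> in auto)
  moreover have "x \<bullet> (e - n) = \<rho> * (1 - n \<bullet> e)"
    by (subst xe) (simp only: inner_scaleR_left inner_diff_right nn inner_commute[of e n] right_diff_distrib)
  then have "x \<bullet> (e - n) > 0"
    using \<rho> lt by simp
  then have "\<forall>\<^sub>F s in at_right 0. norm (x + s *\<^sub>R (e - n)) > norm x"
    by (rule eventually_norm_gt_along_ray)
  then have "\<forall>\<^sub>F s in at_right 0. \<not> norm (x + s *\<^sub>R (e - n)) < norm x"
    by eventually_elim simp
  ultimately show False
    by (rule trivial_at_right_contradiction)
qed

text \<open>The mirror image: for different normals the direction \<open>n - e\<close> leads out of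
  the domain but into the disk contained in it.\<close>

lemma inner_touching_normal:
  assumes L: "level_fun_at I D t x U \<Phi> p q" and t: "t \<in> I" "open (D t)" "x \<in> frontier (D t)"
    and \<rho>: "ball 0 \<rho> \<subseteq> D t" "cmod x = \<rho>" "\<rho> > 0"
  shows "q /\<^sub>R norm q = x /\<^sub>R \<rho>"
proof (rule ccontr)
  assume neq: "\<not> ?thesis"
  define n where "n = q /\<^sub>R norm q"
  define e where "e = x /\<^sub>R \<rho>"
  have q: "norm q > 0"
    using L by (simp add: level_fun_at_def)
  have units: "norm n = 1" "norm e = 1"
    using q \<rho> by (auto simp: n_def e_def)
  have lt: "n \<bullet> e < 1"
    using unit_inner_less_1[OF units] neq by (simp add: n_def e_def)
  have qn: "q = norm q *\<^sub>R n" and xe: "x = \<rho> *\<^sub>R e"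
    using q \<rho> by (auto simp: n_def e_def)
  have nn: "n \<bullet> n = 1" "e \<bullet> e = 1"
    using units by (simp_all add: norm_eq_1)
  have "q \<bullet> (n - e) = norm q * (1 - n \<bullet> e)"
    by (subst qn) (simp only: inner_scaleR_left inner_diff_right nn right_diff_distrib)
  then have "q \<bullet> (n - e) > 0"
    using q lt by simp
  then have "\<forall>\<^sub>F s in at_right 0. x + s *\<^sub>R (n - e) \<notin> D (t + s * 0)"
    by (intro level_fun_eventually_notin[OF L t]) (use t in auto)
  then have "\<forall>\<^sub>F s in at_right 0. \<not> norm (x + s *\<^sub>R (n - e)) < norm x"
    by eventually_elim (use \<rho> in auto)
  moreover have "x \<bullet> (n - e) = \<rho> * (n \<bullet> e - 1)"
    by (subst xe) (simp only: inner_scaleR_left inner_diff_right nn inner_commute[of e n] right_diff_distrib)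
  then have "x \<bullet> (n - e) < 0"
    using \<rho> lt by (simp add: mult_pos_neg)
  then have "\<forall>\<^sub>F s in at_right 0. norm (x + s *\<^sub>R (n - e)) < norm x"
    by (rule eventually_norm_less_along_ray)
  ultimately show False
    using trivial_at_right_contradiction by blast
qed

section \<open>Velocity contradictions at a point of contact\<close>

context radial_potential
begin

lemma speed_pos: "\<rho> > 0 \<Longrightarrow> speed \<rho> > 0"
  using c0_pos p_pos by (simp add: speed_def)

text \<open>Choose \<open>a\<close> strictly between the velocity
  \<open>v \<le> speed \<rho>\<close> of the boundary and the velocity
  \<open>k * speed \<rho>\<close> of the disk, and retreat from \<open>x\<close> along the inner
  normal at speed \<open>a\<close> while time runs backwards. The boundary retreats more slowly, so
  the moving point is inside the earlier domain; the disk shrinks faster, so the point is outside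
  the earlier disk.\<close>

lemma no_outer_touching:
  assumes g: "green_function u (D t) 0 g" and D: "open (D t)" "0 \<in> D t" "D t \<subseteq> ball 0 \<rho>"
    and x: "x \<in> frontier (D t)" "cmod x = \<rho>" "\<rho> > 0"
    and mv: "moves_with_normal_velocity I D t x n v" "has_outward_normal_derivative g x n v"
    and I: "t > 0" "{0..t} \<subseteq> I" and sub: "\<And>s. 0 \<le> s \<Longrightarrow> s < t \<Longrightarrow> D s \<subseteq> ball 0 (sqrt (\<sigma> s))"
    and \<sigma>: "(\<sigma> has_real_derivative k * (2 * \<rho> * speed \<rho>)) (at t)" "\<sigma> t = \<rho>\<^sup>2" and k: "k > 1"
  shows False
proof -
  have tI: "t \<in> I"
    using I by auto
  obtain U \<Phi> p q where L: "level_fun_at I D t x U \<Phi> p q" and n: "n = q /\<^sub>R norm q" and v: "v = - p / norm q"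
    using mv(1) unfolding moves_with_normal_velocity_iff by blast
  let ?e = "x /\<^sub>R \<rho>"
  have q: "norm q > 0"
    using L by (simp add: level_fun_at_def)
  have ne: "q /\<^sub>R norm q = ?e"
    by (rule outer_touching_normal[OF L tI D(1) x(1) D(3) x(2,3)])
  have e1: "norm ?e = 1"
    using x by auto
  have "q \<bullet> ?e = norm q * ((q /\<^sub>R norm q) \<bullet> ?e)"
    using q by simp
  then have qe: "q \<bullet> ?e = norm q"
    unfolding ne using e1 by (simp only: norm_eq_1)
  \<comment> \<open>Time is frozen here: this is the condition that the inward ray stays in
    \<open>D t\<close>, required by the comparison of normal derivatives.\<close>
  have "\<forall>\<^sub>F s in at_right 0. x + s *\<^sub>R (- ?e) \<in> D (t + s * 0)"
    by (intro level_fun_eventually_in[OF L tI D(1) x(1)])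
      (use qe q tI in \<open>simp_all only: inner_minus_right, auto\<close>)
  then have "\<forall>\<^sub>F h in at_left 0. x + h *\<^sub>R ?e \<in> D t"
    by (simp add: eventually_at_left_to_right)
  then have "v \<le> speed \<rho>"
    using outward_derivative_le[OF g D x] mv(2) by (simp only: n ne)
  moreover have "speed \<rho> < k * speed \<rho>"
    using k speed_pos[OF x(3)] by simp
  ultimately obtain a where a: "v < a" "a < k * speed \<rho>"
    using dense[of v "k * speed \<rho>"] by auto
  have "- 1 * p + q \<bullet> (- a *\<^sub>R ?e) = norm q * (v - a)"
    unfolding inner_scaleR_right[of q "- a" ?e] qe using q by (simp add: v right_diff_distrib)
  also have "\<dots> < 0"
    using q a by (simp add: mult_pos_neg)
  finally have "\<forall>\<^sub>F s in at_right 0. x + s *\<^sub>R (- a *\<^sub>R ?e) \<in> D (t + s * (- 1))"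
  proof (rule level_fun_eventually_in[OF L tI D(1) x(1)])
    have "\<forall>\<^sub>F s in at_right 0. s < t"
      using I(1) by (rule eventually_at_rightI[rotated]) simp
    then show "\<forall>\<^sub>F s in at_right 0. t + s * - 1 \<in> I"
      using eventually_at_right_less by eventually_elim (use I in auto)
  qed
  moreover have "\<forall>\<^sub>F s in at_right 0. s < t"
    using I(1) by (rule eventually_at_rightI[rotated]) simp
  ultimately have "\<forall>\<^sub>F s in at_right 0. (cmod (x + s *\<^sub>R (- a *\<^sub>R ?e)))\<^sup>2 < \<sigma> (t - s)"
    using eventually_at_right_less
  proof eventually_elim
    case (elim s)
    then have "cmod (x + s *\<^sub>R (- a *\<^sub>R ?e)) < sqrt (\<sigma> (t - s))"
      using sub[of "t - s"] by auto
    then have "sqrt ((cmod (x + s *\<^sub>R (- a *\<^sub>R ?e)))\<^sup>2) < sqrt (\<sigma> (t - s))"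
      by simp
    then show ?case
      by (simp only: real_sqrt_less_iff)
  qed
  moreover have "\<forall>\<^sub>F s in at_right 0. \<not> (cmod (x + s *\<^sub>R (- a *\<^sub>R ?e)))\<^sup>2 < \<sigma> (t - s)"
  proof -
    have "GDERIV (\<lambda>z::real \<times> complex. (cmod (snd z))\<^sup>2 - \<sigma> (0 + fst z)) (t, x) :> (- (k * (2 * \<rho> * speed \<rho>)), 2 *\<^sub>R snd (t, x))"
      by (rule GDERIV_disk_level) (use \<sigma> in simp)
    moreover have "(- (k * (2 * \<rho> * speed \<rho>)), 2 *\<^sub>R snd (t, x)) \<bullet> (- 1, - a *\<^sub>R ?e) = 2 * \<rho> * (k * speed \<rho> - a)"
    proof -
      have "x \<bullet> ?e = \<rho>"
        using x power2_norm_eq_inner[of x] by (simp add: power2_eq_square field_simps)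
      then show ?thesis
        unfolding inner_prod_def by (simp only: fst_conv snd_conv inner_scaleR_right inner_scaleR_left) (simp add: algebra_simps)
    qed
    moreover have "2 * \<rho> * (k * speed \<rho> - a) > 0"
      using x a by simp
    ultimately have "\<forall>\<^sub>F s in at_right 0. 0 < (cmod (snd ((t, x) + s *\<^sub>R (- 1, - a *\<^sub>R ?e))))\<^sup>2 - \<sigma> (0 + fst ((t, x) + s *\<^sub>R (- 1, - a *\<^sub>R ?e)))"
      by (intro eventually_pos_along_ray) (use \<sigma>(2) x(2) in auto)
    then show ?thesis
      by eventually_elim simp
  qed
  ultimately show False
    by (rule trivial_at_right_contradiction)
qed

text \<open>With \<open>a\<close> between \<open>k * speed \<rho>\<close> and
  \<open>v \<ge> speed \<rho>\<close> the backward motion gives the opposite contradiction: the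
  point lies outside the earlier domain but inside the earlier disk.\<close>

lemma no_inner_touching:
  assumes g: "green_function u (D t) 0 g" and D: "open (D t)" "bounded (D t)" "ball 0 \<rho> \<subseteq> D t"
    and x: "x \<in> frontier (D t)" "cmod x = \<rho>" "\<rho> > 0"
    and mv: "moves_with_normal_velocity I D t x n v" "has_outward_normal_derivative g x n v"
    and I: "t > 0" "{0..t} \<subseteq> I" and sub: "\<And>s. 0 \<le> s \<Longrightarrow> s < t \<Longrightarrow> ball 0 (sqrt (\<sigma> s)) \<subseteq> D s"
    and \<sigma>: "(\<sigma> has_real_derivative k * (2 * \<rho> * speed \<rho>)) (at t)" "\<sigma> t = \<rho>\<^sup>2" and k: "k < 1"
  shows False
proof -
  have tI: "t \<in> I"
    using I by auto
  obtain U \<Phi> p q where L: "level_fun_at I D t x U \<Phi> p q" and n: "n = q /\<^sub>R norm q" and v: "v = - p / norm q"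
    using mv(1) unfolding moves_with_normal_velocity_iff by blast
  let ?e = "x /\<^sub>R \<rho>"
  have q: "norm q > 0"
    using L by (simp add: level_fun_at_def)
  have ne: "q /\<^sub>R norm q = ?e"
    by (rule inner_touching_normal[OF L tI D(1) x(1) D(3) x(2,3)])
  have e1: "norm ?e = 1"
    using x by auto
  have "q \<bullet> ?e = norm q * ((q /\<^sub>R norm q) \<bullet> ?e)"
    using q by simp
  then have qe: "q \<bullet> ?e = norm q"
    unfolding ne using e1 by (simp only: norm_eq_1)
  have "speed \<rho> \<le> v"
    using outward_derivative_ge[OF g D x] mv(2) by (simp only: n ne)
  moreover have "k * speed \<rho> < speed \<rho>"
    using k speed_pos[OF x(3)] by simp
  ultimately obtain a where a: "a < v" "k * speed \<rho> < a"
    using dense[of "k * speed \<rho>" v] by auto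
  have "0 < norm q * (v - a)"
    using q a by simp
  also have "\<dots> = - 1 * p + q \<bullet> (- a *\<^sub>R ?e)"
    unfolding inner_scaleR_right[of q "- a" ?e] qe using q by (simp add: v right_diff_distrib)
  finally have "\<forall>\<^sub>F s in at_right 0. x + s *\<^sub>R (- a *\<^sub>R ?e) \<notin> D (t + s * (- 1))"
  proof (rule level_fun_eventually_notin[OF L tI D(1) x(1)])
    have "\<forall>\<^sub>F s in at_right 0. s < t"
      using I(1) by (rule eventually_at_rightI[rotated]) simp
    then show "\<forall>\<^sub>F s in at_right 0. t + s * - 1 \<in> I"
      using eventually_at_right_less by eventually_elim (use I in auto)
  qed
  moreover have "\<forall>\<^sub>F s in at_right 0. s < t"
    using I(1) by (rule eventually_at_rightI[rotated]) simp
  ultimately have "\<forall>\<^sub>F s in at_right 0. \<not> (cmod (x + s *\<^sub>R (- a *\<^sub>R ?e)))\<^sup>2 < \<sigma> (t - s)"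
    using eventually_at_right_less
  proof eventually_elim
    case (elim s)
    then have "\<not> cmod (x + s *\<^sub>R (- a *\<^sub>R ?e)) < sqrt (\<sigma> (t - s))"
      using sub[of "t - s"] by auto
    then show ?case
      using real_less_rsqrt by blast
  qed
  moreover have "\<forall>\<^sub>F s in at_right 0. (cmod (x + s *\<^sub>R (- a *\<^sub>R ?e)))\<^sup>2 < \<sigma> (t - s)"
  proof -
    have "GDERIV (\<lambda>z::real \<times> complex. (cmod (snd z))\<^sup>2 - \<sigma> (0 + fst z)) (t, x) :> (- (k * (2 * \<rho> * speed \<rho>)), 2 *\<^sub>R snd (t, x))"
      by (rule GDERIV_disk_level) (use \<sigma> in simp)
    moreover have "(- (k * (2 * \<rho> * speed \<rho>)), 2 *\<^sub>R snd (t, x)) \<bullet> (- 1, - a *\<^sub>R ?e) = 2 * \<rho> * (k * speed \<rho> - a)"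
    proof -
      have "x \<bullet> ?e = \<rho>"
        using x power2_norm_eq_inner[of x] by (simp add: power2_eq_square field_simps)
      then show ?thesis
        unfolding inner_prod_def by (simp only: fst_conv snd_conv inner_scaleR_right inner_scaleR_left) (simp add: algebra_simps)
    qed
    moreover have "2 * \<rho> * (k * speed \<rho> - a) < 0"
      using x a by (simp add: mult_pos_neg)
    ultimately have "\<forall>\<^sub>F s in at_right 0. (cmod (snd ((t, x) + s *\<^sub>R (- 1, - a *\<^sub>R ?e))))\<^sup>2 - \<sigma> (0 + fst ((t, x) + s *\<^sub>R (- 1, - a *\<^sub>R ?e))) < 0"
      by (intro eventually_neg_along_ray) (use \<sigma>(2) x(2) in auto)
    then show ?thesis
      by eventually_elim simp
  qed
  ultimately show False
    using trivial_at_right_contradiction by blast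
qed

end

section \<open>Exclusion of sudden expansion\<close>

lemma Ck_on_1_gradient:
  assumes "Ck_on 1 f U"
  shows "\<exists>G. (\<forall>z\<in>U. GDERIV f z :> G z) \<and> continuous_on U G"
proof -
  obtain G where G: "\<And>z. z \<in> U \<Longrightarrow> GDERIV f z :> G z" "\<And>b. b \<in> Basis \<Longrightarrow> continuous_on U (\<lambda>z. G z \<bullet> b)"
    using assms by auto
  from G(1) continuous_on_componentwise_Basis[OF G(2)] show ?thesis
    by blast
qed

lemma GDERIV_unique:
  assumes "GDERIV f x :> D" "GDERIV f x :> D'"
  shows "D = D'"
proof -
  have "(\<lambda>h. h \<bullet> D) = (\<lambda>h. h \<bullet> D')"
    using assms has_derivative_unique unfolding gderiv_def by blast
  then have "(D - D') \<bullet> D = (D - D') \<bullet> D'"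
    by (rule fun_cong)
  then have "(D - D') \<bullet> (D - D') = 0"
    by (simp only: inner_diff_right)
  then show ?thesis
    by simp
qed

text \<open>Near a boundary point, points outside the closure of \<open>D t\<close> have positive level: at a zero
  of the level function its gradient does not vanish, so the zero is a limit of points of \<open>D t\<close>.\<close>

lemma eventually_exterior:
  assumes mv: "moves_with_normal_velocity I D t x n v" and t: "t \<in> I"
  shows "\<exists>e>0. \<forall>y. dist y x < e \<and> y \<notin> closure (D t) \<longrightarrow>
    (\<exists>d>0. \<forall>s\<in>I. \<forall>y'. \<bar>s - t\<bar> < d \<and> dist y' y < d \<longrightarrow> y' \<notin> D s)"
proof -
  obtain U \<Phi> p q where L: "level_fun_at I D t x U \<Phi> p q"
    using mv unfolding moves_with_normal_velocity_iff by blast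
  then have U: "open U" "(t, x) \<in> U" and q: "q \<noteq> 0"
    and lev: "\<And>s y. (s, y) \<in> U \<Longrightarrow> s \<in> I \<Longrightarrow> y \<in> D s \<longleftrightarrow> \<Phi> (s, y) < 0"
    and C1: "Ck_on 1 \<Phi> U" and pq: "GDERIV \<Phi> (t, x) :> (p, q)"
    by (auto simp: level_fun_at_def)
  obtain G where G: "\<And>z. z \<in> U \<Longrightarrow> GDERIV \<Phi> z :> G z" "continuous_on U G"
    using Ck_on_1_gradient[OF C1] by blast
  have Gx: "G (t, x) = (p, q)"
    using GDERIV_unique[OF G(1)[OF U(2)] pq] .
  have "open (U \<inter> (\<lambda>z. snd (G z)) -` (- {0}))"
    using G(2) U(1) by (intro continuous_open_preimage continuous_on_snd) auto
  moreover have "(t, x) \<in> U \<inter> (\<lambda>z. snd (G z)) -` (- {0})"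
    using U q Gx by simp
  ultimately obtain e where e: "e > 0" "ball (t, x) e \<subseteq> U \<inter> (\<lambda>z. snd (G z)) -` (- {0})"
    unfolding open_contains_ball by blast
  have "\<exists>d>0. \<forall>s\<in>I. \<forall>y'. \<bar>s - t\<bar> < d \<and> dist y' y < d \<longrightarrow> y' \<notin> D s" if y: "dist y x < e" "y \<notin> closure (D t)" for y
  proof -
    have "(t, y) \<in> ball (t, x) e"
      using y by (simp add: dist_Pair_Pair dist_commute)
    then have ty: "(t, y) \<in> U" "snd (G (t, y)) \<noteq> 0"
      using e by auto
    have "y \<notin> D t"
      using y closure_subset by blast
    then have "\<Phi> (t, y) \<ge> 0"
      using lev[OF ty(1) t] by simp
    moreover have "\<Phi> (t, y) \<noteq> 0"
    proof
      assume 0: "\<Phi> (t, y) = 0"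
      let ?w = "- snd (G (t, y))"
      have "\<forall>\<^sub>F s in at_right 0. \<Phi> ((t, y) + s *\<^sub>R (0, ?w)) < 0"
        by (rule eventually_neg_along_ray[OF G(1)[OF ty(1)] 0]) (use ty in \<open>simp add: inner_prod_def\<close>)
      moreover have "\<forall>\<^sub>F s in at_right 0. (t, y) + s *\<^sub>R (0, ?w) \<in> U"
        by (rule eventually_along_ray_in_open[OF U(1) ty(1)])
      moreover have "\<forall>\<^sub>F s in at_right 0. y + s *\<^sub>R ?w \<in> - closure (D t)"
        by (rule eventually_along_ray_in_open) (use y in auto)
      ultimately have "\<forall>\<^sub>F s in at_right (0::real). False"
      proof eventually_elim
        case (elim s)
        then have "y + s *\<^sub>R ?w \<in> D t"
          using lev t by simp
        then show ?case
          using elim closure_subset by blast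
      qed
      then show False
        by simp
    qed
    ultimately have pos: "\<Phi> (t, y) > 0"
      by simp
    have "(\<Phi> \<longlongrightarrow> \<Phi> (t, y)) (nhds (t, y))"
      using GDERIV_isCont[OF G(1)[OF ty(1)]] by (simp add: isCont_def tendsto_at_iff_tendsto_nhds)
    then have "\<forall>\<^sub>F z in nhds (t, y). \<Phi> z > 0"
      using pos by (rule order_tendstoD)
    moreover have "\<forall>\<^sub>F z in nhds (t, y). z \<in> U"
      by (rule eventually_nhds_in_open[OF U(1) ty(1)])
    ultimately have "\<forall>\<^sub>F z in nhds (t, y). z \<in> U \<and> \<Phi> z > 0"
      by eventually_elim simp
    then obtain d where d: "d > 0" "\<And>z. dist z (t, y) < d \<Longrightarrow> z \<in> U \<and> \<Phi> z > 0"
      unfolding eventually_nhds_metric by blast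
    have "y' \<notin> D s" if "s \<in> I" "\<bar>s - t\<bar> < d / 2" "dist y' y < d / 2" for s y'
    proof -
      have "dist (s, y') (t, y) \<le> \<bar>s - t\<bar> + dist y' y"
        unfolding dist_Pair_Pair dist_real_def using sqrt_sum_squares_le_sum_abs[of "\<bar>s - t\<bar>" "dist y' y"] by simp
      also have "\<dots> < d"
        using that by simp
      finally show ?thesis
        using d(2) lev[OF _ that(1)] by fastforce
    qed
    then show ?thesis
      using d(1) by (intro exI[of _ "d / 2"]) auto
  qed
  then show ?thesis
    using e(1) by blast
qed


text \<open>A connected \<open>D s\<close> containing the origin cannot cross the compact set of points at a fixed
  small distance from \<open>D t\<close>, all of which stay outside of \<open>D s\<close> for \<open>s\<close> near \<open>t\<close>.\<close>

lemma no_sudden_expansion: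
  assumes t: "t \<in> I" and D: "open (D t)" "0 \<in> D t"
    and conn: "\<And>s. s \<in> I \<Longrightarrow> connected (D s) \<and> 0 \<in> D s"
    and mv: "\<And>x. x \<in> frontier (D t) \<Longrightarrow> \<exists>n v. moves_with_normal_velocity I D t x n v"
    and sub: "closure (D t) \<subseteq> ball 0 \<rho>"
  shows "\<exists>\<delta>>0. \<forall>s\<in>I. \<bar>s - t\<bar> < \<delta> \<longrightarrow> D s \<subseteq> ball 0 \<rho>"
proof -
  let ?C = "closure (D t)"
  have C: "compact ?C" "?C \<noteq> {}"
    using bounded_subset[OF bounded_ball sub] D by (auto simp: compact_eq_bounded_closed)
  define stays where "stays = (\<lambda>y. \<exists>d>0. \<forall>s\<in>I. \<forall>y'. \<bar>s - t\<bar> < d \<and> dist y' y < d \<longrightarrow> y' \<notin> D s)"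
  have "\<forall>x\<in>frontier (D t). \<exists>e>0. \<forall>y. dist y x < e \<and> y \<notin> ?C \<longrightarrow> stays y"
    using mv eventually_exterior[OF _ t] unfolding stays_def by blast
  then obtain r where r: "\<And>x. x \<in> frontier (D t) \<Longrightarrow> r x > 0"
      "\<And>x y. x \<in> frontier (D t) \<Longrightarrow> dist y x < r x \<Longrightarrow> y \<notin> ?C \<Longrightarrow> stays y"
    by metis
  have "compact (frontier (D t))"
    using bounded_subset[OF bounded_ball sub] closure_subset bounded_subset
    by (intro compact_frontier_bounded) blast
  moreover have "frontier (D t) \<subseteq> \<Union> ((\<lambda>x. ball x (r x)) ` frontier (D t))"
    using r(1) by auto
  \<comment> \<open>A Lebesgue number of the cover: one radius \<open>e\<close> that serves all
    frontier points at once.\<close>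
  ultimately obtain e where e: "e > 0"
    "\<And>x. x \<in> frontier (D t) \<Longrightarrow> \<exists>B\<in>(\<lambda>x. ball x (r x)) ` frontier (D t). ball x e \<subseteq> B"
    by (rule Heine_Borel_lemma) auto
  obtain w where "w \<in> ?C" and w: "\<And>z. z \<in> ?C \<Longrightarrow> cmod z \<le> cmod w"
    using continuous_attains_sup[OF C, of cmod] by (auto intro: continuous_intros)
  then have w\<rho>: "cmod w < \<rho>"
    using sub by auto
  \<comment> \<open>Below the Lebesgue number, so the level functions decide at distance
    \<open>d\<close>; and at most \<open>\<rho> - cmod w\<close>, so that points closer than
    \<open>d\<close> to the closure are still in the disk.\<close>
  define d where "d = min (e / 2) (\<rho> - cmod w)"
  have d: "0 < d" "d < e" "d \<le> \<rho> - cmod w"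
    using e w\<rho> by (auto simp: d_def)
  define K where "K = {y. infdist y ?C = d}"
  have stays: "stays y" if y: "y \<in> K" for y
  proof -
    obtain x where "x \<in> ?C" "infdist y ?C = dist y x"
      by (rule infdist_attains_inf[OF closed_closure C(2)])
    then have x: "x \<in> ?C" "dist y x = d"
      using y by (simp_all add: K_def)
    have yC: "y \<notin> ?C"
      using y d(1) by (auto simp: K_def)
    have "\<exists>x'. x' \<in> frontier (D t) \<and> dist y x' \<le> d"
    proof (cases "x \<in> D t")
      case True
      have "closed_segment x y \<inter> frontier (D t) \<noteq> {}"
        using True yC closure_subset by (intro connected_Int_frontier) auto
      then obtain x' where "x' \<in> closed_segment x y" "x' \<in> frontier (D t)"
        by blast
      then show ?thesis
        using segment_bound(2)[of x' x y] x(2) by (auto simp: dist_norm norm_minus_commute)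
    next
      case False
      then show ?thesis
        using x D by (auto simp: frontier_def interior_open)
    qed
    then obtain x' where x': "x' \<in> frontier (D t)" "dist y x' \<le> d"
      by blast
    obtain z where z: "z \<in> frontier (D t)" "ball x' e \<subseteq> ball z (r z)"
      using e(2)[OF x'(1)] by blast
    have "y \<in> ball x' e"
      using x' d by (simp add: dist_commute)
    then have "dist y z < r z"
      using z by (auto simp: dist_commute)
    then show ?thesis
      using r(2)[OF z(1)] yC by blast
  qed
  have "compact K"
  proof -
    have "closed K"
      unfolding K_def by (intro closed_Collect_eq continuous_intros)
    moreover have "K \<subseteq> {y. infdist y ?C \<le> d}"
      by (auto simp: K_def)
    then have "bounded K"
      using compact_infdist_le[OF C(2) C(1) d(1)] compact_imp_bounded bounded_subset by blast
    ultimately show ?thesis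
      by (simp add: compact_eq_bounded_closed)
  qed
  have "\<forall>y\<in>K. \<exists>d>0. \<forall>s\<in>I. \<forall>y'. \<bar>s - t\<bar> < d \<and> dist y' y < d \<longrightarrow> y' \<notin> D s"
    using stays unfolding stays_def by blast
  then obtain h where h: "\<And>y. y \<in> K \<Longrightarrow> h y > 0"
    "\<And>y s y'. y \<in> K \<Longrightarrow> s \<in> I \<Longrightarrow> \<bar>s - t\<bar> < h y \<Longrightarrow> dist y' y < h y \<Longrightarrow> y' \<notin> D s"
    by metis
  obtain K' where K': "K' \<subseteq> K" "finite K'" "K \<subseteq> (\<Union>y\<in>K'. ball y (h y))"
    using compactE_image[OF \<open>compact K\<close>, of K "\<lambda>y. ball y (h y)"] h(1) by force
  define \<delta> where "\<delta> = Min (insert 1 (h ` K'))"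
  have \<delta>: "\<delta> > 0" "\<And>y. y \<in> K' \<Longrightarrow> \<delta> \<le> h y"
    unfolding \<delta>_def using K' h(1) by auto
  have "D s \<subseteq> ball 0 \<rho>" if s: "s \<in> I" "\<bar>s - t\<bar> < \<delta>" for s
  proof
    fix z assume z: "z \<in> D s"
    have disj: "y \<notin> D s" if "y \<in> K" for y
    proof -
      have "y \<in> (\<Union>y\<in>K'. ball y (h y))"
        using K'(3) that by blast
      then obtain y' where "y' \<in> K'" "dist y y' < h y'"
        by (auto simp: dist_commute)
      then show ?thesis
        using h(2)[of y' s y] K'(1) s \<delta>(2)[of y'] by auto
    qed
    have "infdist z ?C < d"
    proof (rule ccontr)
      assume far: "\<not> infdist z ?C < d"
      have "infdist 0 ?C = 0"
        using D(2) closure_subset by (intro infdist_zero) blast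
      moreover have "connected ((\<lambda>y. infdist y ?C) ` D s)"
        using conn[OF s(1)] by (intro connected_continuous_image continuous_intros) auto
      moreover have "0 \<in> D s"
        using conn[OF s(1)] by blast
      ultimately have "{0..infdist z ?C} \<subseteq> (\<lambda>y. infdist y ?C) ` D s"
        using z by (intro connected_contains_Icc) (simp_all add: rev_image_eqI)
      moreover have "d \<in> {0..infdist z ?C}"
        using far d(1) by simp
      ultimately have "d \<in> (\<lambda>y. infdist y ?C) ` D s"
        by blast
      then show False
        using disj by (auto simp: K_def)
    qed
    moreover obtain x where "x \<in> ?C" "infdist z ?C = dist z x"
      by (rule infdist_attains_inf[OF closed_closure C(2)])
    ultimately have "cmod z < d + cmod w"
      using w[of x] norm_triangle_sub[of z x] by (simp add: dist_norm)
    then show "z \<in> ball 0 \<rho>"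
      using d by simp
  qed
  then show ?thesis
    using \<delta>(1) by blast
qed

section \<open>Barriers and uniqueness\<close>

text \<open>Real induction on a half-open interval. At the infimum \<open>r\<close> of the failing
  times \<open>P\<close> holds throughout the past, so the step extends it beyond \<open>r\<close>
  and failing times cannot accumulate there.\<close>

lemma first_failure:
  fixes T :: real
  assumes "t \<in> {0..<T}" "\<not> P t"
    and step: "\<And>r. r \<in> {0..<T} \<Longrightarrow> (\<And>s. 0 \<le> s \<Longrightarrow> s < r \<Longrightarrow> P s) \<Longrightarrow>
      \<exists>\<delta>>0. \<forall>s. r \<le> s \<and> s < r + \<delta> \<and> s < T \<longrightarrow> P s"
  shows False
proof -
  define A where "A = {s \<in> {0..<T}. \<not> P s}"
  define r where "r = Inf A"
  have A: "t \<in> A" "bdd_below A"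
    using assms(1,2) by (auto simp: A_def intro!: bdd_belowI[of _ 0])
  have "r \<le> t"
    unfolding r_def using A by (rule cInf_lower)
  moreover have "r \<ge> 0"
    unfolding r_def using A by (intro cInf_greatest) (auto simp: A_def)
  ultimately have r: "r \<in> {0..<T}"
    using assms(1) by auto
  have "P s" if "0 \<le> s" "s < r" for s
  proof (rule ccontr)
    assume "\<not> P s"
    then have "s \<in> A"
      using that r by (simp add: A_def)
    then have "r \<le> s"
      unfolding r_def using A(2) by (rule cInf_lower)
    then show False
      using that by simp
  qed
  then obtain \<delta> where \<delta>: "\<delta> > 0" "\<And>s. r \<le> s \<Longrightarrow> s < r + \<delta> \<Longrightarrow> s < T \<Longrightarrow> P s"
    using step[OF r] by blast
  obtain a where "a \<in> A" "a < r + \<delta>"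
    using cInf_lessD[of A "r + \<delta>"] A \<delta>(1) by (auto simp: r_def)
  moreover have "r \<le> a"
    unfolding r_def using \<open>a \<in> A\<close> A(2) by (rule cInf_lower)
  ultimately show False
    using \<delta>(2)[of a] by (auto simp: A_def)
qed

context radial_potential
begin

text \<open>Disks growing faster than the elliptic growth of disks are barriers from outside, slower ones
  from inside.\<close>

lemma elliptic_growth_outer_barrier:
  assumes growth: "elliptic_growth u 0 {0..<T} D" and D0: "D 0 = ball 0 R0"
    and S: "\<And>\<tau>. (S has_real_derivative 2 * c0 / p (complex_of_real (sqrt (S \<tau>)))) (at \<tau>)"
    and mono: "strict_mono S" and R0: "S \<tau> = R0\<^sup>2" "R0 > 0"
    and k: "k > 1" and b: "b > 0" and t: "t \<in> {0..<T}"
  shows "D t \<subseteq> ball 0 (sqrt (S (\<tau> + b + k * t)))"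
proof (rule ccontr)
  assume neg: "\<not> ?thesis"
  define \<sigma> where "\<sigma> = (\<lambda>t. S (\<tau> + b + k * t))"
  have \<sigma>_mono: "\<sigma> r < \<sigma> s" if "r < s" for r s
    unfolding \<sigma>_def using that k mono by (simp add: strict_mono_less)
  have \<sigma>0: "\<sigma> 0 > R0\<^sup>2"
    using strict_monoD[OF mono, of \<tau> "\<tau> + b"] b R0 by (simp add: \<sigma>_def)
  have \<sigma>_pos: "\<sigma> s > 0" if "s \<ge> 0" for s
    using \<sigma>_mono[of 0 s] \<sigma>0 that R0 by (cases "s = 0") (auto intro: less_trans[of 0 "R0\<^sup>2"] order.strict_trans[OF zero_less_power[of R0 2]])
  show False
  proof (rule first_failure[where P="\<lambda>s. D s \<subseteq> ball 0 (sqrt (\<sigma> s))", OF t])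
    show "\<not> D t \<subseteq> ball 0 (sqrt (\<sigma> t))"
      using neg by (simp add: \<sigma>_def)
  next
    fix r assume r: "r \<in> {0..<T}" and before: "\<And>s. 0 \<le> s \<Longrightarrow> s < r \<Longrightarrow> D s \<subseteq> ball 0 (sqrt (\<sigma> s))"
    define \<rho> where "\<rho> = sqrt (\<sigma> r)"
    have \<rho>: "\<rho> > 0" "\<rho>\<^sup>2 = \<sigma> r"
      using \<sigma>_pos[of r] r by (auto simp: \<rho>_def)
    have \<sigma>': "(\<sigma> has_real_derivative k * (2 * \<rho> * speed \<rho>)) (at r)"
    proof -
      have "((\<lambda>t. \<tau> + b + k * t) has_real_derivative k) (at r)"
        by (auto intro!: derivative_eq_intros)
      from DERIV_chain2[OF S this] show ?thesis
        unfolding \<sigma>_def \<rho>_def speed_def using \<rho> by (simp add: \<sigma>_def \<rho>_def mult.commute)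
    qed
    obtain g where g: "green_function u (D r) 0 g"
      and bd: "\<And>x. x \<in> frontier (D r) \<Longrightarrow> \<exists>n v. moves_with_normal_velocity {0..<T} D r x n v \<and>
        has_outward_normal_derivative g x n v"
      using growth r unfolding elliptic_growth_def by meson
    have Dr: "open (D r)" "bounded (D r)" "0 \<in> D r"
      using growth r by (auto simp: elliptic_growth_def)
    have "D r \<subseteq> cball 0 \<rho>"
    proof (cases "r = 0")
      case True
      then have "R0 \<le> \<rho>"
        using \<sigma>0 \<rho> R0 by (intro power2_le_imp_le[of R0 \<rho>]) auto
      then show ?thesis
        using D0 True by auto
    next
      case False
      show ?thesis
      proof (rule ccontr)
        assume "\<not> D r \<subseteq> cball 0 \<rho>"
        then obtain y where y: "y \<in> D r" "cmod y > \<rho>"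
          by (metis linorder_not_le mem_cball_0 subsetI)
        \<comment> \<open>The point \<open>y\<close> may be far from the frontier, where no level
          function is at hand. A farthest point \<open>w\<close> of the closure is on the frontier,
          and points of \<open>D r\<close> close to it are still beyond \<open>\<rho>\<close>. By
          continuity of the level function in time such a point belongs to \<open>D s\<close> for
          \<open>s\<close> just before \<open>r\<close>, against the containment at that
          time.\<close>
        obtain w where "w \<in> closure (D r)" and w: "\<And>z. z \<in> closure (D r) \<Longrightarrow> cmod z \<le> cmod w"
          using continuous_attains_sup[of "closure (D r)" cmod] continuous_on_norm_id Dr by auto
        have "cmod w > \<rho>"
          using w[of y] y closure_subset[of "D r"] by auto
        have "w \<notin> D r"
        proof
          assume "w \<in> D r"
          then have "\<forall>\<^sub>F s in at_right 0. w + s *\<^sub>R w \<in> D r"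
            by (rule eventually_along_ray_in_open[OF Dr(1)])
          then have "\<forall>\<^sub>F s in at_right 0. norm (w + s *\<^sub>R w) \<le> norm w"
            by eventually_elim (use w closure_subset in blast)
          moreover have "\<forall>\<^sub>F s in at_right 0. norm (w + s *\<^sub>R w) > norm w"
            by (rule eventually_norm_gt_along_ray)
              (use \<open>cmod w > \<rho>\<close> \<rho> in auto)
          then have "\<forall>\<^sub>F s in at_right 0. \<not> norm (w + s *\<^sub>R w) \<le> norm w"
            by eventually_elim simp
          ultimately show False
            by (rule trivial_at_right_contradiction)
        qed
        then have wf: "w \<in> frontier (D r)"
          using \<open>w \<in> closure (D r)\<close> Dr by (simp add: frontier_def interior_open)
        obtain U \<Phi> p' q' where L: "level_fun_at {0..<T} D r w U \<Phi> p' q'"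
          using bd[OF wf] unfolding moves_with_normal_velocity_iff by blast
        have U: "open U" "(r, w) \<in> U" and C1: "Ck_on 1 \<Phi> U"
          and lev: "\<And>s y. (s, y) \<in> U \<Longrightarrow> s \<in> {0..<T} \<Longrightarrow> y \<in> D s \<longleftrightarrow> \<Phi> (s, y) < 0"
          using L by (auto simp: level_fun_at_def)
        have "((\<lambda>y. (r, y)) \<longlongrightarrow> (r, w)) (nhds w)"
          by (intro tendsto_intros filterlim_ident)
        then have "\<forall>\<^sub>F y in nhds w. (r, y) \<in> U"
          using U by (rule topological_tendstoD)
        moreover have "\<forall>\<^sub>F y in nhds w. y \<in> - cball 0 \<rho>"
          by (rule eventually_nhds_in_open) (use \<open>cmod w > \<rho>\<close> in auto)
        ultimately have "\<forall>\<^sub>F y in nhds w. (r, y) \<in> U \<and> y \<in> - cball 0 \<rho>"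
          by eventually_elim simp
        then obtain N where N: "open N" "w \<in> N" "\<And>y. y \<in> N \<Longrightarrow> (r, y) \<in> U \<and> y \<in> - cball 0 \<rho>"
          unfolding eventually_nhds by blast
        obtain y' where y': "y' \<in> D r" "y' \<in> N"
          using \<open>w \<in> closure (D r)\<close> N(1,2) by (auto simp: closure_iff_nhds_not_empty dest!: spec[of _ N])
        have y'U: "(r, y') \<in> U" "cmod y' > \<rho>"
          using N(3)[OF y'(2)] by auto
        have neg': "\<Phi> (r, y') < 0"
          using lev[OF y'U(1) r] y' by simp
        obtain G where "\<forall>z\<in>U. GDERIV \<Phi> z :> G z"
          using Ck_on_1_gradient[OF C1] by blast
        then have "isCont \<Phi> (r, y')"
          using y'U GDERIV_isCont by blast
        moreover have "((\<lambda>s. (s, y')) \<longlongrightarrow> (r, y')) (at_left r)"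
          by (intro tendsto_intros)
        ultimately have "\<forall>\<^sub>F s in at_left r. \<Phi> (s, y') < 0" "\<forall>\<^sub>F s in at_left r. (s, y') \<in> U"
          using isCont_tendsto_compose[of "(r, y')" \<Phi> "\<lambda>s. (s, y')" "at_left r"] neg' U(1) y'U(1)
          by (auto intro: topological_tendstoD order_tendstoD)
        moreover have "\<forall>\<^sub>F s in at_left r. s \<in> {0<..<r}"
          using False r by (intro eventually_at_leftI[of 0]) auto
        ultimately have "\<forall>\<^sub>F s in at_left r. False"
        proof eventually_elim
          case (elim s)
          then have "y' \<in> D s"
            using lev[of s y'] r by auto
          then have "cmod y' < sqrt (\<sigma> s)"
            using before[of s] elim by auto
          moreover have "sqrt (\<sigma> s) < \<rho>"
            using \<sigma>_mono[of s r] elim by (simp add: \<rho>_def)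
          ultimately show ?case
            using y'U by simp
        qed
        then show False
          by simp
      qed
    qed
    then have sub: "D r \<subseteq> ball 0 \<rho>"
      using Dr(1) interior_maximal[of "D r" "cball 0 \<rho>"] by simp
    \<comment> \<open>Excluding contact leaves a gap between the domain and the circle, by the
      initial offset at \<open>r = 0\<close> and by the strict speeds later. This gap is what the
      exclusion of sudden expansion starts from.\<close>
    have "closure (D r) \<subseteq> ball 0 \<rho>"
    proof
      fix x assume x: "x \<in> closure (D r)"
      have "x \<in> cball 0 \<rho>"
        using x closure_mono[OF sub] \<rho> by auto
      moreover have "cmod x \<noteq> \<rho>"
      proof
        assume x\<rho>: "cmod x = \<rho>"
        then have xf: "x \<in> frontier (D r)"
          using x sub Dr by (auto simp: frontier_def interior_open)
        show False
        proof (cases "r = 0")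
          case True
          then have "x \<in> closure (ball 0 R0)"
            using x D0 by simp
          then have "cmod x \<le> R0"
            using R0 by simp
          moreover have "R0 < \<rho>"
            using \<sigma>0 \<rho> True by (intro power2_less_imp_less[of R0 \<rho>]) auto
          ultimately show False
            using x\<rho> by simp
        next
          case False
          obtain n v where mv: "moves_with_normal_velocity {0..<T} D r x n v" "has_outward_normal_derivative g x n v"
            using bd[OF xf] by blast
          show False
            by (rule no_outer_touching[OF g Dr(1,3) sub xf x\<rho> \<rho>(1) mv _ _ before \<sigma>' _ k])
              (use r False \<rho>(2) in auto)
        qed
      qed
      ultimately show "x \<in> ball 0 \<rho>"
        by simp
    qed
    then have "\<exists>\<delta>>0. \<forall>s\<in>{0..<T}. \<bar>s - r\<bar> < \<delta> \<longrightarrow> D s \<subseteq> ball 0 \<rho>"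
    proof (rule no_sudden_expansion[where D=D, OF r Dr(1,3), rotated 2])
      show "connected (D s) \<and> 0 \<in> D s" if "s \<in> {0..<T}" for s
        using growth that by (simp add: elliptic_growth_def)
      show "\<exists>n v. moves_with_normal_velocity {0..<T} D r x n v" if "x \<in> frontier (D r)" for x
        using bd[OF that] by blast
    qed
    then obtain \<delta> where \<delta>: "\<delta> > 0" "\<And>s. s \<in> {0..<T} \<Longrightarrow> \<bar>s - r\<bar> < \<delta> \<Longrightarrow> D s \<subseteq> ball 0 \<rho>"
      by blast
    have "D s \<subseteq> ball 0 (sqrt (\<sigma> s))" if s: "r \<le> s" "s < r + \<delta>" "s < T" for s
    proof -
      have "D s \<subseteq> ball 0 \<rho>"
        using \<delta>(2)[of s] s r by auto
      moreover have "\<rho> \<le> sqrt (\<sigma> s)"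
        using \<sigma>_mono[of r s] s by (cases "r = s") (auto simp: \<rho>_def)
      ultimately show ?thesis
        using subset_ball by blast
    qed
    then show "\<exists>\<delta>>0. \<forall>s. r \<le> s \<and> s < r + \<delta> \<and> s < T \<longrightarrow> D s \<subseteq> ball 0 (sqrt (\<sigma> s))"
      using \<delta>(1) by blast
  qed
qed

text \<open>Monotonicity of the family carries earlier disks into \<open>D r\<close>, which yields
  the open disk at time \<open>r\<close> by continuity of the radius, and it carries whatever room
  \<open>D r\<close> leaves around the disk to all later times. The positivity of
  \<open>S (\<tau> + b)\<close> ensures that the barrier starts as a genuine disk.\<close>

lemma elliptic_growth_inner_barrier:
  assumes growth: "elliptic_growth u 0 {0..<T} D" and D0: "D 0 = ball 0 R0"
    and S: "\<And>\<tau>. (S has_real_derivative 2 * c0 / p (complex_of_real (sqrt (S \<tau>)))) (at \<tau>)"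
    and mono: "strict_mono S" and R0: "S \<tau> = R0\<^sup>2" "R0 > 0"
    and k: "0 < k" "k < 1" and b: "b < 0" "S (\<tau> + b) > 0" and t: "t \<in> {0..<T}"
  shows "ball 0 (sqrt (S (\<tau> + b + k * t))) \<subseteq> D t"
proof (rule ccontr)
  assume neg: "\<not> ?thesis"
  define \<sigma> where "\<sigma> = (\<lambda>t. S (\<tau> + b + k * t))"
  have \<sigma>_mono: "\<sigma> r < \<sigma> s" if "r < s" for r s
    unfolding \<sigma>_def using that k mono by (simp add: strict_mono_less)
  have \<sigma>0: "\<sigma> 0 < R0\<^sup>2" "\<sigma> 0 > 0"
    using strict_monoD[OF mono, of "\<tau> + b" \<tau>] b R0 by (simp_all add: \<sigma>_def)
  have \<sigma>_pos: "\<sigma> s > 0" if "s \<ge> 0" for s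
    using \<sigma>_mono[of 0 s] \<sigma>0 that by (cases "s = 0") auto
  have \<sigma>_cont: "isCont \<sigma> s" for s
  proof -
    have "isCont S x" for x
      using S DERIV_isCont by blast
    then show ?thesis
      unfolding \<sigma>_def by (intro isCont_o2[of s "\<lambda>t. \<tau> + b + k * t" S] continuous_intros)
  qed
  have D_mono: "D r \<subseteq> D s" if "0 \<le> r" "r \<le> s" "s < T" for r s
    using growth that by (auto simp: elliptic_growth_def)
  show False
  proof (rule first_failure[where P="\<lambda>s. ball 0 (sqrt (\<sigma> s)) \<subseteq> D s", OF t])
    show "\<not> ball 0 (sqrt (\<sigma> t)) \<subseteq> D t"
      using neg by (simp add: \<sigma>_def)
  next
    fix r assume r: "r \<in> {0..<T}" and before: "\<And>s. 0 \<le> s \<Longrightarrow> s < r \<Longrightarrow> ball 0 (sqrt (\<sigma> s)) \<subseteq> D s"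
    define \<rho> where "\<rho> = sqrt (\<sigma> r)"
    have \<rho>: "\<rho> > 0" "\<rho>\<^sup>2 = \<sigma> r"
      using \<sigma>_pos[of r] r by (auto simp: \<rho>_def)
    have \<sigma>': "(\<sigma> has_real_derivative k * (2 * \<rho> * speed \<rho>)) (at r)"
    proof -
      have "((\<lambda>t. \<tau> + b + k * t) has_real_derivative k) (at r)"
        by (auto intro!: derivative_eq_intros)
      from DERIV_chain2[OF S this] show ?thesis
        unfolding \<sigma>_def \<rho>_def speed_def using \<rho> by (simp add: \<sigma>_def \<rho>_def mult.commute)
    qed
    obtain g where g: "green_function u (D r) 0 g"
      and bd: "\<And>x. x \<in> frontier (D r) \<Longrightarrow> \<exists>n v. moves_with_normal_velocity {0..<T} D r x n v \<and>
        has_outward_normal_derivative g x n v"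
      using growth r unfolding elliptic_growth_def by meson
    have Dr: "open (D r)" "bounded (D r)" "0 \<in> D r"
      using growth r by (auto simp: elliptic_growth_def)
    have sub: "ball 0 \<rho> \<subseteq> D r"
    proof (cases "r = 0")
      case True
      then have "\<rho> \<le> R0"
        using \<sigma>0 \<rho> R0 by (intro power2_le_imp_le[of \<rho> R0]) auto
      then show ?thesis
        using D0 True subset_ball[of \<rho> R0 0] by simp
    next
      case False
      show ?thesis
      proof
        fix y :: complex assume "y \<in> ball 0 \<rho>"
        then have y: "cmod y < sqrt (\<sigma> r)"
          by (simp add: \<rho>_def)
        have "((\<lambda>s. sqrt (\<sigma> s)) \<longlongrightarrow> sqrt (\<sigma> r)) (at_left r)"
          using \<sigma>_cont[of r] by (intro tendsto_real_sqrt) (auto simp: isCont_def intro: tendsto_within_subset)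
        then have "\<forall>\<^sub>F s in at_left r. cmod y < sqrt (\<sigma> s)"
          using y by (rule order_tendstoD)
        moreover have "\<forall>\<^sub>F s in at_left r. s \<in> {0<..<r}"
          using False r by (intro eventually_at_leftI[of 0]) auto
        ultimately have "\<forall>\<^sub>F s in at_left r. y \<in> D r"
        proof eventually_elim
          case (elim s)
          then have "y \<in> D s"
            using before[of s] by auto
          then show ?case
            using D_mono[of s r] elim r by auto
        qed
        then show "y \<in> D r"
          by simp
      qed
    qed
    have "cball 0 \<rho> \<subseteq> D r"
    proof
      fix x :: complex assume x: "x \<in> cball 0 \<rho>"
      show "x \<in> D r"
      proof (rule ccontr)
        assume "x \<notin> D r"
        then have x\<rho>: "cmod x = \<rho>"
          using x sub by force
        have "x \<in> closure (D r)"
          using x closure_mono[OF sub] \<rho> by auto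
        then have xf: "x \<in> frontier (D r)"
          using \<open>x \<notin> D r\<close> Dr by (simp add: frontier_def interior_open)
        show False
        proof (cases "r = 0")
          case True
          then have "\<rho> < R0"
            using \<sigma>0 \<rho> R0 by (intro power2_less_imp_less[of \<rho> R0]) auto
          then show False
            using \<open>x \<notin> D r\<close> True D0 x\<rho> by simp
        next
          case False
          obtain n v where mv: "moves_with_normal_velocity {0..<T} D r x n v" "has_outward_normal_derivative g x n v"
            using bd[OF xf] by blast
          show False
            by (rule no_inner_touching[OF g Dr(1,2) sub xf x\<rho> \<rho>(1) mv _ _ before \<sigma>' _ k(2)])
              (use r False \<rho>(2) in auto)
        qed
      qed
    qed
    \<comment> \<open>The closed disk is compact and the complement closed, so they have a positive
      distance \<open>d\<close>. Comparing a point with its radial projection to the circle shows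
      that the disk can be enlarged by \<open>d\<close> inside \<open>D r\<close>.\<close>
    then have "cball 0 \<rho> \<inter> - D r = {}"
      by auto
    then obtain d where d: "d > 0" "\<And>x y. x \<in> cball 0 \<rho> \<Longrightarrow> y \<in> - D r \<Longrightarrow> d \<le> dist x y"
      using separate_compact_closed[of "cball 0 \<rho>" "- D r"] Dr(1) by (auto simp: closed_Compl)
    have big: "ball 0 (\<rho> + d) \<subseteq> D r"
    proof
      fix y :: complex assume y: "y \<in> ball 0 (\<rho> + d)"
      show "y \<in> D r"
      proof (cases "cmod y \<le> \<rho>")
        case True
        then show ?thesis
          using \<open>cball 0 \<rho> \<subseteq> D r\<close> by auto
      next
        case False
        let ?x = "(\<rho> / cmod y) *\<^sub>R y"
        have y0: "cmod y > 0"
          using False \<rho> by linarith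
        have "?x - y = (\<rho> / cmod y - 1) *\<^sub>R y"
          by (simp add: scaleR_diff_left)
        then have "dist ?x y = \<bar>\<rho> / cmod y - 1\<bar> * cmod y"
          by (simp add: dist_norm)
        also have "\<dots> = cmod y - \<rho>"
          using False y0 by (simp add: abs_if field_simps)
        finally have "dist ?x y < d"
          using y by simp
        moreover have "?x \<in> cball 0 \<rho>"
          using y0 \<rho> by simp
        ultimately show ?thesis
          using d(2)[of ?x y] by auto
      qed
    qed
    have "((\<lambda>s. sqrt (\<sigma> s)) \<longlongrightarrow> \<rho>) (nhds r)"
      unfolding \<rho>_def using \<sigma>_cont[of r] by (intro tendsto_real_sqrt) (simp add: isCont_def tendsto_at_iff_tendsto_nhds)
    then have "\<forall>\<^sub>F s in nhds r. sqrt (\<sigma> s) < \<rho> + d"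
      using d(1) by (intro order_tendstoD) auto
    then obtain \<delta> where \<delta>: "\<delta> > 0" "\<And>s. \<bar>s - r\<bar> < \<delta> \<Longrightarrow> sqrt (\<sigma> s) < \<rho> + d"
      unfolding eventually_nhds_metric dist_real_def by blast
    have "ball 0 (sqrt (\<sigma> s)) \<subseteq> D s" if s: "r \<le> s" "s < r + \<delta>" "s < T" for s
    proof -
      have "sqrt (\<sigma> s) \<le> \<rho> + d"
        using \<delta>(2)[of s] s by auto
      then have "ball 0 (sqrt (\<sigma> s)) \<subseteq> ball (0::complex) (\<rho> + d)"
        by (rule subset_ball)
      also have "\<dots> \<subseteq> D r"
        by (rule big)
      also have "\<dots> \<subseteq> D s"
        using D_mono[of r s] s r by auto
      finally show ?thesis .
    qed
    then show "\<exists>\<delta>>0. \<forall>s. r \<le> s \<and> s < r + \<delta> \<and> s < T \<longrightarrow> ball 0 (sqrt (\<sigma> s)) \<subseteq> D s"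
      using \<delta>(1) by blast
  qed
qed

text \<open>Offset and factor are tied to one parameter, \<open>b = e\<close> and
  \<open>k = 1 + e\<close>: positive \<open>e\<close> gives an outer barrier, negative
  \<open>e\<close> an inner one, and both close in on the same disk as \<open>e\<close> tends to
  0.\<close>

lemma elliptic_growth_unique:
  assumes growth: "elliptic_growth u 0 {0..<T} D" and D0: "D 0 = ball 0 R0"
    and S: "\<And>\<tau>. (S has_real_derivative 2 * c0 / p (complex_of_real (sqrt (S \<tau>)))) (at \<tau>)"
    and mono: "strict_mono S" and R0: "S \<tau> = R0\<^sup>2" "R0 > 0" and t: "t \<in> {0..<T}"
  shows "D t = ball 0 (sqrt (S (\<tau> + t)))"
proof -
  have contS: "isCont S x" for x
    using S DERIV_isCont by blast
  have lim: "((\<lambda>e. S (\<tau> + e + (1 + e) * t)) \<longlongrightarrow> S (\<tau> + t)) (at 0)"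
    by (rule isCont_tendsto_compose[OF contS]) (auto intro!: tendsto_eq_intros)
  have lim0: "((\<lambda>e. S (\<tau> + e)) \<longlongrightarrow> S \<tau>) (at 0)"
    by (rule isCont_tendsto_compose[OF contS]) (auto intro!: tendsto_eq_intros)
  have "D t \<subseteq> cball 0 (sqrt (S (\<tau> + t)))"
  proof
    fix y assume y: "y \<in> D t"
    have "cmod y \<le> sqrt (S (\<tau> + t))"
    proof (rule tendsto_lowerbound)
      show "((\<lambda>e. sqrt (S (\<tau> + e + (1 + e) * t))) \<longlongrightarrow> sqrt (S (\<tau> + t))) (at_right 0)"
        using lim by (intro tendsto_real_sqrt) (auto intro: tendsto_within_subset)
      have *: "cmod y \<le> sqrt (S (\<tau> + e + (1 + e) * t))" if "0 < e" for e
        using elliptic_growth_outer_barrier[OF growth D0 S mono R0 _ that t, of "1 + e"] that y by auto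
      show "\<forall>\<^sub>F e in at_right 0. cmod y \<le> sqrt (S (\<tau> + e + (1 + e) * t))"
        using eventually_at_right_less by eventually_elim (rule *)
    qed simp
    then show "y \<in> cball 0 (sqrt (S (\<tau> + t)))"
      by simp
  qed
  \<comment> \<open>The limit of strict inequalities gives only the closed disk; openness of
    \<open>D t\<close> removes its boundary circle.\<close>
  moreover have "open (D t)"
    using growth t by (auto simp: elliptic_growth_def)
  ultimately have "D t \<subseteq> ball 0 (sqrt (S (\<tau> + t)))"
    using interior_maximal[of "D t" "cball 0 (sqrt (S (\<tau> + t)))"] by simp
  moreover have "ball 0 (sqrt (S (\<tau> + t))) \<subseteq> D t"
  proof
    fix y :: complex assume "y \<in> ball 0 (sqrt (S (\<tau> + t)))"
    then have y: "cmod y < sqrt (S (\<tau> + t))"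
      by simp
    have "((\<lambda>e. sqrt (S (\<tau> + e + (1 + e) * t))) \<longlongrightarrow> sqrt (S (\<tau> + t))) (at_left 0)"
      using lim by (intro tendsto_real_sqrt) (auto intro: tendsto_within_subset)
    then have "\<forall>\<^sub>F e in at_left 0. cmod y < sqrt (S (\<tau> + e + (1 + e) * t))"
      using y by (rule order_tendstoD)
    moreover have "\<forall>\<^sub>F e in at_left 0. S (\<tau> + e) > 0"
    proof (rule order_tendstoD)
      show "((\<lambda>e. S (\<tau> + e)) \<longlongrightarrow> S \<tau>) (at_left 0)"
        using lim0 by (rule tendsto_within_subset) simp
      show "0 < S \<tau>"
        using R0 by simp
    qed
    \<comment> \<open>The bound -1 keeps the factor \<open>1 + e\<close> positive, so that the inner
      barrier still grows.\<close>
    moreover have "\<forall>\<^sub>F e in at_left 0. e \<in> {-1<..<0::real}"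
      by (intro eventually_at_leftI[of "-1"]) auto
    ultimately have "\<forall>\<^sub>F e::real in at_left 0. y \<in> D t"
    proof eventually_elim
      case (elim e)
      have "ball 0 (sqrt (S (\<tau> + e + (1 + e) * t))) \<subseteq> D t"
        by (rule elliptic_growth_inner_barrier[OF growth D0 S mono R0 _ _ _ _ t]) (use elim in auto)
      then show ?case
        using elim by auto
    qed
    then show "y \<in> D t"
      by simp
  qed
  ultimately show ?thesis
    by blast
qed

end

text \<open>Only the initial domain is prescribed to be a disk: the second half derives that every
  later domain is one, and the first half guarantees that such an evolution exists at all. The
  derivative within the time interval is one-sided at time 0.\<close>

theorem theorem3p6:
  fixes lam u :: "complex \<Rightarrow> real" and R0 :: real
  assumes "smooth_on lam UNIV"
    and "\<And>z. lam z > 0"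
    and "\<And>z z'. cmod z = cmod z' \<Longrightarrow> lam z = lam z'"
    and "\<And>r s. 0 \<le> r \<Longrightarrow> r \<le> s \<Longrightarrow> lam (complex_of_real r) \<le> lam (complex_of_real s)"
    and "\<And>z. u z = laplacian (\<lambda>y. sqrt (lam y)) z / sqrt (lam z)"
    and "R0 > 0"
  shows "(\<exists>T>0. \<exists>D. elliptic_growth u 0 {0..<T} D \<and> D 0 = ball 0 R0) \<and>
    (\<forall>T>0. \<forall>D. elliptic_growth u 0 {0..<T} D \<and> D 0 = ball 0 R0 \<longrightarrow>
       (\<exists>R. R 0 = R0 \<and>
          (\<forall>t\<in>{0..<T}. R t > 0 \<and> D t = ball 0 (R t)) \<and>
          strict_mono_on {0..<T} R \<and>
          (\<forall>t\<in>{0..<T}. ((\<lambda>s. measure lebesgue (D s)) has_real_derivative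
             sqrt (lam 0) / sqrt (lam (complex_of_real (R t)))) (at t within {0..<T}))))"
proof -
  have "Ck_on 2 (\<lambda>z. sqrt (lam z)) UNIV"
    using assms(1,2) by (intro Ck_on_2_sqrt) (simp_all add: smooth_on_def)
  then obtain G H where C2: "C2_on (\<lambda>z. sqrt (lam z)) G H UNIV"
    using Ck_on_2_iff by blast
  interpret radial_potential "\<lambda>z. sqrt (lam z)" G H u
  proof
    show "sqrt (lam z) = sqrt (lam z')" if "cmod z = cmod z'" for z z'
      using assms(3)[OF that] by simp
    show "sqrt (lam (complex_of_real r)) \<le> sqrt (lam (complex_of_real s))" if "0 \<le> r" "r \<le> s" for r s
      using assms(4)[OF that] by simp
  qed (simp_all add: C2 assms(2) assms(5))
  obtain S where S: "\<And>\<tau>. (S has_real_derivative 2 * c0 / sqrt (lam (complex_of_real (sqrt (S \<tau>))))) (at \<tau>)"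
    and mono: "strict_mono S" and "surj S"
    using squared_radius_flow by blast
  \<comment> \<open>\<open>S\<close> is a fixed solution of an autonomous equation, so prescribing
    the initial radius amounts to a shift of time.\<close>
  obtain \<tau> where \<tau>: "S \<tau> = R0\<^sup>2"
    using \<open>surj S\<close> by (metis surjD)
  define R where "R = (\<lambda>t. sqrt (S (\<tau> + t)))"
  have S_pos: "S (\<tau> + t) > 0" if "t \<ge> 0" for t
    using strict_mono_less_eq[OF mono, of \<tau> "\<tau> + t"] that \<tau> assms(6) zero_less_power[of R0 2] by linarith
  have R0: "R 0 = R0"
    using \<tau> assms(6) by (simp add: R_def)
  show ?thesis
  proof (intro conjI allI impI)
    have "elliptic_growth u 0 {0..<1} (\<lambda>t. ball 0 (R t))"
      unfolding R_def using disks_elliptic_growth[OF S mono] S_pos[of 0] by simp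
    then show "\<exists>T>0. \<exists>D. elliptic_growth u 0 {0..<T} D \<and> D 0 = ball 0 R0"
      using R0 by (intro exI[of _ 1]) auto
  next
    fix T :: real and D
    assume "T > 0" and D: "elliptic_growth u 0 {0..<T} D \<and> D 0 = ball 0 R0"
    have Dt: "D t = ball 0 (R t)" if "t \<in> {0..<T}" for t
      unfolding R_def using D by (intro elliptic_growth_unique[OF _ _ S mono \<tau> assms(6) that]) auto
    have area: "measure lebesgue (D t) = pi * S (\<tau> + t)" if "t \<in> {0..<T}" for t
      using S_pos[of t] that by (simp add: Dt content_ball unit_ball_vol_2 R_def)
    have "((\<lambda>s. measure lebesgue (D s)) has_real_derivative
        sqrt (lam 0) / sqrt (lam (complex_of_real (R t)))) (at t within {0..<T})" if t: "t \<in> {0..<T}" for t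
    proof (rule has_field_derivative_transform_within[of _ _ _ _ 1])
      \<comment> \<open>As \<open>2 * pi * c0\<close> is the square root of \<open>lam 0\<close>,
        the factor \<open>pi\<close> from the area of a disk turns the rate of the squared radius
        into the stated quotient.\<close>
      have "((\<lambda>s. pi * S (\<tau> + s)) has_real_derivative
          pi * (2 * c0 / sqrt (lam (complex_of_real (R t))) * 1)) (at t within {0..<T})"
        unfolding R_def
        by (intro DERIV_cmult DERIV_chain2[OF S]) (auto intro!: derivative_eq_intros)
      then show "((\<lambda>s. pi * S (\<tau> + s)) has_real_derivative
          sqrt (lam 0) / sqrt (lam (complex_of_real (R t)))) (at t within {0..<T})"
        by (simp add: c0_def)
    qed (use t area in auto)
    moreover have "strict_mono_on {0..<T} R"
      using mono by (auto simp: R_def strict_mono_on_def strict_mono_less)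
    moreover have "R t > 0" if "t \<in> {0..<T}" for t
      using S_pos[of t] that by (simp add: R_def)
    ultimately show "\<exists>R. R 0 = R0 \<and> (\<forall>t\<in>{0..<T}. R t > 0 \<and> D t = ball 0 (R t)) \<and>
          strict_mono_on {0..<T} R \<and>
          (\<forall>t\<in>{0..<T}. ((\<lambda>s. measure lebesgue (D s)) has_real_derivative
             sqrt (lam 0) / sqrt (lam (complex_of_real (R t)))) (at t within {0..<T}))"
      using R0 Dt by (intro exI[of _ R]) blast
  qed
qed

end
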